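(* Suppose $x\in(S_{\mathcal{M}_L})_{\geq0}$ and $\operatorname{Meas}_L(T)=x$. Then the Le-coordinates of $x$ may be written in the alternate form \[ T_B= \begin{cases} 0 & \text{if $P_{M(B)}(x)=0$;}\\ \prod_{L_{C}=+}(P_{M(C)}(x))^{\varepsilon(C)} & \text{if $P_{M(B)}(x)\neq 0$,} \end{cases} \] where $\varepsilon(C)=[\varepsilon_{U_F}(C)-\varepsilon_{U_F'}(C)]-[\varepsilon_{D_F}(C)-\varepsilon_{D_F'}(C)]$.
   Context: $\operatorname{Gr}_{kn}$ is the Grassmannian of $k$-planes in $\mathbb{R}^n$ with Pl\"ucker coordinates $P_J$; $(\operatorname{Gr}_{kn})_{\geq0}$ its totally nonnegative part. A Le-diagram $L$ is a partition $\lambda$ in a $k\times(n-k)$ rectangle with boxes filled by $0$ and $+$ so that no $0$ has a $+$ above it in its column and a $+$ to its left in its row; a Le-tableau $T\in\mathbf{T}_L$ replaces the $+$ entries by positive reals (Le-coordinates). Box $B=(r,c)$: $r$-th row from top, $c$-th column from right. Label the steps of the southeast border of $\lambda$ by $1,\dots,n$; south steps are sources $I=\{i_1<\dots<i_k\}$, west steps are sinks $j_1<\dots<j_{n-k}$. The $\Gamma$-graph $G_L$ consists of, for each $B=(r,c)$ with $L_B=+$, the $B$ hook with corner at the northwest corner of $B$, horizontal path directed from $i_r$ to the corner, vertical path directed from the corner to $j_c$. $\mathcal{M}_L$ is the set of $J$ reachable from $I$ by non-intersecting path collections in $G_L$, and $(S_{\mathcal{M}_L})_{\geq0}$ is the set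 of $x\in(\operatorname{Gr}_{kn})_{\geq0}$ with $P_J(x)\ne0$ iff $J\in\mathcal{M}_L$. The $\Gamma$-network $N_T$ assigns weight $T_B$ to the face $F(B)$ with northwest corner $B$ and weight $\prod1/T_B$ to the face bounded by the disk boundary; $P_J(\operatorname{Meas}_L(T))=\sum_A\prod_{i}\operatorname{wt}(A_i)$ over non-intersecting path families $A$ from $I$ to $J$, $\operatorname{wt}(A_i)$ being the product of weights of faces southeast of $A_i$. For a box $B=(r,c)$: $A_{r,c}=[n]\setminus\{i_r+1,\dots,j_c-1\}$, $M'(B)=\operatorname{lexmax}\{J\in\mathcal{M}_L: J\cap A_{r,c}=I\cap A_{r,c}\}$, $M(B)=(M'(B)\setminus\{i_r\})\cup\{j_c\}$. A generalized path is a collection $W$ of pairwise disjoint paths in $G_L$, none lying southeast of another; its outer corners $\mathcal{OC}(W)$ are boxes whose northern and western boundaries are both edges of $W$, and its inner corners $\mathcal{IC}(W)$ are boxes whose northwest boundary is formed by portions of the hooks of two consecutive outer corners. Set $\varepsilon_W(C)=1$ if $C\in\mathcal{OC}(W)$, $-1$ if $C\in\mathcal{IC}(W)$, $0$ otherwise. For $B$ with $L_B=+$ and $F=F(B)$: $U_F$ is the $F$ hook (the $B$ hook), $D_F$ is the unique generalized path weakly under $U_F$ forming the southeastern boundary of $F$, and $U_F'$, $D_F'$ are the northwest-most generalized paths lying strictly southeast of $U_F$, $D_F$ respectively. *)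

theory Defs
  imports
    "Jordan_Normal_Form.VS_Connect"
    "Jordan_Normal_Form.Determinant"
    "Jordan_Normal_Form.DL_Submatrix"
begin

section \<open>The Grassmannian and its Pluecker coordinates\<close>

definition grassmannian :: "nat \<Rightarrow> nat \<Rightarrow> real vec set set" where
  "grassmannian k n =
     {x. VectorSpace.subspace class_ring x (module_vec TYPE(real) n) \<and>
         vectorspace.dim class_ring ((module_vec TYPE(real) n)\<lparr>carrier := x\<rparr>) = k}"

definition k_subsets :: "nat \<Rightarrow> nat \<Rightarrow> nat set set" where
  "k_subsets k n = {J. J \<subseteq> {1..n} \<and> card J = k}"

text \<open>Pluecker coordinates are homogeneous: they are the maximal minors of any \<open>k \<times> n\<close> matrix with
  row space \<open>x\<close>, and another choice of matrix multiplies all of them by one nonzero factor.  We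
  fix one such matrix; whatever is said below about \<open>plucker\<close> is invariant under a common nonzero
  factor.  Labels are \<open>1,\<dots>,n\<close> whereas the columns of a matrix are numbered from \<open>0\<close>.\<close>

definition plucker :: "nat \<Rightarrow> nat \<Rightarrow> real vec set \<Rightarrow> nat set \<Rightarrow> real" where
  "plucker k n x J =
     det (submatrix (SOME A. A \<in> carrier_mat k n \<and> vec_space.row_space n A = x)
           UNIV {j. Suc j \<in> J})"

definition tnn_grassmannian :: "nat \<Rightarrow> nat \<Rightarrow> real vec set set" where
  "tnn_grassmannian k n =
     {x \<in> grassmannian k n. \<exists>a. a \<noteq> 0 \<and> (\<forall>J\<in>k_subsets k n. 0 \<le> a * plucker k n x J)}"

definition tnn_cell :: "nat \<Rightarrow> nat \<Rightarrow> nat set set \<Rightarrow> real vec set set" where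
  "tnn_cell k n M =
     {x \<in> tnn_grassmannian k n. \<forall>J\<in>k_subsets k n. plucker k n x J \<noteq> 0 \<longleftrightarrow> J \<in> M}"


section \<open>Le-diagrams\<close>

text \<open>A box \<open>(r, c)\<close> lies in the \<open>r\<close>-th row from the top and in the \<open>c\<close>-th column from the
  \<^emph>\<open>right\<close> of the \<open>k \<times> (n - k)\<close> rectangle, both counted from \<open>1\<close>; rows of the partition are
  left-justified, so \<open>c + 1\<close> is the column to the left of \<open>c\<close>.\<close>

type_synonym box = "nat \<times> nat"

record le_diagram =
  dim_k :: nat
  dim_n :: nat
  row_len :: "nat \<Rightarrow> nat"
  plus_boxes :: "box set"

definition width :: "le_diagram \<Rightarrow> nat" where
  "width L = dim_n L - dim_k L"

definition boxes :: "le_diagram \<Rightarrow> box set" where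
  "boxes L = {(r, c). 1 \<le> r \<and> r \<le> dim_k L \<and> width L - row_len L r < c \<and> c \<le> width L}"

definition is_le_diagram :: "le_diagram \<Rightarrow> bool" where
  "is_le_diagram L \<longleftrightarrow>
     dim_k L \<le> dim_n L \<and>
     (\<forall>r\<in>{1..dim_k L}. row_len L r \<le> width L) \<and>
     (\<forall>r\<in>{1..dim_k L}. \<forall>r'\<in>{1..dim_k L}. r \<le> r' \<longrightarrow> row_len L r' \<le> row_len L r) \<and>
     plus_boxes L \<subseteq> boxes L \<and>
     (\<forall>(r, c) \<in> boxes L - plus_boxes L.
        \<not> ((\<exists>r'<r. (r', c) \<in> plus_boxes L) \<and> (\<exists>c'>c. (r, c') \<in> plus_boxes L)))"

definition is_le_tableau :: "le_diagram \<Rightarrow> (box \<Rightarrow> real) \<Rightarrow> bool" where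
  "is_le_tableau L T \<longleftrightarrow>
     (\<forall>B\<in>plus_boxes L. 0 < T B) \<and> (\<forall>B \<in> boxes L - plus_boxes L. T B = 0)"

definition col_height :: "le_diagram \<Rightarrow> nat \<Rightarrow> nat" where
  "col_height L c = card {r. (r, c) \<in> boxes L}"

text \<open>The labels \<open>i_r\<close> and \<open>j_c\<close> of the steps of the southeast border, read from the northeast to
  the southwest corner of the rectangle: the south step of row \<open>r\<close> is preceded by \<open>r - 1\<close> south
  and \<open>(n - k) - \<lambda>\<^sub>r\<close> west steps, the west step of column \<open>c\<close> by \<open>c - 1\<close> west steps and by the south
  steps of the rows that meet column \<open>c\<close>.\<close>

definition source :: "le_diagram \<Rightarrow> nat \<Rightarrow> nat" where
  "source L r = r + (width L - row_len L r)"

definition sink :: "le_diagram \<Rightarrow> nat \<Rightarrow> nat" where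
  "sink L c = c + col_height L c"

definition sources :: "le_diagram \<Rightarrow> nat set" where
  "sources L = source L ` {1..dim_k L}"

definition sinks :: "le_diagram \<Rightarrow> nat set" where
  "sinks L = sink L ` {1..width L}"


section \<open>The Gamma-graph and its paths\<close>

text \<open>Hooks run along the grid lines, so the graph is drawn with unit edges: \<open>Corner r c\<close> is the
  northwest corner of box \<open>(r, c)\<close>, and \<open>Bdry m\<close> is the boundary vertex on border step \<open>m\<close>.  (A
  sink and the following source may sit at the same lattice point of the border; they are distinct
  vertices.)  Subdividing edges at the corners of boxes without a \<open>+\<close> affects neither reachability
  nor disjointness of paths.\<close>

datatype vertex = Bdry nat | Corner nat nat

fun north_edge :: "le_diagram \<Rightarrow> box \<Rightarrow> vertex \<times> vertex" where
  "north_edge L (r, c) =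
     (if (r, c - 1) \<in> boxes L then Corner r (c - 1) else Bdry (source L r), Corner r c)"

fun west_edge :: "le_diagram \<Rightarrow> box \<Rightarrow> vertex \<times> vertex" where
  "west_edge L (r, c) =
     (Corner r c, if (r + 1, c) \<in> boxes L then Corner (r + 1) c else Bdry (sink L c))"

fun hook_path :: "le_diagram \<Rightarrow> box \<Rightarrow> vertex list" where
  "hook_path L (r, c) =
     [Bdry (source L r)]
     @ map (\<lambda>c'. Corner r c') [width L - row_len L r + 1 ..< c + 1]
     @ map (\<lambda>r'. Corner r' c) [r + 1 ..< col_height L c + 1]
     @ [Bdry (sink L c)]"

definition path_edges :: "vertex list \<Rightarrow> (vertex \<times> vertex) set" where
  "path_edges p = set (zip p (tl p))"

definition gamma_graph :: "le_diagram \<Rightarrow> (vertex \<times> vertex) set" where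
  "gamma_graph L = (\<Union>B\<in>plus_boxes L. path_edges (hook_path L B))"

definition is_path :: "le_diagram \<Rightarrow> vertex list \<Rightarrow> bool" where
  "is_path L p \<longleftrightarrow> p \<noteq> [] \<and> successively (\<lambda>u v. (u, v) \<in> gamma_graph L) p"

text \<open>Paths run from the border westwards and southwards back to the border; a box lies southeast
  of one iff it is weakly below and weakly to the right of some vertex of the path.\<close>

definition southeast :: "le_diagram \<Rightarrow> vertex list \<Rightarrow> box set" where
  "southeast L p =
     {(a, b) \<in> boxes L. \<exists>r c. Corner r c \<in> set p \<and> r \<le> a \<and> b \<le> c}"

text \<open>Non-intersecting path families from the set of all sources to \<open>J\<close>.  A source lying in \<open>J\<close>
  is necessarily joined to itself by the trivial path, since no edge enters it.\<close>

definition path_families :: "le_diagram \<Rightarrow> nat set \<Rightarrow> vertex list set set" where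
  "path_families L J =
     {A. (\<forall>p\<in>A. is_path L p) \<and>
         (\<forall>p\<in>A. \<forall>q\<in>A. p \<noteq> q \<longrightarrow> set p \<inter> set q = {}) \<and>
         hd ` A = Bdry ` sources L \<and> last ` A = Bdry ` J}"

definition le_matroid :: "le_diagram \<Rightarrow> nat set set" where
  "le_matroid L = {J \<in> k_subsets (dim_k L) (dim_n L). path_families L J \<noteq> {}}"


section \<open>Faces, weights and the boundary measurement map\<close>

text \<open>The disk is cut into unit cells: the boxes of the partition, together with an L-shaped strip
  of cells (row \<open>0\<close> and column \<open>n - k + 1\<close>) for the part of the disk northwest of the partition.
  Faces are the classes of cells connected without crossing an edge of the graph.\<close>

definition cells :: "le_diagram \<Rightarrow> box set" where
  "cells L = boxes L \<union> {0} \<times> {1..width L + 1} \<union> {0..dim_k L} \<times> {width L + 1}"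

definition open_steps :: "le_diagram \<Rightarrow> (box \<times> box) set" where
  "open_steps L =
     {((r, c), (r, c + 1)) | r c.
        (r, c) \<in> cells L \<and> (r, c + 1) \<in> cells L \<and> west_edge L (r, c) \<notin> gamma_graph L} \<union>
     {((r + 1, c), (r, c)) | r c.
        (r + 1, c) \<in> cells L \<and> (r, c) \<in> cells L \<and> north_edge L (r + 1, c) \<notin> gamma_graph L}"

definition face_of :: "le_diagram \<Rightarrow> box \<Rightarrow> box set" where
  "face_of L B = {C. (B, C) \<in> (open_steps L \<union> (open_steps L)\<inverse>)\<^sup>*}"

definition faces :: "le_diagram \<Rightarrow> box set set" where
  "faces L = face_of L ` cells L"

definition face_weight :: "le_diagram \<Rightarrow> (box \<Rightarrow> real) \<Rightarrow> box set \<Rightarrow> real" where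
  "face_weight L T \<Phi> =
     (if \<exists>B\<in>plus_boxes L. \<Phi> = face_of L B
      then T (THE B. B \<in> plus_boxes L \<and> \<Phi> = face_of L B)
      else (\<Prod>B\<in>plus_boxes L. 1 / T B))"

definition path_weight :: "le_diagram \<Rightarrow> (box \<Rightarrow> real) \<Rightarrow> vertex list \<Rightarrow> real" where
  "path_weight L T p = (\<Prod>\<Phi> \<in> {\<Phi> \<in> faces L. \<Phi> \<subseteq> southeast L p}. face_weight L T \<Phi>)"

definition meas_coord :: "le_diagram \<Rightarrow> (box \<Rightarrow> real) \<Rightarrow> nat set \<Rightarrow> real" where
  "meas_coord L T J = (\<Sum>A \<in> path_families L J. \<Prod>p\<in>A. path_weight L T p)"

text \<open>\<open>is_meas L T x\<close> says \<open>Meas\<^sub>L(T) = x\<close>.  A point of the Grassmannian is determined by its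
  homogeneous Pluecker coordinates.\<close>

definition is_meas :: "le_diagram \<Rightarrow> (box \<Rightarrow> real) \<Rightarrow> real vec set \<Rightarrow> bool" where
  "is_meas L T x \<longleftrightarrow>
     x \<in> grassmannian (dim_k L) (dim_n L) \<and>
     (\<exists>a. a \<noteq> 0 \<and> (\<forall>J \<in> k_subsets (dim_k L) (dim_n L).
        plucker (dim_k L) (dim_n L) x J = a * meas_coord L T J))"

text \<open>The Pluecker coordinates scaled so that \<open>P\<^sub>I = 1\<close> for the set \<open>I\<close> of sources, which is the
  scaling of \<open>meas_coord\<close> (the only family from \<open>I\<close> to \<open>I\<close> consists of trivial paths).\<close>

definition P :: "le_diagram \<Rightarrow> real vec set \<Rightarrow> nat set \<Rightarrow> real" where
  "P L x J = plucker (dim_k L) (dim_n L) x J / plucker (dim_k L) (dim_n L) x (sources L)"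


section \<open>The index sets \<open>M(B)\<close>\<close>

definition lexmax :: "nat set set \<Rightarrow> nat set" where
  "lexmax \<J> = (THE J. J \<in> \<J> \<and>
     (\<forall>K\<in>\<J>. K \<noteq> J \<longrightarrow>
        (sorted_list_of_set K, sorted_list_of_set J) \<in> lexord {(a, b). a < b}))"

fun A_set :: "le_diagram \<Rightarrow> box \<Rightarrow> nat set" where
  "A_set L (r, c) = {1..dim_n L} - {source L r + 1 .. sink L c - 1}"

definition M' :: "le_diagram \<Rightarrow> box \<Rightarrow> nat set" where
  "M' L B = lexmax {J \<in> le_matroid L. J \<inter> A_set L B = sources L \<inter> A_set L B}"

definition M :: "le_diagram \<Rightarrow> box \<Rightarrow> nat set" where
  "M L B = (M' L B - {source L (fst B)}) \<union> {sink L (snd B)}"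


section \<open>Generalized paths\<close>

text \<open>The empty generalized path is admitted: \<open>D_F\<close>, \<open>U_F'\<close> and \<open>D_F'\<close> may be empty.\<close>

definition generalized_path :: "le_diagram \<Rightarrow> vertex list set \<Rightarrow> bool" where
  "generalized_path L W \<longleftrightarrow>
     (\<forall>p\<in>W. is_path L p \<and> hd p \<in> Bdry ` sources L \<and> last p \<in> Bdry ` sinks L) \<and>
     (\<forall>p\<in>W. \<forall>q\<in>W. p \<noteq> q \<longrightarrow>
        set p \<inter> set q = {} \<and> \<not> southeast L p \<subseteq> southeast L q)"

definition gp_edges :: "vertex list set \<Rightarrow> (vertex \<times> vertex) set" where
  "gp_edges W = (\<Union>p\<in>W. path_edges p)"

definition gp_southeast :: "le_diagram \<Rightarrow> vertex list set \<Rightarrow> box set" where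
  "gp_southeast L W = (\<Union>p\<in>W. southeast L p)"

definition outer_corners :: "le_diagram \<Rightarrow> vertex list set \<Rightarrow> box set" where
  "outer_corners L W =
     {C \<in> boxes L. north_edge L C \<in> gp_edges W \<and> west_edge L C \<in> gp_edges W}"

text \<open>The outer corners of a generalized path are linearly ordered from northeast to southwest,
  hence by their rows.\<close>

definition consecutive_corners :: "le_diagram \<Rightarrow> vertex list set \<Rightarrow> box \<Rightarrow> box \<Rightarrow> bool" where
  "consecutive_corners L W C D \<longleftrightarrow>
     C \<in> outer_corners L W \<and> D \<in> outer_corners L W \<and> fst C < fst D \<and>
     \<not> (\<exists>E \<in> outer_corners L W. fst C < fst E \<and> fst E < fst D)"

text \<open>At an inner corner the northern boundary belongs to the hook of the more southwestern of the
  two outer corners, the western boundary to the hook of the other one.\<close>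

definition inner_corners :: "le_diagram \<Rightarrow> vertex list set \<Rightarrow> box set" where
  "inner_corners L W =
     {X \<in> boxes L. \<exists>C D. consecutive_corners L W C D \<and>
        north_edge L X \<in> path_edges (hook_path L D) \<and>
        west_edge L X \<in> path_edges (hook_path L C)}"

definition eps_gp :: "le_diagram \<Rightarrow> vertex list set \<Rightarrow> box \<Rightarrow> int" where
  "eps_gp L W C =
     (if C \<in> outer_corners L W then 1 else if C \<in> inner_corners L W then - 1 else 0)"

definition strictly_southeast :: "le_diagram \<Rightarrow> vertex list set \<Rightarrow> vertex list set \<Rightarrow> bool" where
  "strictly_southeast L W V \<longleftrightarrow>
     gp_southeast L V \<subseteq> gp_southeast L W \<and> (\<forall>p\<in>W. \<forall>q\<in>V. set p \<inter> set q = {})"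

definition next_gp :: "le_diagram \<Rightarrow> vertex list set \<Rightarrow> vertex list set" where
  "next_gp L W = (THE V. generalized_path L V \<and> strictly_southeast L W V \<and>
     (\<forall>V'. generalized_path L V' \<and> strictly_southeast L W V' \<longrightarrow>
        gp_southeast L V' \<subseteq> gp_southeast L V))"

definition U_path :: "le_diagram \<Rightarrow> box \<Rightarrow> vertex list set" where
  "U_path L B = {hook_path L B}"

text \<open>\<open>D_F\<close> lies weakly under \<open>U_F\<close>, and the region between the two is exactly the face \<open>F\<close>.
  (Parts of the southeastern boundary of \<open>F\<close> may lie on the border rather than on \<open>D_F\<close>.)\<close>

definition D_path :: "le_diagram \<Rightarrow> box \<Rightarrow> vertex list set" where
  "D_path L B = (THE W. generalized_path L W \<and>
     gp_southeast L W \<subseteq> gp_southeast L (U_path L B) \<and>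
     gp_southeast L (U_path L B) - gp_southeast L W = face_of L B)"

text \<open>The exponent \<open>\<epsilon>(C)\<close> for the face \<open>F = F(B)\<close>.\<close>

definition eps :: "le_diagram \<Rightarrow> box \<Rightarrow> box \<Rightarrow> int" where
  "eps L B C =
     (eps_gp L (U_path L B) C - eps_gp L (next_gp L (U_path L B)) C)
     - (eps_gp L (D_path L B) C - eps_gp L (next_gp L (D_path L B)) C)"

end

theory Submission
  imports Defs
begin

text \<open>A generalized path \<open>W\<close> is encoded by the set \<open>X\<close> of boxes southeast of it, and \<open>depth X b\<close>
  is the length of a longest chain of \<open>+\<close> boxes of \<open>X\<close>, strictly increasing towards the southeast
  and ending weakly northwest of \<open>b\<close>.  The Le-property makes the depth modular in \<open>X\<close>: the join of
  two \<open>+\<close> boxes with a common southeast box is again a \<open>+\<close> box, so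
  \<open>depth (X \<inter> Y) = min (depth X) (depth Y)\<close>.  Among all families of disjoint paths running in \<open>X\<close>
  one covers every box \<open>b\<close> exactly \<open>depth X b\<close> times, which is the maximum, and it is determined by
  its endpoints.  For \<open>X\<close> the region weakly southeast of a \<open>+\<close> box \<open>B\<close> it is the only family with
  endpoints \<open>M(B)\<close>, so \<open>P\<^bsub>M(B)\<^esub>\<close> is the monomial with exponents \<open>depth X\<close>; if \<open>B\<close> has no \<open>+\<close>, no
  family reaches \<open>M(B)\<close>.  By modularity the signed sum over the corners of \<open>W\<close> of these exponents is
  the depth function of \<open>W\<close>; passing to the next generalized path lowers it by one on \<open>X\<close>, and the
  difference between \<open>U\<^sub>F\<close> and \<open>D\<^sub>F\<close> is the face \<open>F\<close>.\<close>

text \<open>Families are compared through their height functions, which count the paths that have a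
  given box on their southeast side. The jumps of the height across the sides of a box are the edges
  of the family, and disjointness says that the height grows by at most one along a diagonal. The
  Le-property acts through its contrapositive: a box without \<open>+\<close> has no edge on its
  northern or none on its western side, so heights and depths are copied there from a neighbour and
  all comparisons reduce to \<open>+\<close> boxes. The obstacle is that \<open>M'\<close> is a
  lexicographic maximum, while the argument produces maximal heights. Counting links the two: for a
  family from the sources to \<open>J\<close>, the paths straddling a point of the southeast border
  are counted by a height there, and also by the excess of the sources over the elements of
  \<open>J\<close> up to that point. Larger heights thus mean fewer small labels in
  \<open>J\<close>. Exchanging the source of \<open>B\<close> for its sink lowers the count of
  labels by one exactly along the border of the region of \<open>B\<close>; this is matched by the
  \<open>+\<close> of \<open>B\<close>, which prolongs every chain by one.\<close>

declare north_edge.simps [simp del] west_edge.simps [simp del] hook_path.simps [simp del]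

section \<open>Le-diagrams and the depth function\<close>

locale le_diag =
  fixes L :: le_diagram
  assumes le: "is_le_diagram L"
begin

text \<open>Columns are numbered from the right while rows are left-justified, so a row misses the
  columns with the smallest numbers.\<close>

definition offset :: "nat \<Rightarrow> nat" where
  "offset r = width L - row_len L r"

lemma boxes_iff: "(r, c) \<in> boxes L \<longleftrightarrow> 1 \<le> r \<and> r \<le> dim_k L \<and> offset r < c \<and> c \<le> width L"
  by (simp add: boxes_def offset_def)

lemma offset_mono: "1 \<le> r \<Longrightarrow> r \<le> r' \<Longrightarrow> r' \<le> dim_k L \<Longrightarrow> offset r \<le> offset r'"
  using le unfolding is_le_diagram_def offset_def by (simp add: diff_le_mono2)

lemma boxes_nw:
  "(r, c) \<in> boxes L \<Longrightarrow> 1 \<le> r' \<Longrightarrow> r' \<le> r \<Longrightarrow> c \<le> c' \<Longrightarrow> c' \<le> width L \<Longrightarrow> (r', c') \<in> boxes L"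
  using offset_mono[of r' r] by (auto simp: boxes_iff)

lemma boxesD: "(r, c) \<in> boxes L \<Longrightarrow> 1 \<le> r \<and> r \<le> dim_k L \<and> 1 \<le> c \<and> c \<le> width L"
  by (auto simp: boxes_iff)

lemma finite_boxes: "finite (boxes L)"
  by (rule finite_subset[of _ "{1..dim_k L} \<times> {1..width L}"]) (auto simp: boxes_iff)

text \<open>A column meets the diagram in an initial segment of rows, by \<open>boxes_nw\<close>,
  and such a segment is determined by its size.\<close>

lemma boxes_col: "(r, c) \<in> boxes L \<longleftrightarrow> 1 \<le> c \<and> c \<le> width L \<and> 1 \<le> r \<and> r \<le> col_height L c"
proof (cases "1 \<le> c \<and> c \<le> width L")
  case True
  define S where "S = {r. (r, c) \<in> boxes L}"
  have fin: "finite S"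
    by (rule finite_subset[of _ "{1..dim_k L}"]) (auto simp: S_def boxes_iff)
  have S1: "S \<subseteq> {1..}" by (auto simp: S_def boxes_iff)
  have "S = {1..card S}"
  proof (cases "S = {}")
    case False
    define m where "m = Max S"
    have m: "m \<in> S" using False fin by (simp add: m_def)
    have "S = {1..m}"
    proof
      show "S \<subseteq> {1..m}" using S1 fin by (auto simp: m_def)
      show "{1..m} \<subseteq> S" using m True boxes_nw[of m c _ c] by (auto simp: S_def)
    qed
    then show ?thesis by simp
  qed simp
  moreover have "card S = col_height L c" by (simp add: S_def col_height_def)
  ultimately have "S = {1..col_height L c}" by simp
  then have "(r, c) \<in> boxes L \<longleftrightarrow> r \<in> {1..col_height L c}" unfolding S_def by (metis mem_Collect_eq)
  then show ?thesis using True by simp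
qed (auto simp: boxes_iff)

lemma plus_boxes_subset: "plus_boxes L \<subseteq> boxes L"
  using le by (auto simp: is_le_diagram_def)

lemma finite_plus_boxes: "finite (plus_boxes L)"
  using plus_boxes_subset finite_boxes by (rule finite_subset)

text \<open>The hook of \<open>(r, c')\<close> covers the northern sides of the boxes of row
  \<open>r\<close> up to its corner, so this is the condition for the northern side of
  \<open>(r, c)\<close> to be an edge of the graph; \<open>col_plus\<close> does the same for the
  western side.\<close>

definition row_plus :: "nat \<Rightarrow> nat \<Rightarrow> bool" where
  "row_plus r c \<longleftrightarrow> (\<exists>c'\<ge>c. (r, c') \<in> plus_boxes L)"

definition col_plus :: "nat \<Rightarrow> nat \<Rightarrow> bool" where
  "col_plus r c \<longleftrightarrow> (\<exists>r'\<le>r. (r', c) \<in> plus_boxes L)"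

text \<open>The entrance of the Le-condition. Its contrapositive is the form that matters: a box
  without \<open>+\<close> lacks the edge on its northern side or the one on its western
  side.\<close>

lemma le_property:
  assumes "(r, c) \<in> boxes L" "row_plus r c" "col_plus r c"
  shows "(r, c) \<in> plus_boxes L"
proof (rule ccontr)
  assume n: "(r, c) \<notin> plus_boxes L"
  obtain c' where c': "c' \<ge> c" "(r, c') \<in> plus_boxes L" using assms(2) by (auto simp: row_plus_def)
  obtain r' where r': "r' \<le> r" "(r', c) \<in> plus_boxes L" using assms(3) by (auto simp: col_plus_def)
  have "c' \<noteq> c" "r' \<noteq> r" using n c' r' by auto
  then have "(\<exists>r'<r. (r', c) \<in> plus_boxes L) \<and> (\<exists>c'>c. (r, c') \<in> plus_boxes L)"
    using c' r' by (metis le_neq_implies_less)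
  moreover have "\<forall>(r, c) \<in> boxes L - plus_boxes L.
        \<not> ((\<exists>r'<r. (r', c) \<in> plus_boxes L) \<and> (\<exists>c'>c. (r, c') \<in> plus_boxes L))"
    using le by (simp add: is_le_diagram_def)
  ultimately show False using n assms(1) by blast
qed

lemma row_plus_mono: "row_plus r c \<Longrightarrow> c' \<le> c \<Longrightarrow> row_plus r c'"
  unfolding row_plus_def by (meson order_trans)

lemma col_plus_mono: "col_plus r c \<Longrightarrow> r \<le> r' \<Longrightarrow> col_plus r' c"
  unfolding col_plus_def by (meson order_trans)

lemma plus_row_plus: "(r, c) \<in> plus_boxes L \<Longrightarrow> row_plus r c"
  by (auto simp: row_plus_def)

lemma plus_col_plus: "(r, c) \<in> plus_boxes L \<Longrightarrow> col_plus r c"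
  by (auto simp: col_plus_def)

subsection \<open>Edges of the Gamma-graph\<close>

lemma path_edges_Cons: "path_edges (x # y # xs) = insert (x, y) (path_edges (y # xs))"
  by (simp add: path_edges_def)

lemma path_edges_single: "path_edges [x] = {}"
  by (simp add: path_edges_def)

lemma path_edges_append: "path_edges (xs @ a # ys) = path_edges (xs @ [a]) \<union> path_edges (a # ys)"
proof (induction xs)
  case (Cons x xs)
  then show ?case by (cases xs) (auto simp: path_edges_Cons path_edges_single)
qed (simp add: path_edges_single)

lemma row_part_edges:
  assumes "1 \<le> r" "r \<le> dim_k L" "offset r < c" "c \<le> width L"
  shows "path_edges (Bdry (source L r) # map (Corner r) [offset r + 1..<c + 1]) =
    (\<lambda>c'. north_edge L (r, c')) ` {offset r<..c}"
proof -
  have "Suc (offset r) \<le> c" using assms by simp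
  then show ?thesis using assms(4)
  proof (induction c rule: dec_induct)
    case base
    have "(r, offset r) \<notin> boxes L" by (simp add: boxes_iff)
    moreover have "{offset r<..Suc (offset r)} = {Suc (offset r)}" by auto
    ultimately show ?case by (simp add: path_edges_def north_edge.simps)
  next
    case (step c)
    have eq: "[offset r + 1..<Suc c + 1] = [offset r + 1..<c] @ [c, Suc c]"
      using step.hyps by simp
    have eq2: "[offset r + 1..<c + 1] = [offset r + 1..<c] @ [c]"
      using step.hyps by simp
    have "(r, c) \<in> boxes L" using step assms by (simp add: boxes_iff)
    then have e: "north_edge L (r, Suc c) = (Corner r c, Corner r (Suc c))" by (simp add: north_edge.simps)
    have "path_edges (Bdry (source L r) # map (Corner r) [offset r + 1..<Suc c + 1]) =
      path_edges ((Bdry (source L r) # map (Corner r) [offset r + 1..<c]) @ Corner r c # [Corner r (Suc c)])"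
      unfolding eq by simp
    also have "\<dots> = path_edges (Bdry (source L r) # map (Corner r) [offset r + 1..<c + 1]) \<union>
        {(Corner r c, Corner r (Suc c))}"
      unfolding eq2 by (subst path_edges_append) (simp add: path_edges_def)
    also have "\<dots> = (\<lambda>c'. north_edge L (r, c')) ` {offset r<..c} \<union> {north_edge L (r, Suc c)}"
      using step by (simp only: e)
    also have "\<dots> = (\<lambda>c'. north_edge L (r, c')) ` {offset r<..Suc c}"
    proof -
      have "{offset r<..Suc c} = insert (Suc c) {offset r<..c}" using step.hyps by auto
      then show ?thesis by simp
    qed
    finally show ?case .
  qed
qed

lemma col_part_edges:
  assumes "(r, c) \<in> boxes L"
  shows "path_edges (map (\<lambda>r'. Corner r' c) [r..<col_height L c + 1] @ [Bdry (sink L c)]) =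
    (\<lambda>r'. west_edge L (r', c)) ` {r..col_height L c}"
proof -
  have "r \<le> col_height L c" using assms by (simp add: boxes_col)
  then show ?thesis using assms
  proof (induction r rule: inc_induct)
    case base
    have "(col_height L c + 1, c) \<notin> boxes L" by (simp add: boxes_col)
    then show ?case by (simp add: path_edges_def west_edge.simps)
  next
    case (step r)
    have b: "(Suc r, c) \<in> boxes L" using step by (simp add: boxes_col)
    have e: "west_edge L (r, c) = (Corner r c, Corner (Suc r) c)" using b by (simp add: west_edge.simps)
    have eq: "[r..<col_height L c + 1] = r # Suc r # [Suc (Suc r)..<col_height L c + 1]"
      using step.hyps by (simp add: upt_rec)
    have eq2: "[Suc r..<col_height L c + 1] = Suc r # [Suc (Suc r)..<col_height L c + 1]"
      using step.hyps by (simp add: upt_rec)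
    have "path_edges (map (\<lambda>r'. Corner r' c) [r..<col_height L c + 1] @ [Bdry (sink L c)]) =
      insert (Corner r c, Corner (Suc r) c)
       (path_edges (map (\<lambda>r'. Corner r' c) [Suc r..<col_height L c + 1] @ [Bdry (sink L c)]))"
      unfolding eq eq2 by (simp add: path_edges_Cons)
    also have "\<dots> = insert (west_edge L (r, c)) ((\<lambda>r'. west_edge L (r', c)) ` {Suc r..col_height L c})"
      using step.IH[OF b] by (simp only: e)
    also have "\<dots> = (\<lambda>r'. west_edge L (r', c)) ` {r..col_height L c}"
    proof -
      have "{r..col_height L c} = insert r {Suc r..col_height L c}" using step.hyps by auto
      then show ?thesis by simp
    qed
    finally show ?case .
  qed
qed

lemma hook_edges:
  assumes "(r, c) \<in> boxes L"
  shows "path_edges (hook_path L (r, c)) =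
    (\<lambda>c'. north_edge L (r, c')) ` {offset r<..c} \<union> (\<lambda>r'. west_edge L (r', c)) ` {r..col_height L c}"
proof -
  have b: "1 \<le> r" "r \<le> dim_k L" "offset r < c" "c \<le> width L" using assms by (auto simp: boxes_iff)
  have h: "r \<le> col_height L c" using assms by (simp add: boxes_col)
  have e1: "[offset r + 1..<c + 1] = [offset r + 1..<c] @ [c]" using b by simp
  have e2: "[r..<col_height L c + 1] = r # [r + 1..<col_height L c + 1]" using h by (simp add: upt_rec)
  have "hook_path L (r, c) = (Bdry (source L r) # map (Corner r) [offset r + 1..<c]) @ Corner r c #
      (map (\<lambda>r'. Corner r' c) [r + 1..<col_height L c + 1] @ [Bdry (sink L c)])"
    using e1 by (simp add: offset_def hook_path.simps)
  then have "path_edges (hook_path L (r, c)) =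
     path_edges ((Bdry (source L r) # map (Corner r) [offset r + 1..<c]) @ [Corner r c]) \<union>
     path_edges (Corner r c # (map (\<lambda>r'. Corner r' c) [r + 1..<col_height L c + 1] @ [Bdry (sink L c)]))"
    using path_edges_append by metis
  then have "path_edges (hook_path L (r, c)) =
     path_edges (Bdry (source L r) # map (Corner r) [offset r + 1..<c + 1]) \<union>
     path_edges (map (\<lambda>r'. Corner r' c) [r..<col_height L c + 1] @ [Bdry (sink L c)])"
    unfolding e1 e2 by simp
  then show ?thesis using row_part_edges[OF b] col_part_edges[OF assms] by simp
qed

text \<open>From here on an edge is a side of a box rather than a piece of a hook, so membership in
  the graph is decided at that box.\<close>

lemma gamma_graph_eq:
  "gamma_graph L = {north_edge L (r, c) | r c. (r, c) \<in> boxes L \<and> row_plus r c} \<union>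
     {west_edge L (r, c) | r c. (r, c) \<in> boxes L \<and> col_plus r c}" (is "_ = ?N \<union> ?W")
proof -
  have "e \<in> gamma_graph L \<longleftrightarrow> e \<in> ?N \<union> ?W" for e
  proof -
  have "e \<in> gamma_graph L \<longleftrightarrow> (\<exists>r c. (r, c) \<in> plus_boxes L \<and> e \<in> path_edges (hook_path L (r, c)))"
    by (fastforce simp: gamma_graph_def)
  also have "\<dots> \<longleftrightarrow> (\<exists>r c. (r, c) \<in> plus_boxes L \<and> (
      (\<exists>c'. offset r < c' \<and> c' \<le> c \<and> e = north_edge L (r, c')) \<or>
      (\<exists>r'. r \<le> r' \<and> r' \<le> col_height L c \<and> e = west_edge L (r', c))))"
  proof -
    have "e \<in> path_edges (hook_path L (r, c)) \<longleftrightarrow>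
      (\<exists>c'. offset r < c' \<and> c' \<le> c \<and> e = north_edge L (r, c')) \<or>
      (\<exists>r'. r \<le> r' \<and> r' \<le> col_height L c \<and> e = west_edge L (r', c))"
      if "(r, c) \<in> plus_boxes L" for r c
    proof -
      have "(r, c) \<in> boxes L" using that plus_boxes_subset by blast
      then show ?thesis by (auto simp: hook_edges)
    qed
    then show ?thesis by blast
  qed
  also have "\<dots> \<longleftrightarrow> e \<in> ?N \<union> ?W"
  proof -
    have "offset r < c' \<longleftrightarrow> (r, c') \<in> boxes L" if "(r, c) \<in> plus_boxes L" "c' \<le> c" for r c c'
      using that plus_boxes_subset by (auto simp: boxes_iff)
    moreover have "r' \<le> col_height L c \<longleftrightarrow> (r', c) \<in> boxes L" if "(r, c) \<in> plus_boxes L" "r \<le> r'" for r c r'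
      using that plus_boxes_subset by (auto simp: boxes_col)
    ultimately show ?thesis unfolding row_plus_def col_plus_def by blast
  qed
  finally show ?thesis .
  qed
  then show ?thesis by blast
qed

lemma north_edge_inject: "north_edge L (r, c) = north_edge L (r', c') \<longleftrightarrow> r = r' \<and> c = c'"
  by (auto simp: north_edge.simps)

lemma west_edge_inject: "west_edge L (r, c) = west_edge L (r', c') \<longleftrightarrow> r = r' \<and> c = c'"
  by (auto simp: west_edge.simps)

lemma north_neq_west: "north_edge L (r, c) \<noteq> west_edge L (r', c')"
  by (auto simp: north_edge.simps west_edge.simps split: if_splits)

lemma north_edge_in_gamma: "(r, c) \<in> boxes L \<Longrightarrow> north_edge L (r, c) \<in> gamma_graph L \<longleftrightarrow> row_plus r c"
  unfolding gamma_graph_eq using north_edge_inject north_neq_west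
  by (auto)

lemma west_edge_in_gamma: "(r, c) \<in> boxes L \<Longrightarrow> west_edge L (r, c) \<in> gamma_graph L \<longleftrightarrow> col_plus r c"
  unfolding gamma_graph_eq using west_edge_inject north_neq_west[symmetric]
  by (auto)

subsection \<open>Depth\<close>

text \<open>The longest chain is evaluated greedily. If column \<open>c\<close> has no
  \<open>+\<close> weakly above the box, the column is dropped and the recursion moves left. If it
  has one but the box itself has none, the Le-property leaves no \<open>+\<close> in the row to the
  left, and the row is dropped. Positions in row 0 or beyond the last column are not boxes and stop
  the recursion.\<close>

function depth :: "box set \<Rightarrow> nat \<Rightarrow> nat \<Rightarrow> nat" where
  "depth X r c =
     (if (r, c) \<notin> X \<inter> boxes L then 0
      else if (r, c) \<in> plus_boxes L then Suc (depth X (r - 1) (c + 1))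
      else if \<not> col_plus r c then depth X r (c + 1)
      else depth X (r - 1) c)"
  by pat_completeness auto
termination
  by (relation "measure (\<lambda>(X, r, c). r + (width L + 1 - c))") (auto dest: boxesD)

declare depth.simps [simp del]

lemma depth_outside: "(r, c) \<notin> X \<inter> boxes L \<Longrightarrow> depth X r c = 0"
  by (subst depth.simps) simp

lemma depth_plus:
  "(r, c) \<in> X \<Longrightarrow> (r, c) \<in> plus_boxes L \<Longrightarrow> depth X r c = Suc (depth X (r - 1) (c + 1))"
  using plus_boxes_subset by (subst depth.simps) auto

definition southeast_closed :: "box set \<Rightarrow> bool" where
  "southeast_closed X \<longleftrightarrow> X \<subseteq> boxes L \<and>
     (\<forall>r c r' c'. (r, c) \<in> X \<longrightarrow> (r', c') \<in> boxes L \<longrightarrow> r \<le> r' \<longrightarrow> c' \<le> c \<longrightarrow> (r', c') \<in> X)"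

lemma southeast_closedD:
  "southeast_closed X \<Longrightarrow> (r, c) \<in> X \<Longrightarrow> (r', c') \<in> boxes L \<Longrightarrow> r \<le> r' \<Longrightarrow> c' \<le> c \<Longrightarrow> (r', c') \<in> X"
  unfolding southeast_closed_def by blast

lemma southeast_closedI:
  "X \<subseteq> boxes L \<Longrightarrow>
    (\<And>r c r' c'. (r, c) \<in> X \<Longrightarrow> (r', c') \<in> boxes L \<Longrightarrow> r \<le> r' \<Longrightarrow> c' \<le> c \<Longrightarrow> (r', c') \<in> X) \<Longrightarrow>
    southeast_closed X"
  by (simp add: southeast_closed_def)

lemma southeast_closed_subset: "southeast_closed X \<Longrightarrow> X \<subseteq> boxes L"
  by (simp add: southeast_closed_def)

text \<open>The neighbours visited by \<open>depth\<close> may fall off the diagram to the north or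
  west, so the induction hypothesis has to cover such positions too; \<open>outside\<close> supplies
  them.\<close>

lemma quadrant_induct [consumes 1, case_names outside less]:
  assumes "(r, c) \<in> boxes L"
    and "\<And>r c. r = 0 \<or> width L < c \<Longrightarrow> Q r c"
    and "\<And>r c. (r, c) \<in> boxes L \<Longrightarrow> (\<And>r' c'. r' \<le> r \<Longrightarrow> c \<le> c' \<Longrightarrow> (r', c') \<noteq> (r, c) \<Longrightarrow> Q r' c') \<Longrightarrow> Q r c"
  shows "Q r c"
  using assms(1)
proof (induction "r + (width L + 1 - c)" arbitrary: r c rule: less_induct)
  case less
  show ?case
  proof (rule assms(3)[OF less.prems])
    fix r' c' assume b: "r' \<le> r" "c \<le> c'" "(r', c') \<noteq> (r, c)"
    show "Q r' c'"
    proof (cases "r' = 0 \<or> width L < c'")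
      case False
      then have "(r', c') \<in> boxes L" using boxes_nw[OF less.prems] b by simp
      moreover have "r' + (width L + 1 - c') < r + (width L + 1 - c)" using b False by auto
      ultimately show ?thesis using less.hyps by blast
    qed (rule assms(2))
  qed
qed

lemma box_less_induct [consumes 1, case_names less]:
  assumes "(r, c) \<in> boxes L"
    and "\<And>r c. (r, c) \<in> boxes L \<Longrightarrow> (\<And>r' c'. (r', c') \<in> boxes L \<Longrightarrow> r' \<le> r \<Longrightarrow> c \<le> c' \<Longrightarrow> (r', c') \<noteq> (r, c) \<Longrightarrow> Q r' c') \<Longrightarrow> Q r c"
  shows "Q r c"
proof -
  have "(r, c) \<in> boxes L \<longrightarrow> Q r c" using assms(1)
  proof (induction r c rule: quadrant_induct)
    case (outside r c)
    then show ?case using boxesD[of r c] by auto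
  next
    case (less r c)
    then show ?case using assms(2)[of r c] by blast
  qed
  then show ?thesis using assms(1) by blast
qed

lemma depth_northwest: "r = 0 \<or> width L < c \<Longrightarrow> depth X r c = 0"
  using boxesD[of r c] by (intro depth_outside) auto

lemma northwest_box: "(r, c) \<in> boxes L \<Longrightarrow> r' \<le> r \<Longrightarrow> c \<le> c' \<Longrightarrow> (r', c') \<in> boxes L \<or> r' = 0 \<or> width L < c'"
  using boxes_nw[of r c r' c'] by (cases "r' = 0") auto

text \<open>Extends the leftward clause of the recursion beyond \<open>X\<close>: if the box
  \<open>(r, c)\<close> is not in the closed set \<open>X\<close>, then neither is
  \<open>(r, c + 1)\<close>, and both depths are 0.\<close>

lemma depth_no_col:
  assumes X: "southeast_closed X" and n: "\<not> col_plus r c" and b: "(r, c) \<in> boxes L \<or> r = 0 \<or> width L < c"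
  shows "depth X r c = depth X r (c + 1)"
proof (cases "(r, c) \<in> X \<inter> boxes L")
  case True
  have "(r, c) \<notin> plus_boxes L" using n plus_col_plus by blast
  then show ?thesis using True n by (subst depth.simps) auto
next
  case False
  then have "(r, c + 1) \<notin> X \<or> r = 0 \<or> width L < c + 1" using b southeast_closedD[OF X, of r "c + 1" r c] by auto
  then have "depth X r (c + 1) = 0"
    by (cases "(r, c + 1) \<in> X") (auto simp: depth_outside intro: depth_northwest)
  then show ?thesis using False by (simp add: depth_outside)
qed

text \<open>Not just a clause of the recursion, which prefers the step to the left. If the column
  has no \<open>+\<close> either, both sides move to column \<open>c + 1\<close>, where the row
  still has no \<open>+\<close>, and the induction hypothesis applies.\<close>

lemma depth_no_row:
  assumes X: "southeast_closed X" and n: "\<not> row_plus r c" and b: "(r, c) \<in> boxes L \<or> r = 0 \<or> width L < c"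
  shows "depth X r c = depth X (r - 1) c"
proof (cases "(r, c) \<in> boxes L")
  case True
  then have "\<not> row_plus r c \<longrightarrow> depth X r c = depth X (r - 1) c"
  proof (induction r c rule: quadrant_induct)
    case (outside r c)
    then have "r - 1 = 0 \<or> width L < c" by auto
    then show ?case using outside by (simp add: depth_northwest)
  next
    case (less r c)
    show ?case
    proof
      assume n: "\<not> row_plus r c"
      have np: "(r, c) \<notin> plus_boxes L" using n plus_row_plus by blast
      consider "(r, c) \<notin> X" | "(r, c) \<in> X" "col_plus r c" | "\<not> col_plus r c" by blast
      then show "depth X r c = depth X (r - 1) c"
      proof cases
        case 1
        then have "(r - 1, c) \<notin> X" using southeast_closedD[OF X _ less.hyps, of "r - 1" c] by auto
        then show ?thesis using 1 by (simp add: depth_outside)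
      next
        case 2
        then show ?thesis using np less.hyps by (subst depth.simps) simp
      next
        case 3
        then have "\<not> col_plus (r - 1) c" using col_plus_mono[of "r - 1" c r] by auto
        then have "depth X (r - 1) c = depth X (r - 1) (c + 1)"
          using depth_no_col[OF X] northwest_box[OF less.hyps, of "r - 1" c] by simp
        moreover have "\<not> row_plus r (c + 1)" using n row_plus_mono[of r "c + 1" c] by auto
        ultimately show ?thesis using depth_no_col[OF X 3] less.IH[of r "c + 1"] less.hyps by simp
      qed
    qed
  qed
  then show ?thesis using n by blast
next
  case False
  then have "r - 1 = 0 \<or> width L < c" using b by auto
  then show ?thesis using False b by (simp add: depth_northwest)
qed

text \<open>The inequalities of a height function: nonnegative jumps across western and northern
  sides, and at most one path through a corner. They are proved together because the cases use
  several of them at the neighbours.\<close>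

lemma depth_mono_step:
  assumes X: "southeast_closed X" and "(r, c) \<in> boxes L"
  shows "depth X r (c + 1) \<le> depth X r c \<and> depth X (r - 1) c \<le> depth X r c \<and>
    depth X r c \<le> Suc (depth X (r - 1) (c + 1))"
  using assms(2)
proof (induction r c rule: quadrant_induct)
  case (outside r c)
  then have "r - 1 = 0 \<or> width L < c" "r = 0 \<or> width L < c + 1" by auto
  then show ?case using outside by (simp add: depth_northwest)
next
  case (less r c)
  have ne: "r - 1 \<noteq> r" using boxesD[OF less.hyps] by linarith
  have left: "depth X (r - 1) (c + 1) \<le> depth X r (c + 1)" "depth X r (c + 1) \<le> Suc (depth X (r - 1) (c + 1 + 1))"
    using less.IH[of r "c + 1"] by auto
  have up: "depth X (r - 1) (c + 1) \<le> depth X (r - 1) c" "depth X (r - 1) c \<le> Suc (depth X (r - 1 - 1) (c + 1))"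
    using less.IH[of "r - 1" c] ne by auto
  have ul: "depth X (r - 1) (c + 1 + 1) \<le> depth X (r - 1) (c + 1)" "depth X (r - 1 - 1) (c + 1) \<le> depth X (r - 1) (c + 1)"
    using less.IH[of "r - 1" "c + 1"] by auto
  consider "(r, c) \<notin> X" | "(r, c) \<in> X" "(r, c) \<in> plus_boxes L" | "\<not> col_plus r c" | "\<not> row_plus r c"
    using le_property less.hyps by blast
  then show ?case
  proof cases
    case 1
    have "(r, c + 1) \<notin> X" "(r - 1, c) \<notin> X"
      using 1 southeast_closedD[OF X _ less.hyps, of r "c + 1"] southeast_closedD[OF X _ less.hyps, of "r - 1" c] by auto
    then show ?thesis using 1 by (simp add: depth_outside)
  next
    case 2
    then show ?thesis using depth_plus left up ul by fastforce
  next
    case 3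
    then have "\<not> col_plus (r - 1) c" using col_plus_mono[of "r - 1" c r] by auto
    then have "depth X (r - 1) c = depth X (r - 1) (c + 1)"
      using depth_no_col[OF X] northwest_box[OF less.hyps, of "r - 1" c] by simp
    then show ?thesis using depth_no_col[OF X 3] less.hyps left ul by linarith
  next
    case 4
    then have "\<not> row_plus r (c + 1)" using row_plus_mono[of r "c + 1" c] by auto
    then have "depth X r (c + 1) = depth X (r - 1) (c + 1)"
      using depth_no_row[OF X] northwest_box[OF less.hyps, of r "c + 1"] by simp
    then show ?thesis using depth_no_row[OF X 4] less.hyps up ul by linarith
  qed
qed

text \<open>The clause of the recursion is chosen by the box alone, so at a given box the same
  clause serves all closed sets at once (those containing the box, if it carries a
  \<open>+\<close>). This is what makes depths in different regions comparable.\<close>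

lemma depth_cases:
  assumes "(r, c) \<in> X" "(r, c) \<in> boxes L" "southeast_closed X"
  obtains "(r, c) \<in> plus_boxes L" "\<And>Y. southeast_closed Y \<Longrightarrow> (r, c) \<in> Y \<Longrightarrow> depth Y r c = Suc (depth Y (r - 1) (c + 1))"
  | "(r, c) \<notin> plus_boxes L" "\<not> col_plus r c" "\<And>Y. southeast_closed Y \<Longrightarrow> depth Y r c = depth Y r (c + 1)"
  | "(r, c) \<notin> plus_boxes L" "\<not> row_plus r c" "\<And>Y. southeast_closed Y \<Longrightarrow> depth Y r c = depth Y (r - 1) c"
proof -
  consider "(r, c) \<in> plus_boxes L" | "(r, c) \<notin> plus_boxes L" "\<not> col_plus r c" | "(r, c) \<notin> plus_boxes L" "\<not> row_plus r c"
    using le_property assms(2) by blast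
  then show ?thesis
  proof cases
    case 1
    show ?thesis by (rule that(1)[OF 1]) (rule depth_plus[OF _ 1])
  next
    case 2
    show ?thesis by (rule that(2)[OF 2]) (simp add: depth_no_col 2(2) assms(2))
  next
    case 3
    show ?thesis by (rule that(3)[OF 3]) (simp add: depth_no_row 3(2) assms(2))
  qed
qed

lemma box_greater_induct [consumes 1, case_names greater]:
  assumes "(r, c) \<in> boxes L"
    and "\<And>r c. (r, c) \<in> boxes L \<Longrightarrow> (\<And>r' c'. (r', c') \<in> boxes L \<Longrightarrow> r \<le> r' \<Longrightarrow> c' \<le> c \<Longrightarrow> (r', c') \<noteq> (r, c) \<Longrightarrow> Q r' c') \<Longrightarrow> Q r c"
  shows "Q r c"
  using assms(1)
proof (induction "(dim_k L - r) + c" arbitrary: r c rule: less_induct)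
  case less
  show ?case
  proof (rule assms(2)[OF less.prems])
    fix r' c' assume b: "(r', c') \<in> boxes L" "r \<le> r'" "c' \<le> c" "(r', c') \<noteq> (r, c)"
    have "(dim_k L - r') + c' < (dim_k L - r) + c"
      using b boxesD[OF b(1)] boxesD[OF less.prems] by auto
    then show "Q r' c'" using less.hyps b(1) by blast
  qed
qed

lemma left_box_or_outside: "(r, c) \<in> boxes L \<Longrightarrow> (r, c + 1) \<in> boxes L \<or> c = width L"
  using boxes_nw[of r c r "c + 1"] boxesD[of r c] by force

section \<open>Unions and intersections of closed regions\<close>

lemma southeast_closed_Un:
  assumes "southeast_closed X" "southeast_closed Y"
  shows "southeast_closed (X \<union> Y)"
proof (rule southeast_closedI)
  show "X \<union> Y \<subseteq> boxes L" using assms southeast_closed_subset by simp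
  fix r c r' c' assume a: "(r, c) \<in> X \<union> Y" "(r', c') \<in> boxes L" "r \<le> r'" "c' \<le> c"
  from a(1) show "(r', c') \<in> X \<union> Y"
    using southeast_closedD[OF assms(1) _ a(2-4)] southeast_closedD[OF assms(2) _ a(2-4)] by blast
qed

lemma southeast_closed_Int:
  assumes "southeast_closed X" "southeast_closed Y"
  shows "southeast_closed (X \<inter> Y)"
proof (rule southeast_closedI)
  show "X \<inter> Y \<subseteq> boxes L" using southeast_closed_subset[OF assms(1)] by auto
  fix r c r' c' assume a: "(r, c) \<in> X \<inter> Y" "(r', c') \<in> boxes L" "r \<le> r'" "c' \<le> c"
  from a(1) show "(r', c') \<in> X \<inter> Y"
    using southeast_closedD[OF assms(1) _ a(2-4)] southeast_closedD[OF assms(2) _ a(2-4)] by blast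
qed

text \<open>All four functions follow the same clause of \<open>depth_cases\<close>, and
  \<open>max\<close> and \<open>min\<close> commute with \<open>Suc\<close>. If the box lies in only
  one of the sets, the other contains none of its northwestern neighbours either, and contributes
  0.\<close>

lemma depth_union_inter:
  assumes X: "southeast_closed X" and Y: "southeast_closed Y"
  shows "depth (X \<union> Y) r c = max (depth X r c) (depth Y r c) \<and>
         depth (X \<inter> Y) r c = min (depth X r c) (depth Y r c)"
proof (cases "(r, c) \<in> boxes L")
  case True
  note XY = southeast_closed_Un[OF X Y] southeast_closed_Int[OF X Y]
  show ?thesis using True
  proof (induction r c rule: quadrant_induct)
    case (outside r c)
    then show ?case by (simp add: depth_northwest)
  next
    case (less r c)
    have "r - 1 \<noteq> r" using boxesD[OF less.hyps] by linarith
    then have ul: "depth (X \<union> Y) r' c' = max (depth X r' c') (depth Y r' c') \<and>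
        depth (X \<inter> Y) r' c' = min (depth X r' c') (depth Y r' c')"
      if "r' = r - 1 \<and> c' = c + 1 \<or> r' = r \<and> c' = c + 1 \<or> r' = r - 1 \<and> c' = c" for r' c'
      using less.IH[of r' c'] that by auto
    consider "(r, c) \<notin> X \<union> Y" | "(r, c) \<in> X" "(r, c) \<in> Y" | "(r, c) \<in> X" "(r, c) \<notin> Y" | "(r, c) \<notin> X" "(r, c) \<in> Y" by blast
    then show ?case
    proof cases
      case 1
      then show ?thesis by (simp add: depth_outside)
    next
      case 2
      show ?thesis
        by (rule depth_cases[OF 2(1) less.hyps X]) (use 2 X Y XY ul in auto)
    next
      case 3
      have n: "(r - 1, c + 1) \<notin> Y" "(r, c + 1) \<notin> Y" "(r - 1, c) \<notin> Y"
        using 3 southeast_closedD[OF Y _ less.hyps, of "r - 1" "c + 1"]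
          southeast_closedD[OF Y _ less.hyps, of r "c + 1"] southeast_closedD[OF Y _ less.hyps, of "r - 1" c]
        by auto
      show ?thesis
        by (rule depth_cases[OF 3(1) less.hyps X]) (use 3 n X Y XY ul in \<open>auto simp: depth_outside\<close>)
    next
      case 4
      have n: "(r - 1, c + 1) \<notin> X" "(r, c + 1) \<notin> X" "(r - 1, c) \<notin> X"
        using 4 southeast_closedD[OF X _ less.hyps, of "r - 1" "c + 1"]
          southeast_closedD[OF X _ less.hyps, of r "c + 1"] southeast_closedD[OF X _ less.hyps, of "r - 1" c]
        by auto
      show ?thesis
        by (rule depth_cases[OF 4(2) less.hyps Y]) (use 4 n X Y XY ul in \<open>auto simp: depth_outside\<close>)
    qed
  qed
qed (simp add: depth_outside)

lemma depth_modular: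
  assumes "southeast_closed X" "southeast_closed Y"
  shows "depth (X \<union> Y) r c + depth (X \<inter> Y) r c = depth X r c + depth Y r c"
  using depth_union_inter[OF assms, of r c] by simp

end

section \<open>Paths in the Gamma-graph\<close>

lemma path_edges_iff: "(u, v) \<in> path_edges p \<longleftrightarrow> (\<exists>xs ys. p = xs @ u # v # ys)"
proof
  assume "(u, v) \<in> path_edges p"
  then show "\<exists>xs ys. p = xs @ u # v # ys"
  proof (induction p)
    case (Cons x p)
    show ?case
    proof (cases p)
      case Nil
      then show ?thesis using Cons.prems by (simp add: path_edges_def)
    next
      case (Cons y q)
      then consider "u = x" "v = y" | "(u, v) \<in> path_edges p"
        using Cons.prems by (auto simp: path_edges_def)
      then show ?thesis
      proof cases
        case 1
        then have "x # p = [] @ u # v # q" using Cons by simp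
        then show ?thesis by blast
      next
        case 2
        then obtain xs ys where "p = xs @ u # v # ys" using Cons.IH by blast
        then have "x # p = (x # xs) @ u # v # ys" by simp
        then show ?thesis by blast
      qed
    qed
  qed (simp add: path_edges_def)
next
  assume "\<exists>xs ys. p = xs @ u # v # ys"
  then obtain xs ys where p: "p = xs @ u # v # ys" by blast
  show "(u, v) \<in> path_edges p" unfolding p
  proof (induction xs)
    case (Cons x xs)
    then show ?case by (cases xs) (simp_all add: path_edges_def)
  qed (simp add: path_edges_def)
qed

lemma path_edges_in_set: "(u, v) \<in> path_edges p \<Longrightarrow> u \<in> set p \<and> v \<in> set p"
  by (auto simp: path_edges_iff)

lemma successively_iff_path_edges: "successively Q p \<longleftrightarrow> (\<forall>(u, v) \<in> path_edges p. Q u v)"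
proof (induction p)
  case (Cons x p)
  then show ?case by (cases p) (auto simp: path_edges_def)
qed (simp add: path_edges_def)

lemma next_vertex: "u \<in> set p \<Longrightarrow> u \<noteq> last p \<Longrightarrow> \<exists>v. (u, v) \<in> path_edges p"
proof -
  assume "u \<in> set p" "u \<noteq> last p"
  then obtain xs ys where p: "p = xs @ u # ys" by (meson split_list)
  then obtain v ys' where "ys = v # ys'" using \<open>u \<noteq> last p\<close> by (cases ys) auto
  then show ?thesis using p path_edges_iff by blast
qed

lemma prev_vertex: "v \<in> set p \<Longrightarrow> v \<noteq> hd p \<Longrightarrow> \<exists>u. (u, v) \<in> path_edges p"
proof -
  assume "v \<in> set p" "v \<noteq> hd p"
  then obtain xs ys where p: "p = xs @ v # ys" by (meson split_list)
  then obtain xs' u where "xs = xs' @ [u]" using \<open>v \<noteq> hd p\<close> by (cases xs rule: rev_cases) auto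
  then have "p = xs' @ u # v # ys" using p by simp
  then show ?thesis using path_edges_iff by blast
qed

context le_diag
begin

text \<open>Read from the northeast, the border passes the south step of row \<open>r\<close> before
  the west step of column \<open>c\<close> exactly when the box \<open>(r, c)\<close> is inside; the
  next lemma is the other direction.\<close>

lemma source_less_sink: "(r, c) \<in> boxes L \<Longrightarrow> source L r < sink L c"
  using boxes_iff[of r c] boxes_col[of r c] by (auto simp: source_def sink_def offset_def)

lemma sink_less_source:
  "1 \<le> r \<Longrightarrow> r \<le> dim_k L \<Longrightarrow> 1 \<le> c \<Longrightarrow> c \<le> width L \<Longrightarrow> (r, c) \<notin> boxes L \<Longrightarrow> sink L c < source L r"
  using boxes_iff[of r c] boxes_col[of r c] by (auto simp: source_def sink_def offset_def)

lemma source_less: "1 \<le> r \<Longrightarrow> r < r' \<Longrightarrow> r' \<le> dim_k L \<Longrightarrow> source L r < source L r'"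
  using offset_mono[of r r'] by (simp add: source_def offset_def)

lemma col_height_mono: "1 \<le> c \<Longrightarrow> c \<le> c' \<Longrightarrow> c' \<le> width L \<Longrightarrow> col_height L c \<le> col_height L c'"
proof -
  assume c: "1 \<le> c" "c \<le> c'" "c' \<le> width L"
  show ?thesis
  proof (cases "col_height L c = 0")
    case False
    then have b: "(col_height L c, c) \<in> boxes L" using c by (simp add: boxes_col)
    have "(col_height L c, c') \<in> boxes L"
      by (rule boxes_nw[OF b]) (use c False in auto)
    then show ?thesis by (simp add: boxes_col)
  qed simp
qed

lemma sink_less: "1 \<le> c \<Longrightarrow> c < c' \<Longrightarrow> c' \<le> width L \<Longrightarrow> sink L c < sink L c'"
  using col_height_mono[of c c'] by (simp add: sink_def)

lemma source_inject:
  "1 \<le> r \<Longrightarrow> r \<le> dim_k L \<Longrightarrow> 1 \<le> r' \<Longrightarrow> r' \<le> dim_k L \<Longrightarrow> source L r = source L r' \<longleftrightarrow> r = r'"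
  using source_less[of r r'] source_less[of r' r] by (metis less_irrefl linorder_neqE_nat)

lemma sink_inject:
  "1 \<le> c \<Longrightarrow> c \<le> width L \<Longrightarrow> 1 \<le> c' \<Longrightarrow> c' \<le> width L \<Longrightarrow> sink L c = sink L c' \<longleftrightarrow> c = c'"
  using sink_less[of c c'] sink_less[of c' c] by (metis less_irrefl linorder_neqE_nat)

lemma source_neq_sink:
  "1 \<le> r \<Longrightarrow> r \<le> dim_k L \<Longrightarrow> 1 \<le> c \<Longrightarrow> c \<le> width L \<Longrightarrow> source L r \<noteq> sink L c"
  using source_less_sink[of r c] sink_less_source[of r c] by fastforce

lemma sources_sinks_disjoint: "sources L \<inter> sinks L = {}"
  using source_neq_sink by (auto simp: sources_def sinks_def)

text \<open>A strict order containing the edges, whatever the filling. Since \<open>Bdry\<close>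
  carries only a label, the quantifiers recover a row from it when it comes first (a source) and a
  column when it comes last (a sink).\<close>

fun precedes :: "vertex \<Rightarrow> vertex \<Rightarrow> bool" where
  "precedes (Corner r c) (Corner r' c') \<longleftrightarrow>
     (r, c) \<in> boxes L \<and> (r', c') \<in> boxes L \<and> r \<le> r' \<and> c \<le> c' \<and> r + c < r' + c'"
| "precedes (Bdry m) (Corner r c) \<longleftrightarrow> (r, c) \<in> boxes L \<and> (\<exists>s\<ge>1. m = source L s \<and> s \<le> r)"
| "precedes (Corner r c) (Bdry m) \<longleftrightarrow> (r, c) \<in> boxes L \<and> (\<exists>t\<le>width L. m = sink L t \<and> c \<le> t)"
| "precedes (Bdry m) (Bdry m') \<longleftrightarrow> (\<exists>s t. (s, t) \<in> boxes L \<and> m = source L s \<and> m' = sink L t)"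

lemma precedes_trans: "precedes u v \<Longrightarrow> precedes v w \<Longrightarrow> precedes u w"
proof -
  assume uv: "precedes u v" and vw: "precedes v w"
  \<comment> \<open>A border vertex in the middle would carry a label that is both a source and a
    sink.\<close>
  have no: False if vm: "v = Bdry m" for m
  proof -
    have "\<exists>t. 1 \<le> t \<and> t \<le> width L \<and> m = sink L t"
    proof (cases u)
      case (Corner a b)
      then obtain t where "(a, b) \<in> boxes L" "t \<le> width L" "m = sink L t" "b \<le> t" using uv vm by auto
      then show ?thesis using boxesD[of a b] by (intro exI[of _ t]) auto
    next
      case (Bdry m')
      then obtain a t where "(a, t) \<in> boxes L" "m = sink L t" using uv vm by auto
      then show ?thesis using boxesD[of a t] by (intro exI[of _ t]) auto
    qed
    moreover have "\<exists>s. 1 \<le> s \<and> s \<le> dim_k L \<and> m = source L s"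
    proof (cases w)
      case (Corner a b)
      then obtain s where "(a, b) \<in> boxes L" "s \<ge> 1" "m = source L s" "s \<le> a" using vw vm by auto
      then show ?thesis using boxesD[of a b] by (intro exI[of _ s]) auto
    next
      case (Bdry m')
      then obtain s b where "(s, b) \<in> boxes L" "m = source L s" using vw vm by auto
      then show ?thesis using boxesD[of s b] by (intro exI[of _ s]) auto
    qed
    ultimately show False using source_neq_sink by metis
  qed
  obtain a b where v: "v = Corner a b" using no by (cases v) auto
  show ?thesis
  proof (cases u)
    case (Bdry m)
    then obtain s where s: "1 \<le> s" "s \<le> a" "m = source L s" and ab: "(a, b) \<in> boxes L" using uv v by auto
    show ?thesis
    proof (cases w)
      case (Bdry m')
      then obtain t where t: "t \<le> width L" "m' = sink L t" "b \<le> t" using vw v by auto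
      then have "(s, t) \<in> boxes L" using boxes_nw[OF ab] s by simp
      then show ?thesis using s t Bdry \<open>u = Bdry m\<close> by auto
    next
      case (Corner a' b')
      then show ?thesis using Bdry v vw s by auto
    qed
  next
    case (Corner a' b')
    then show ?thesis using uv vw v by (cases w) auto
  qed
qed

lemma precedes_irrefl: "\<not> precedes u u"
proof (cases u)
  case (Bdry m)
  then show ?thesis using source_less_sink by (auto; metis less_irrefl)
qed auto

lemma gamma_graph_cases:
  assumes "(u, v) \<in> gamma_graph L"
  obtains (north) r c where "(r, c) \<in> boxes L" "row_plus r c" "(u, v) = north_edge L (r, c)"
  | (west) r c where "(r, c) \<in> boxes L" "col_plus r c" "(u, v) = west_edge L (r, c)"
  using assms unfolding gamma_graph_eq by blast

lemma north_edge_inner: "(r, c) \<in> boxes L \<Longrightarrow> north_edge L (r, c + 1) = (Corner r c, Corner r (c + 1))"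
  by (simp add: north_edge.simps)

lemma west_edge_inner: "(r + 1, c) \<in> boxes L \<Longrightarrow> west_edge L (r, c) = (Corner r c, Corner (r + 1) c)"
  by (simp add: west_edge.simps)

lemma gamma_out_corner:
  assumes "(Corner r c, v) \<in> gamma_graph L"
  shows "(r, c) \<in> boxes L"
    and "v = Corner r (c + 1) \<and> (r, c + 1) \<in> boxes L \<and> north_edge L (r, c + 1) = (Corner r c, v) \<or>
         west_edge L (r, c) = (Corner r c, v) \<and> (v = Corner (r + 1) c \<and> (r + 1, c) \<in> boxes L \<or>
           v = Bdry (sink L c) \<and> (r + 1, c) \<notin> boxes L)"
  using assms
  by (cases rule: gamma_graph_cases; auto simp: north_edge.simps west_edge.simps boxes_iff split: if_splits)+

lemma gamma_in_corner:
  assumes "(u, Corner r c) \<in> gamma_graph L"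
  shows "(r, c) \<in> boxes L"
    and "u = Corner (r - 1) c \<and> (r - 1, c) \<in> boxes L \<and> west_edge L (r - 1, c) = (u, Corner r c) \<or>
         north_edge L (r, c) = (u, Corner r c) \<and> (u = Corner r (c - 1) \<and> (r, c - 1) \<in> boxes L \<or>
           u = Bdry (source L r) \<and> (r, c - 1) \<notin> boxes L)"
  using assms
  by (cases rule: gamma_graph_cases; auto simp: north_edge.simps west_edge.simps boxes_iff split: if_splits)+

lemma gamma_out_bdry:
  assumes "(Bdry m, v) \<in> gamma_graph L"
  obtains s where "(s, offset s + 1) \<in> boxes L" "m = source L s" "v = Corner s (offset s + 1)"
    "north_edge L (s, offset s + 1) = (Bdry m, v)"
  using assms
proof (cases rule: gamma_graph_cases)
  case (north r c)
  then have n: "(r, c - 1) \<notin> boxes L" "m = source L r" "v = Corner r c"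
    by (auto simp: north_edge.simps split: if_splits)
  have "c = offset r + 1" using n(1) north(1) by (auto simp: boxes_iff)
  then show ?thesis using that[of r] north n by simp
qed (auto simp: west_edge.simps)

lemma gamma_in_bdry:
  assumes "(u, Bdry m) \<in> gamma_graph L"
  obtains t where "(col_height L t, t) \<in> boxes L" "m = sink L t" "u = Corner (col_height L t) t"
    "west_edge L (col_height L t, t) = (u, Bdry m)"
  using assms
proof (cases rule: gamma_graph_cases)
  case (west r c)
  then have n: "(r + 1, c) \<notin> boxes L" "m = sink L c" "u = Corner r c"
    by (auto simp: west_edge.simps split: if_splits)
  have "r = col_height L c" using n(1) west(1) by (auto simp: boxes_col)
  then show ?thesis using that[of c] west n by simp
qed (auto simp: north_edge.simps)

lemma gamma_precedes: "(u, v) \<in> gamma_graph L \<Longrightarrow> precedes u v"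
proof (cases u)
  case (Bdry m)
  assume "(u, v) \<in> gamma_graph L"
  with Bdry obtain s where "(s, offset s + 1) \<in> boxes L" "m = source L s" "v = Corner s (offset s + 1)"
    using gamma_out_bdry by metis
  then show ?thesis using Bdry boxesD by auto
next
  case (Corner r c)
  assume "(u, v) \<in> gamma_graph L"
  with Corner have "(r, c) \<in> boxes L" and "v = Corner r (c + 1) \<and> (r, c + 1) \<in> boxes L \<or>
     v = Corner (r + 1) c \<and> (r + 1, c) \<in> boxes L \<or> v = Bdry (sink L c)"
    using gamma_out_corner by blast+
  moreover have "c \<le> width L" using boxesD[OF \<open>(r, c) \<in> boxes L\<close>] by simp
  ultimately show ?thesis using Corner by auto
qed

lemma is_path_edges: "is_path L p \<longleftrightarrow> p \<noteq> [] \<and> path_edges p \<subseteq> gamma_graph L"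
  by (auto simp: is_path_def successively_iff_path_edges)

lemma path_sorted: "is_path L p \<Longrightarrow> sorted_wrt precedes p"
proof -
  assume "is_path L p"
  then have "successively precedes p"
    unfolding is_path_def by (auto elim: successively_mono simp: gamma_precedes)
  moreover have "transp precedes" using precedes_trans by (rule transpI)
  ultimately show ?thesis by (simp add: successively_conv_sorted_wrt)
qed

lemma path_comparable:
  assumes "is_path L p" "u \<in> set p" "v \<in> set p"
  shows "u = v \<or> precedes u v \<or> precedes v u"
proof -
  obtain xs ys where p: "p = xs @ u # ys" using assms(2) by (meson split_list)
  show ?thesis using path_sorted[OF assms(1)] assms(3) unfolding p by (auto simp: sorted_wrt_append)
qed

lemma path_distinct: "is_path L p \<Longrightarrow> distinct p"
proof -
  have "sorted_wrt precedes p \<Longrightarrow> distinct p"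
    by (induction p) (auto simp: precedes_irrefl)
  then show "is_path L p \<Longrightarrow> distinct p" using path_sorted by blast
qed

text \<open>Paths are sorted by \<open>precedes\<close>, so no vertex of a path lies between the
  ends of one of its edges.\<close>

lemma path_edge_separates:
  assumes "is_path L p" "(u, v) \<in> path_edges p" "w \<in> set p"
  shows "w = u \<or> w = v \<or> precedes w u \<or> precedes v w"
proof -
  obtain xs ys where p: "p = xs @ u # v # ys" using assms(2) by (auto simp: path_edges_iff)
  show ?thesis using path_sorted[OF assms(1)] assms(3) unfolding p by (auto simp: sorted_wrt_append)
qed

lemma path_edge_unique:
  assumes "is_path L p" "(u, v) \<in> path_edges p"
  shows "(u, v') \<in> path_edges p \<Longrightarrow> v' = v" and "(u', v) \<in> path_edges p \<Longrightarrow> u' = u"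
proof -
  have prec: "precedes x y" if "(x, y) \<in> path_edges p" for x y
    using that assms(1) is_path_edges gamma_precedes by blast
  have no: "\<not> (precedes x y \<and> precedes y x)" for x y
    using precedes_trans precedes_irrefl by blast
  show "v' = v" if e: "(u, v') \<in> path_edges p"
  proof -
    have "v' = u \<or> v' = v \<or> precedes v' u \<or> precedes v v'"
      using path_edge_separates[OF assms] path_edges_in_set e by blast
    moreover have "v = u \<or> v = v' \<or> precedes v u \<or> precedes v' v"
      using path_edge_separates[OF assms(1) e] path_edges_in_set assms(2) by blast
    ultimately show ?thesis using no precedes_irrefl prec[OF e] prec[OF assms(2)] by blast
  qed
  show "u' = u" if e: "(u', v) \<in> path_edges p"
  proof -
    have "u' = u \<or> u' = v \<or> precedes u' u \<or> precedes v u'"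
      using path_edge_separates[OF assms] path_edges_in_set e by blast
    moreover have "u = u' \<or> u = v \<or> precedes u u' \<or> precedes v u"
      using path_edge_separates[OF assms(1) e] path_edges_in_set assms(2) by blast
    ultimately show ?thesis using no precedes_irrefl prec[OF e] prec[OF assms(2)] by blast
  qed
qed

lemma no_edge_from_last: "is_path L p \<Longrightarrow> (last p, v) \<notin> path_edges p"
proof
  assume p: "is_path L p" and e: "(last p, v) \<in> path_edges p"
  obtain xs ys where pp: "p = xs @ last p # v # ys" using e path_edges_iff by metis
  have "last p = last (v # ys)" by (subst pp) simp
  then have "last p \<in> set (v # ys)" by (metis last_in_set list.discI)
  moreover have "distinct (xs @ last p # v # ys)" using path_distinct[OF p] pp by simp
  ultimately show False by auto
qed

text \<open>The end need only be a border vertex, so the trivial path at a source is included; path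
  families contain such paths, generalized paths do not.\<close>

definition border_path :: "vertex list \<Rightarrow> bool" where
  "border_path p \<longleftrightarrow> is_path L p \<and> hd p \<in> Bdry ` sources L \<and> last p \<in> range Bdry"

lemma border_path_is_path: "border_path p \<Longrightarrow> is_path L p"
  by (simp add: border_path_def)

lemma border_path_cases:
  assumes "border_path p"
  obtains (trivial) s where "1 \<le> s" "s \<le> dim_k L" "p = [Bdry (source L s)]"
  | (proper) s t where "(s, offset s + 1) \<in> boxes L" "(col_height L t, t) \<in> boxes L"
      "hd p = Bdry (source L s)" "last p = Bdry (sink L t)"
      "Corner s (offset s + 1) \<in> set p" "Corner (col_height L t) t \<in> set p"
proof -
  obtain s where s: "1 \<le> s" "s \<le> dim_k L" "hd p = Bdry (source L s)"
    using assms by (auto simp: border_path_def sources_def)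
  obtain m where m: "last p = Bdry m" using assms by (auto simp: border_path_def)
  have path: "is_path L p" "p \<noteq> []" "path_edges p \<subseteq> gamma_graph L"
    using assms by (auto simp: border_path_def is_path_edges)
  show ?thesis
  proof (cases "tl p = []")
    case True
    then have "p = [Bdry (source L s)]" using path s by (cases p) auto
    then show ?thesis using trivial s by blast
  next
    case False
    then obtain u v q where p: "p = u # v # q" using path by (metis list.exhaust list.sel(3))
    have u: "u = Bdry (source L s)" using s p by simp
    have "(u, v) \<in> path_edges p" by (simp add: p path_edges_def)
    then have "(Bdry (source L s), v) \<in> gamma_graph L" using u path by blast
    then obtain s' where s': "(s', offset s' + 1) \<in> boxes L" "source L s = source L s'" "v = Corner s' (offset s' + 1)"
      using gamma_out_bdry by metis
    have ss: "s' = s" using s'(1,2) s source_inject boxesD by metis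
    obtain q' w where q': "p = q' @ [w, Bdry m]"
    proof -
      obtain z where "p = z @ [Bdry m]" using m path by (metis append_butlast_last_id)
      moreover have "z \<noteq> []" using \<open>p = z @ [Bdry m]\<close> p by auto
      ultimately show ?thesis using that[of "butlast z" "last z"] by simp
    qed
    have "(w, Bdry m) \<in> path_edges p" unfolding path_edges_iff using q' by blast
    then have "(w, Bdry m) \<in> gamma_graph L" using path by blast
    then obtain t where t: "(col_height L t, t) \<in> boxes L" "m = sink L t" "w = Corner (col_height L t) t"
      using gamma_in_bdry by metis
    have "w \<in> set p" using q' by simp
    moreover have "v \<in> set p" using p by simp
    ultimately show ?thesis
      using proper[of s t] s'(1,3) s(3) t m unfolding ss by simp
  qed
qed

lemma corner_in_boxes: "border_path p \<Longrightarrow> Corner r c \<in> set p \<Longrightarrow> (r, c) \<in> boxes L"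
proof -
  assume p: "border_path p" and c: "Corner r c \<in> set p"
  have "hd p \<noteq> Corner r c" using p by (auto simp: border_path_def)
  then obtain u where "(u, Corner r c) \<in> path_edges p" using prev_vertex c by metis
  then have "(u, Corner r c) \<in> gamma_graph L" using p by (auto simp: border_path_def is_path_edges)
  then show ?thesis by (rule gamma_in_corner)
qed

section \<open>A path as the boundary of the region southeast of it\<close>

lemma southeast_iff:
  "(a, b) \<in> southeast L p \<longleftrightarrow> (a, b) \<in> boxes L \<and> (\<exists>r c. Corner r c \<in> set p \<and> r \<le> a \<and> b \<le> c)"
  by (simp add: southeast_def)

lemma southeast_closed_southeast: "southeast_closed (southeast L p)"
  by (rule southeast_closedI) (auto simp: southeast_iff intro: order_trans)

lemma southeast_trivial: "southeast L [Bdry m] = {}"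
  by (auto simp: southeast_def)

text \<open>A path runs along the northwestern boundary of its region, so it uses a side exactly
  when that side separates inside from outside. In this way edges can be read off from a set of
  boxes.\<close>

lemma west_edge_path_iff:
  assumes p: "border_path p" and b: "(r, c) \<in> boxes L"
  shows "west_edge L (r, c) \<in> path_edges p \<longleftrightarrow> (r, c) \<in> southeast L p \<and> (r, c + 1) \<notin> southeast L p"
proof
  assume e: "west_edge L (r, c) \<in> path_edges p"
  obtain v where v: "west_edge L (r, c) = (Corner r c, v)" by (simp add: west_edge.simps)
  have in_p: "Corner r c \<in> set p" using e v path_edges_in_set by metis
  have "(r, c + 1) \<notin> southeast L p"
  proof
    assume "(r, c + 1) \<in> southeast L p"
    then obtain a d where d: "Corner a d \<in> set p" "a \<le> r" "c + 1 \<le> d" by (auto simp: southeast_iff)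
    have "Corner a d = Corner r c \<or> Corner a d = v \<or> precedes (Corner a d) (Corner r c) \<or> precedes v (Corner a d)"
      using path_edge_separates[OF border_path_is_path[OF p] _ d(1)] e v by metis
    moreover have "v = Corner (r + 1) c \<or> v = Bdry (sink L c)" using v by (auto simp: west_edge.simps split: if_splits)
    moreover have "\<not> precedes (Bdry (sink L c)) (Corner a d)"
      using source_neq_sink boxesD[OF b] boxesD[of a d] by force
    ultimately show False using d by auto
  qed
  then show "(r, c) \<in> southeast L p \<and> (r, c + 1) \<notin> southeast L p"
    using in_p b by (auto simp: southeast_iff)
next
  assume a: "(r, c) \<in> southeast L p \<and> (r, c + 1) \<notin> southeast L p"
  \<comment> \<open>A vertex further to the left would put \<open>(r, c + 1)\<close> into the region
    as well.\<close>
  have eqc: "c' = c" if "Corner r' c' \<in> set p" "r' \<le> r" "c \<le> c'" for r' c'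
  proof (cases "(r, c + 1) \<in> boxes L")
    case True
    then show ?thesis using a that unfolding southeast_iff by (metis Suc_eq_plus1 le_antisym not_less_eq_eq)
  next
    case False
    then have "c = width L" using left_box_or_outside[OF b] by simp
    then show ?thesis using that corner_in_boxes[OF p that(1)] boxesD by force
  qed
  \<comment> \<open>The lowest vertex of the path in column \<open>c\<close> down to row
    \<open>r\<close>: the path cannot leave it to the west, by \<open>eqc\<close>, and by maximality
    its southward edge is the western side of \<open>(r, c)\<close>.\<close>
  define S where "S = {r'. r' \<le> r \<and> Corner r' c \<in> set p}"
  have "S \<noteq> {}" using a eqc unfolding S_def southeast_iff by blast
  moreover have fin: "finite S" by (simp add: S_def)
  ultimately have "Max S \<in> S" by simp
  define m where "m = Max S"
  have m: "m \<le> r" "Corner m c \<in> set p" using \<open>Max S \<in> S\<close> by (auto simp: S_def m_def)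
  have max: "x \<le> m" if "x \<le> r" "Corner x c \<in> set p" for x using that fin by (simp add: S_def m_def)
  have "Corner m c \<noteq> last p" using p by (auto simp: border_path_def)
  then obtain v where v: "(Corner m c, v) \<in> path_edges p" using next_vertex m by metis
  then have "(Corner m c, v) \<in> gamma_graph L" using p by (auto simp: border_path_def is_path_edges)
  from gamma_out_corner(2)[OF this] show "west_edge L (r, c) \<in> path_edges p"
  proof (elim disjE conjE)
    assume "v = Corner m (c + 1)"
    then show ?thesis using eqc[of m "c + 1"] v m path_edges_in_set by force
  next
    assume w: "west_edge L (m, c) = (Corner m c, v)" "v = Corner (m + 1) c"
    have "m = r" using max[of "m + 1"] m v w path_edges_in_set by force
    then show ?thesis using w v by simp
  next
    assume w: "west_edge L (m, c) = (Corner m c, v)" "(m + 1, c) \<notin> boxes L"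
    have "m = r" using w(2) boxes_nw[OF b, of "m + 1" c] m boxesD[OF b] by force
    then show ?thesis using w v by simp
  qed
qed

text \<open>Mirror image of \<open>west_edge_path_iff\<close>: the path is followed backwards from
  its vertex in row \<open>r\<close> with the least column from \<open>c\<close> on.\<close>

lemma north_edge_path_iff:
  assumes p: "border_path p" and b: "(r, c) \<in> boxes L"
  shows "north_edge L (r, c) \<in> path_edges p \<longleftrightarrow> (r, c) \<in> southeast L p \<and> (r - 1, c) \<notin> southeast L p"
proof
  assume e: "north_edge L (r, c) \<in> path_edges p"
  obtain u where u: "north_edge L (r, c) = (u, Corner r c)" by (simp add: north_edge.simps)
  have in_p: "Corner r c \<in> set p" using e u path_edges_in_set by metis
  have "(r - 1, c) \<notin> southeast L p"
  proof
    assume "(r - 1, c) \<in> southeast L p"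
    then obtain a d where d: "Corner a d \<in> set p" "a \<le> r - 1" "c \<le> d" by (auto simp: southeast_iff)
    have r: "1 \<le> r" "1 \<le> c" using boxesD[OF b] by auto
    have "Corner a d = u \<or> Corner a d = Corner r c \<or> precedes (Corner a d) u \<or> precedes (Corner r c) (Corner a d)"
      using path_edge_separates[OF border_path_is_path[OF p] _ d(1)] e u by metis
    moreover have "u = Corner r (c - 1) \<or> u = Bdry (source L r)" using u by (auto simp: north_edge.simps split: if_splits)
    moreover have "\<not> precedes (Corner a d) (Bdry (source L r))"
      using source_neq_sink boxesD[OF b] boxesD[of a d] by force
    ultimately show False using d r by auto
  qed
  then show "(r, c) \<in> southeast L p \<and> (r - 1, c) \<notin> southeast L p"
    using in_p b by (auto simp: southeast_iff)
next
  assume a: "(r, c) \<in> southeast L p \<and> (r - 1, c) \<notin> southeast L p"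
  have eqr: "r' = r" if "Corner r' c' \<in> set p" "r' \<le> r" "c \<le> c'" for r' c'
  proof (rule ccontr)
    assume "r' \<noteq> r"
    then have r': "r' \<le> r - 1" "1 \<le> r'" using that(2) corner_in_boxes[OF p that(1)] boxesD by force+
    then have "(r - 1, c) \<in> boxes L" using boxes_nw[OF b, of "r - 1" c] boxesD[OF b] by simp
    then show False using a that r' unfolding southeast_iff by blast
  qed
  define S where "S = {c'. c \<le> c' \<and> Corner r c' \<in> set p}"
  have "S \<noteq> {}" using a eqr unfolding S_def southeast_iff by blast
  define m where "m = (LEAST x. x \<in> S)"
  have "m \<in> S" using \<open>S \<noteq> {}\<close> unfolding m_def by (metis LeastI ex_in_conv)
  then have m: "c \<le> m" "Corner r m \<in> set p" by (auto simp: S_def)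
  have min: "m \<le> x" if "c \<le> x" "Corner r x \<in> set p" for x using that by (simp add: S_def m_def Least_le)
  have mb: "(r, m) \<in> boxes L" using corner_in_boxes[OF p m(2)] .
  have "Corner r m \<noteq> hd p" using p by (auto simp: border_path_def)
  then obtain u where u: "(u, Corner r m) \<in> path_edges p" using prev_vertex m by metis
  then have "(u, Corner r m) \<in> gamma_graph L" using p by (auto simp: border_path_def is_path_edges)
  from gamma_in_corner(2)[OF this] show "north_edge L (r, c) \<in> path_edges p"
  proof (elim disjE conjE)
    assume w: "u = Corner (r - 1) m"
    then show ?thesis using eqr[of "r - 1" m] u m path_edges_in_set boxesD[OF b] by force
  next
    assume w: "north_edge L (r, m) = (u, Corner r m)" "u = Corner r (m - 1)"
    have "m = c" using min[of "m - 1"] m u w path_edges_in_set boxesD[OF b] by force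
    then show ?thesis using w u by simp
  next
    assume w: "north_edge L (r, m) = (u, Corner r m)" "(r, m - 1) \<notin> boxes L"
    have "m = c"
    proof (rule ccontr)
      assume "m \<noteq> c"
      then have "(r, m - 1) \<in> boxes L"
        using boxes_nw[OF b, of r "m - 1"] m boxesD[OF mb] boxesD[OF b] by auto
      then show False using w by simp
    qed
    then show ?thesis using w u by simp
  qed
qed

text \<open>Vertices of a path are comparable, so none has both a smaller row and a larger column
  than another. Conversely the path leaves the vertex along the northern side of the left neighbour
  if that is inside, and along the western side of the box otherwise.\<close>

lemma corner_path_iff:
  assumes p: "border_path p" and b: "(r, c) \<in> boxes L"
  shows "Corner r c \<in> set p \<longleftrightarrow> (r, c) \<in> southeast L p \<and> (r - 1, c + 1) \<notin> southeast L p"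
proof
  assume c: "Corner r c \<in> set p"
  have "(r - 1, c + 1) \<notin> southeast L p"
  proof
    assume "(r - 1, c + 1) \<in> southeast L p"
    then obtain a d where d: "Corner a d \<in> set p" "a \<le> r - 1" "c + 1 \<le> d" by (auto simp: southeast_iff)
    show False using path_comparable[OF border_path_is_path[OF p] c d(1)] d boxesD[OF b] by auto
  qed
  then show "(r, c) \<in> southeast L p \<and> (r - 1, c + 1) \<notin> southeast L p"
    using c b by (auto simp: southeast_iff)
next
  assume a: "(r, c) \<in> southeast L p \<and> (r - 1, c + 1) \<notin> southeast L p"
  show "Corner r c \<in> set p"
  proof (cases "(r, c + 1) \<in> southeast L p")
    case True
    then have bb: "(r, c + 1) \<in> boxes L" by (simp add: southeast_iff)
    have "north_edge L (r, c + 1) \<in> path_edges p" using north_edge_path_iff[OF p bb] True a by simp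
    then show ?thesis using north_edge_inner[OF b] path_edges_in_set by metis
  next
    case False
    then have "west_edge L (r, c) \<in> path_edges p" using west_edge_path_iff[OF p b] a by simp
    then show ?thesis using path_edges_in_set by (metis west_edge.simps)
  qed
qed

lemma southeast_bounds:
  assumes p: "border_path p" "hd p = Bdry (source L s)" "last p = Bdry (sink L t)"
    and st: "1 \<le> s" "s \<le> dim_k L" "1 \<le> t" "t \<le> width L"
    and "(a, b) \<in> southeast L p"
  shows "s \<le> a \<and> b \<le> t"
proof -
  obtain r c where rc: "Corner r c \<in> set p" "r \<le> a" "b \<le> c" using assms by (auto simp: southeast_iff)
  note path = border_path_is_path[OF p(1)]
  have ne: "p \<noteq> []" using path by (simp add: is_path_def)
  have box: "(r, c) \<in> boxes L" using corner_in_boxes[OF p(1) rc(1)] .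
  have "\<not> precedes (Corner r c) (Bdry (source L s))" "\<not> precedes (Bdry (sink L t)) (Corner r c)"
    using source_neq_sink st boxesD[OF box] by force+
  moreover have "Bdry (source L s) \<in> set p" "Bdry (sink L t) \<in> set p"
    using ne p hd_in_set last_in_set by metis+
  ultimately have "precedes (Bdry (source L s)) (Corner r c)" "precedes (Corner r c) (Bdry (sink L t))"
    using path_comparable[OF path rc(1)] by blast+
  then show ?thesis using rc source_inject sink_inject st boxesD[OF box] by force
qed

text \<open>The assumptions on \<open>(a, b)\<close> put its southeast corner on the border. A path
  cuts this point off from the northwest exactly when it starts before and ends after it, so
  membership depends on the ends alone.\<close>

lemma border_box_southeast_iff:
  assumes p: "border_path p" "hd p = Bdry (source L s)" "last p = Bdry (sink L t)"
    and st: "1 \<le> s" "s \<le> dim_k L" "1 \<le> t" "t \<le> width L"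
    and b: "(a, b) \<in> boxes L" "(a + 1, b - 1) \<notin> boxes L"
  shows "(a, b) \<in> southeast L p \<longleftrightarrow> s \<le> a \<and> b \<le> t"
proof
  assume "(a, b) \<in> southeast L p"
  then show "s \<le> a \<and> b \<le> t" using southeast_bounds[OF p st] by blast
next
  assume ab: "s \<le> a \<and> b \<le> t"
  \<comment> \<open>The sum \<open>r + c\<close> grows along the path, so its maximum marks the last
    vertex in the rows up to \<open>a\<close>. There the path steps down from row \<open>a\<close>,
    where \<open>(a + 1, c)\<close> is a box but \<open>(a + 1, b - 1)\<close> is not, or it ends in
    column \<open>t\<close>; both give \<open>b \<le> c\<close>.\<close>
  define S where "S = {r + c | r c. Corner r c \<in> set p \<and> r \<le> a}"
  have sub: "S \<subseteq> (\<lambda>(r, c). r + c) ` boxes L" using corner_in_boxes[OF p(1)] by (force simp: S_def)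
  have fin: "finite S" using finite_subset[OF sub] finite_boxes by blast
  have "S \<noteq> {}" using p(1)
  proof (cases rule: border_path_cases)
    case (trivial s')
    then show ?thesis using p st source_neq_sink by auto
  next
    case (proper s' t')
    then have "s' = s" using p st boxesD source_inject by (metis vertex.inject(1))
    then show ?thesis using proper ab unfolding S_def by blast
  qed
  then have "Max S \<in> S" using fin by simp
  then obtain r c where rc: "Corner r c \<in> set p" "r \<le> a" "r + c = Max S" unfolding S_def by auto
  have max: "r' + c' \<le> r + c" if "Corner r' c' \<in> set p" "r' \<le> a" for r' c'
    using that rc fin unfolding S_def by (metis (mono_tags, lifting) Max_ge mem_Collect_eq)
  have "Corner r c \<noteq> last p" using p by (auto simp: border_path_def)
  then obtain v where v: "(Corner r c, v) \<in> path_edges p" using next_vertex rc by metis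
  then have g: "(Corner r c, v) \<in> gamma_graph L" using p by (auto simp: border_path_def is_path_edges)
  have vp: "v \<in> set p" using v path_edges_in_set by metis
  have "b \<le> c"
    using gamma_out_corner(2)[OF g]
  proof (elim disjE conjE)
    assume "v = Corner r (c + 1)"
    then show ?thesis using max[of r "c + 1"] vp rc by simp
  next
    assume w: "v = Corner (r + 1) c" "(r + 1, c) \<in> boxes L"
    have "r = a" using max[of "r + 1" c] vp w rc by force
    then show ?thesis using w b boxes_nw[OF w(2), of "r + 1" "b - 1"] boxesD[OF b(1)] by force
  next
    assume w: "v = Bdry (sink L c)"
    have "v = last p"
    proof (rule ccontr)
      assume "v \<noteq> last p"
      then obtain v' where "(v, v') \<in> path_edges p" using vp next_vertex by metis
      then have "(Bdry (sink L c), v') \<in> gamma_graph L" using p w by (auto simp: border_path_def is_path_edges)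
      then show False using source_neq_sink gamma_out_bdry boxesD corner_in_boxes[OF p(1) rc(1)] by metis
    qed
    then have "c = t" using w p sink_inject st boxesD corner_in_boxes[OF p(1) rc(1)]
      by (metis vertex.inject(1))
    then show ?thesis using ab by simp
  qed
  then show "(a, b) \<in> southeast L p" using rc b by (auto simp: southeast_iff)
qed

end

section \<open>Families of disjoint paths\<close>

lemma finite_path_eq:
  assumes "successively (\<lambda>u v. (u, v) \<in> E) p" "successively (\<lambda>u v. (u, v) \<in> E) q"
    and "p \<noteq> []" "q \<noteq> []" "hd p = hd q" "last p \<notin> Domain E" "last q \<notin> Domain E" "single_valued E"
  shows "p = q"
  using assms
proof (induction p arbitrary: q)
  case (Cons x p)
  obtain q' where q: "q = x # q'" using Cons.prems by (cases q) auto
  show ?case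
  proof (cases p)
    case Nil
    then show ?thesis using Cons.prems q by (cases q') auto
  next
    case (Cons y p')
    then have xy: "(x, y) \<in> E" using Cons.prems by simp
    then obtain z q'' where z: "q' = z # q''" using Cons.prems q by (cases q') auto
    have "z = y" using xy Cons.prems q z by (auto dest: single_valuedD)
    then show ?thesis using Cons.IH[of q'] Cons.prems q z \<open>p = y # p'\<close> by auto
  qed
qed simp

lemma path_reachable: "successively (\<lambda>u v. (u, v) \<in> E) p \<Longrightarrow> v \<in> set p \<Longrightarrow> (hd p, v) \<in> E\<^sup>*"
proof (induction p)
  case (Cons x p)
  then show ?case by (cases p) (auto intro: converse_rtrancl_into_rtrancl)
qed simp

text \<open>Corners get a placeholder value; \<open>label\<close> is meant for the ends of border
  paths.\<close>

fun label :: "vertex \<Rightarrow> nat" where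
  "label (Bdry m) = m"
| "label (Corner r c) = 0"

context le_diag
begin

section \<open>Families and their height functions\<close>

definition family :: "vertex list set \<Rightarrow> bool" where
  "family A \<longleftrightarrow> finite A \<and> (\<forall>p\<in>A. border_path p) \<and>
     (\<forall>p\<in>A. \<forall>q\<in>A. p \<noteq> q \<longrightarrow> set p \<inter> set q = {})"

text \<open>At a \<open>+\<close> box this is the exponent of its weight in the weight of the family
  (\<open>family_weight\<close>), and its jumps are the edges of the family.\<close>

definition height :: "vertex list set \<Rightarrow> nat \<Rightarrow> nat \<Rightarrow> nat" where
  "height A r c = card {p \<in> A. (r, c) \<in> southeast L p}"

lemma family_share: "family A \<Longrightarrow> p \<in> A \<Longrightarrow> q \<in> A \<Longrightarrow> v \<in> set p \<Longrightarrow> v \<in> set q \<Longrightarrow> p = q"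
  unfolding family_def by blast

lemma family_border_path: "family A \<Longrightarrow> p \<in> A \<Longrightarrow> border_path p"
  by (simp add: family_def)

lemma border_path_nonempty: "border_path p \<Longrightarrow> p \<noteq> []"
  by (simp add: border_path_def is_path_def)

lemma finite_sources: "finite (sources L)"
  by (simp add: sources_def)

lemma inj_on_ends:
  assumes "\<And>p q. p \<in> A \<Longrightarrow> q \<in> A \<Longrightarrow> p \<noteq> q \<Longrightarrow> set p \<inter> set q = {}" "[] \<notin> A"
  shows "inj_on hd A" "inj_on last A"
proof -
  have "p = q" if "p \<in> A" "q \<in> A" "v \<in> set p" "v \<in> set q" for p q v
    using assms(1) that by blast
  then show "inj_on hd A" "inj_on last A"
    using assms(2) by (metis inj_onI hd_in_set, metis inj_onI last_in_set)
qed

lemma family_inj_on: "family A \<Longrightarrow> inj_on hd A" "family A \<Longrightarrow> inj_on last A"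
  using inj_on_ends[of A] border_path_nonempty by (auto simp: family_def)

text \<open>Disjoint paths have distinct heads among the finitely many sources, which gives
  finiteness.\<close>

lemma disjoint_paths_family:
  assumes "\<And>p. p \<in> A \<Longrightarrow> border_path p"
    and "\<And>p q. p \<in> A \<Longrightarrow> q \<in> A \<Longrightarrow> p \<noteq> q \<Longrightarrow> set p \<inter> set q = {}"
  shows "family A"
proof -
  have "[] \<notin> A" using assms(1) border_path_nonempty by blast
  then have "inj_on hd A" using inj_on_ends assms(2) by blast
  moreover have "hd ` A \<subseteq> Bdry ` sources L" using assms(1) by (auto simp: border_path_def)
  ultimately have "finite A" using finite_sources by (meson finite_imageD finite_imageI finite_subset)
  then show ?thesis using assms by (simp add: family_def)
qed

lemma path_families_iff:
  "A \<in> path_families L J \<longleftrightarrow> family A \<and> hd ` A = Bdry ` sources L \<and> last ` A = Bdry ` J"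
proof
  assume A: "A \<in> path_families L J"
  have "border_path p" if "p \<in> A" for p
    using A that unfolding path_families_def border_path_def by blast
  then show "family A \<and> hd ` A = Bdry ` sources L \<and> last ` A = Bdry ` J"
    using A disjoint_paths_family[of A] by (auto simp: path_families_def)
next
  assume "family A \<and> hd ` A = Bdry ` sources L \<and> last ` A = Bdry ` J"
  then show "A \<in> path_families L J"
    by (auto simp: path_families_def family_def border_path_def)
qed

lemma gp_edges_gamma: "family A \<Longrightarrow> gp_edges A \<subseteq> gamma_graph L"
  using border_path_is_path is_path_edges by (fastforce simp: gp_edges_def family_def)

lemma card_at_most_one:
  assumes "\<And>p q. p \<in> S \<Longrightarrow> q \<in> S \<Longrightarrow> p = q"
  shows "card S = (if S = {} then 0 else 1)"
proof (cases "S = {}")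
  case False
  then obtain p where "p \<in> S" by blast
  then have "S = {p}" using assms by blast
  then show ?thesis by simp
qed simp

lemma card_edge: "family A \<Longrightarrow> card {p \<in> A. e \<in> path_edges p} = (if e \<in> gp_edges A then 1 else 0)"
proof -
  assume A: "family A"
  obtain u v where e: "e = (u, v)" by (cases e)
  have "card {p \<in> A. e \<in> path_edges p} = (if {p \<in> A. e \<in> path_edges p} = {} then 0 else 1)"
    using family_share[OF A] path_edges_in_set unfolding e by (intro card_at_most_one) blast
  then show ?thesis by (auto simp: gp_edges_def)
qed

lemma height_step:
  assumes "family A" and "\<And>p. p \<in> A \<Longrightarrow> Q p \<longleftrightarrow> (r, c) \<in> southeast L p \<and> (r', c') \<notin> southeast L p"
    and "\<And>p. p \<in> A \<Longrightarrow> (r', c') \<in> southeast L p \<Longrightarrow> (r, c) \<in> southeast L p"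
  shows "height A r c = height A r' c' + card {p \<in> A. Q p}"
proof -
  have "{p \<in> A. (r, c) \<in> southeast L p} = {p \<in> A. (r', c') \<in> southeast L p} \<union> {p \<in> A. Q p}"
    using assms by blast
  moreover have "{p \<in> A. (r', c') \<in> southeast L p} \<inter> {p \<in> A. Q p} = {}" using assms by blast
  moreover have "finite A" using assms(1) by (simp add: family_def)
  ultimately show ?thesis unfolding height_def by (simp add: card_Un_disjoint)
qed

lemma southeast_mono:
  "(r', c') \<in> southeast L p \<Longrightarrow> (r, c) \<in> boxes L \<Longrightarrow> r' \<le> r \<Longrightarrow> c \<le> c' \<Longrightarrow> (r, c) \<in> southeast L p"
  using southeast_closed_southeast southeast_closedD by blast

text \<open>The criterion for one path is counted over the family, and disjointness bounds the jump
  by one. The next two lemmas do the same for the northern side and the corner.\<close>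

lemma height_west:
  assumes "family A" "(r, c) \<in> boxes L"
  shows "height A r c = height A r (c + 1) + (if west_edge L (r, c) \<in> gp_edges A then 1 else 0)"
  unfolding card_edge[OF assms(1), symmetric] using west_edge_path_iff family_border_path assms southeast_mono
  by (intro height_step) auto

lemma height_north:
  assumes "family A" "(r, c) \<in> boxes L"
  shows "height A r c = height A (r - 1) c + (if north_edge L (r, c) \<in> gp_edges A then 1 else 0)"
  unfolding card_edge[OF assms(1), symmetric] using north_edge_path_iff family_border_path assms southeast_mono
  by (intro height_step) auto

lemma height_corner:
  assumes "family A" "(r, c) \<in> boxes L"
  shows "height A r c = height A (r - 1) (c + 1) + (if \<exists>p\<in>A. Corner r c \<in> set p then 1 else 0)"
proof -
  have "height A r c = height A (r - 1) (c + 1) + card {p \<in> A. Corner r c \<in> set p}"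
    using corner_path_iff family_border_path assms southeast_mono by (intro height_step) auto
  moreover have "card {p \<in> A. Corner r c \<in> set p} = (if {p \<in> A. Corner r c \<in> set p} = {} then 0 else 1)"
    using family_share[OF assms(1)] by (intro card_at_most_one) blast
  ultimately show ?thesis by auto
qed

lemma height_outside: "(r, c) \<notin> boxes L \<Longrightarrow> height A r c = 0"
  by (simp add: height_def southeast_iff)

text \<open>At a \<open>+\<close> box of \<open>X\<close> the height exceeds that of the diagonal
  neighbour by at most one, the depth by exactly one. At another box of \<open>X\<close> a side is
  missing from the graph, and height and depth are copied from the same neighbour.\<close>

lemma height_le_depth:
  assumes A: "family A" and X: "southeast_closed X" and sub: "\<And>p. p \<in> A \<Longrightarrow> southeast L p \<subseteq> X"
  shows "height A r c \<le> depth X r c"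
proof (cases "(r, c) \<in> boxes L")
  case True
  then show ?thesis
  proof (induction r c rule: quadrant_induct)
    case (outside r c)
    then show ?case using boxesD[of r c] height_outside[of r c] by fastforce
  next
    case (less r c)
    note IH = less.IH
    have r': "r - 1 \<noteq> r" using boxesD[OF less.hyps] by linarith
    have w: "west_edge L (r, c) \<in> gp_edges A \<Longrightarrow> col_plus r c"
      using gp_edges_gamma[OF A] west_edge_in_gamma[OF less.hyps] by blast
    have n: "north_edge L (r, c) \<in> gp_edges A \<Longrightarrow> row_plus r c"
      using gp_edges_gamma[OF A] north_edge_in_gamma[OF less.hyps] by blast
    show ?case
    proof (cases "(r, c) \<in> X")
      case False
      then have "{p \<in> A. (r, c) \<in> southeast L p} = {}" using sub by blast
      then show ?thesis by (simp only: height_def) simp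
    next
      case True
      show ?thesis
      proof (rule depth_cases[OF True less.hyps X])
        assume "\<And>Y. southeast_closed Y \<Longrightarrow> (r, c) \<in> Y \<Longrightarrow> depth Y r c = Suc (depth Y (r - 1) (c + 1))"
        then show ?thesis using height_corner[OF A less.hyps] IH[of "r - 1" "c + 1"] r' X True by auto
      next
        assume "\<not> col_plus r c" "\<And>Y. southeast_closed Y \<Longrightarrow> depth Y r c = depth Y r (c + 1)"
        then show ?thesis using height_west[OF A less.hyps] IH[of r "c + 1"] w X by auto
      next
        assume "\<not> row_plus r c" "\<And>Y. southeast_closed Y \<Longrightarrow> depth Y r c = depth Y (r - 1) c"
        then show ?thesis using height_north[OF A less.hyps] IH[of "r - 1" c] r' n X by auto
      qed
    qed
  qed
qed (simp add: height_outside)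

text \<open>A southeastmost violation would be a place where \<open>A\<close> turns from south to west although the
  depth does not change; the box of that turn carries a \<open>+\<close>, and there the depth must increase.\<close>

lemma depth_le_height:
  assumes A: "family A" and X: "southeast_closed X" and Y: "southeast_closed Y"
    and border: "\<And>r c. (r, c) \<in> X \<Longrightarrow> (r + 1, c - 1) \<notin> boxes L \<Longrightarrow> depth Y r c + d \<le> height A r c"
    and XY: "\<And>r c. (r, c) \<in> X \<Longrightarrow> (r + 1, c - 1) \<in> plus_boxes L \<Longrightarrow> (r + 1, c - 1) \<in> Y"
    and "(r, c) \<in> X"
  shows "depth Y r c + d \<le> height A r c"
proof -
  have "(r, c) \<in> boxes L" using X assms(6) southeast_closed_subset by blast
  then show ?thesis using assms(6)
  proof (induction r c rule: box_greater_induct)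
    case (greater r c)
    note b = greater.hyps
    show ?case
    proof (cases "(r + 1, c - 1) \<in> boxes L")
      case False
      then show ?thesis using border greater.prems by blast
    next
      case True
      have c: "1 \<le> c - 1" "1 \<le> r" "c \<le> width L" using boxesD True boxesD[OF b] by auto
      have right: "(r, c - 1) \<in> boxes L" using boxes_nw[OF True, of r "c - 1"] c by simp
      have down: "(r + 1, c) \<in> boxes L" using boxes_nw[OF True, of "r + 1" c] c by simp
      have inX: "(r, c - 1) \<in> X" "(r + 1, c) \<in> X" "(r + 1, c - 1) \<in> X"
        using southeast_closedD[OF X greater.prems] right down True by auto
      have IH: "depth Y r (c - 1) + d \<le> height A r (c - 1)" "depth Y (r + 1) c + d \<le> height A (r + 1) c"
        "depth Y (r + 1) (c - 1) + d \<le> height A (r + 1) (c - 1)"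
        using greater.IH[OF right] greater.IH[OF down] greater.IH[OF True] inX c by auto
      show ?thesis
      proof (rule ccontr)
        assume less: "\<not> depth Y r c + d \<le> height A r c"
        have c1: "c - 1 + 1 = c" using c by simp
        have "depth Y r c \<le> depth Y r (c - 1)" using depth_mono_step[OF Y right] c1 by simp
        then have "west_edge L (r, c - 1) \<in> gp_edges A"
          using height_west[OF A right] less IH c1 by (auto split: if_splits)
        then have "col_plus r (c - 1)" using gp_edges_gamma[OF A] west_edge_in_gamma[OF right] by blast
        then have cp: "col_plus (r + 1) (c - 1)" using col_plus_mono by simp
        have "depth Y r c \<le> depth Y (r + 1) c" using depth_mono_step[OF Y down] by simp
        then have "north_edge L (r + 1, c) \<in> gp_edges A"
          using height_north[OF A down] less IH by (auto split: if_splits)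
        then have "row_plus (r + 1) c" using gp_edges_gamma[OF A] north_edge_in_gamma[OF down] by blast
        then have rp: "row_plus (r + 1) (c - 1)" using row_plus_mono by simp
        have plus: "(r + 1, c - 1) \<in> plus_boxes L" using le_property[OF True rp cp] .
        have "depth Y (r + 1) (c - 1) = Suc (depth Y r c)"
          using depth_plus[OF XY[OF greater.prems plus] plus] c1 by simp
        moreover have "height A (r + 1) (c - 1) \<le> Suc (height A r c)"
          using height_corner[OF A True] c1 by simp
        ultimately show False using IH less by simp
      qed
    qed
  qed
qed

subsection \<open>Border boxes and endpoints\<close>

lemma border_path_label:
  assumes p: "border_path p"
  obtains (trivial) s where "s \<in> {1..dim_k L}" "p = [Bdry (source L s)]"
  | (proper) s t where "(s, t) \<in> boxes L" "hd p = Bdry (source L s)" "last p = Bdry (sink L t)"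
     "(s, offset s + 1) \<in> southeast L p" "(col_height L t, t) \<in> southeast L p"
  using p
proof (cases rule: border_path_cases)
  case (proper s t)
  have se: "(s, offset s + 1) \<in> southeast L p" "(col_height L t, t) \<in> southeast L p"
    using proper by (auto simp: southeast_iff)
  have st: "1 \<le> s" "s \<le> dim_k L" "1 \<le> t" "t \<le> width L"
    using boxesD[OF proper(1)] boxesD[OF proper(2)] by auto
  have "s \<le> col_height L t"
    using southeast_bounds[OF p proper(3,4) st se(2)] by simp
  then have "(s, t) \<in> boxes L" using boxes_nw[OF proper(2), of s t] st by simp
  then show ?thesis using that(2) proper se by blast
qed (use that in auto)

text \<open>The southeast corner of such a box is the border point reached after \<open>a\<close>
  south steps and \<open>b - 1\<close> west steps. Hence \<open>a + b - 1\<close> separates the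
  sources of the rows up to \<open>a\<close> from the later ones, and the sinks of the columns below
  \<open>b\<close> from the rest.\<close>

lemma border_label:
  assumes b: "(a, b) \<in> boxes L" "(a + 1, b - 1) \<notin> boxes L"
  shows "1 \<le> s \<Longrightarrow> s \<le> dim_k L \<Longrightarrow> source L s \<le> a + b - 1 \<longleftrightarrow> s \<le> a"
    and "1 \<le> t \<Longrightarrow> t \<le> width L \<Longrightarrow> a + b - 1 < sink L t \<longleftrightarrow> b \<le> t"
proof -
  note ab = boxesD[OF b(1)]
  have src: "source L s = s + offset s" for s by (simp add: source_def offset_def)
  assume s: "1 \<le> s" "s \<le> dim_k L"
  show "source L s \<le> a + b - 1 \<longleftrightarrow> s \<le> a"
  proof (cases "s \<le> a")
    case True
    have "offset s \<le> offset a" "offset a < b" using offset_mono[of s a] True s ab b(1) by (auto simp: boxes_iff)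
    then show ?thesis using True src by simp
  next
    case False
    have "b - 1 \<le> offset s"
    proof (rule ccontr)
      assume "\<not> b - 1 \<le> offset s"
      moreover have w: "b - 1 \<le> width L" using ab by linarith
      ultimately have "(s, b - 1) \<in> boxes L" using s by (simp add: boxes_iff)
      then have "(a + 1, b - 1) \<in> boxes L" using boxes_nw[of s "b - 1" "a + 1" "b - 1"] False ab w by simp
      then show False using b by simp
    qed
    then show ?thesis using src False ab by simp
  qed
next
  note ab = boxesD[OF b(1)]
  assume t: "1 \<le> t" "t \<le> width L"
  show "a + b - 1 < sink L t \<longleftrightarrow> b \<le> t"
  proof (cases "b \<le> t")
    case True
    then have "(a, t) \<in> boxes L" using boxes_nw[OF b(1), of a t] ab t by simp
    then show ?thesis using True boxes_col[of a t] ab by (auto simp: sink_def)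
  next
    case False
    have "col_height L t \<le> a"
    proof (rule ccontr)
      assume "\<not> col_height L t \<le> a"
      then have "(a + 1, t) \<in> boxes L" using t by (simp add: boxes_col)
      moreover have "b - 1 \<le> width L" using ab by linarith
      ultimately have "(a + 1, b - 1) \<in> boxes L" using boxes_nw[of "a + 1" t "a + 1" "b - 1"] False ab by simp
      then show False using b by simp
    qed
    then show ?thesis using False by (auto simp: sink_def)
  qed
qed

text \<open>The paths straddling the border point that is reached after \<open>m\<close>
  steps.\<close>

definition crossing :: "vertex list set \<Rightarrow> nat \<Rightarrow> nat" where
  "crossing A m = card {p \<in> A. label (hd p) \<le> m \<and> m < label (last p)}"

lemma label_hd_le_last: "border_path p \<Longrightarrow> label (hd p) \<le> label (last p)"
  by (cases p rule: border_path_label) (use source_less_sink in \<open>auto intro: less_imp_le\<close>)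

text \<open>Labels do not decrease from the head to the end of a path, so the paths starting at a
  label up to \<open>m\<close> are those that also end by \<open>m\<close> and those that straddle
  \<open>m\<close>.\<close>

lemma crossing_count:
  assumes "A \<in> path_families L J"
  shows "crossing A m + card (J \<inter> {..m}) = card (sources L \<inter> {..m})"
proof -
  have A: "family A" "hd ` A = Bdry ` sources L" "last ` A = Bdry ` J"
    using assms by (auto simp: path_families_iff)
  have fin: "finite A" using A by (simp add: family_def)
  have count: "card (K \<inter> {..m}) = card {p \<in> A. label (f p) \<le> m}"
    if f: "f ` A = Bdry ` K" "inj_on f A" for f :: "vertex list \<Rightarrow> vertex" and K
  proof -
    have "inj_on label (range Bdry)" by (auto simp: inj_on_def)
    moreover have "f ` A \<subseteq> range Bdry" using f by auto
    ultimately have inj: "inj_on (label \<circ> f) A" using f(2) by (meson comp_inj_on inj_on_subset)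
    have "K \<inter> {..m} = (label \<circ> f) ` {p \<in> A. label (f p) \<le> m}"
    proof
      show "K \<inter> {..m} \<subseteq> (label \<circ> f) ` {p \<in> A. label (f p) \<le> m}"
      proof
        fix x assume x: "x \<in> K \<inter> {..m}"
        then have "Bdry x \<in> f ` A" using f by simp
        then obtain p where "p \<in> A" "f p = Bdry x" by auto
        then show "x \<in> (label \<circ> f) ` {p \<in> A. label (f p) \<le> m}" using x by (intro image_eqI[of _ _ p]) auto
      qed
      show "(label \<circ> f) ` {p \<in> A. label (f p) \<le> m} \<subseteq> K \<inter> {..m}"
      proof
        fix x assume "x \<in> (label \<circ> f) ` {p \<in> A. label (f p) \<le> m}"
        then obtain p where p: "p \<in> A" "label (f p) \<le> m" "x = label (f p)" by auto
        then have "f p \<in> Bdry ` K" using f by blast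
        then show "x \<in> K \<inter> {..m}" using p by auto
      qed
    qed
    then show ?thesis using inj by (simp add: card_image inj_on_def)
  qed
  have "{p \<in> A. label (hd p) \<le> m} = {p \<in> A. label (hd p) \<le> m \<and> m < label (last p)} \<union> {p \<in> A. label (last p) \<le> m}"
    using label_hd_le_last family_border_path[OF A(1)] by fastforce
  moreover have "{p \<in> A. label (hd p) \<le> m \<and> m < label (last p)} \<inter> {p \<in> A. label (last p) \<le> m} = {}" by auto
  ultimately have "card {p \<in> A. label (hd p) \<le> m} =
      card {p \<in> A. label (hd p) \<le> m \<and> m < label (last p)} + card {p \<in> A. label (last p) \<le> m}"
    using fin by (simp add: card_Un_disjoint)
  then show ?thesis using count[OF A(2)] count[OF A(3)] family_inj_on[OF A(1)] by (simp add: crossing_def)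
qed

text \<open>Straddling the point and having the border box southeast are both decided by the ends of
  a path, and \<open>border_label\<close> shows that the two conditions agree.\<close>

lemma crossing_border:
  assumes "family A" "(a, b) \<in> boxes L" "(a + 1, b - 1) \<notin> boxes L"
  shows "crossing A (a + b - 1) = height A a b"
proof -
  have "(a, b) \<in> southeast L p \<longleftrightarrow> label (hd p) \<le> a + b - 1 \<and> a + b - 1 < label (last p)" if "p \<in> A" for p
    using family_border_path[OF assms(1) that]
  proof (cases p rule: border_path_label)
    case (trivial s)
    then show ?thesis by (simp add: southeast_trivial)
  next
    case (proper s t)
    note st = boxesD[OF proper(1)]
    show ?thesis
      using border_box_southeast_iff[OF family_border_path[OF assms(1) that] proper(2,3) _ _ _ _ assms(2,3)]
        border_label[OF assms(2,3)] st proper(2,3) by simp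
  qed
  then have "{p \<in> A. label (hd p) \<le> a + b - 1 \<and> a + b - 1 < label (last p)} = {p \<in> A. (a, b) \<in> southeast L p}"
    by blast
  then show ?thesis by (simp only: height_def crossing_def)
qed

lemma border_box_exists:
  assumes b: "(s, t) \<in> boxes L" and m: "source L s \<le> m" "m < sink L t"
  shows "\<exists>a b. (a, b) \<in> boxes L \<and> (a + 1, b - 1) \<notin> boxes L \<and> m = a + b - 1"
proof -
  note st = boxesD[OF b]
  have src: "source L s = s + offset s" for s by (simp add: source_def offset_def)
  \<comment> \<open>The maximum \<open>a\<close> is the number of south steps among the first
    \<open>m\<close> border steps, so the point reached is the southeast corner of the box in row
    \<open>a\<close> and column \<open>m + 1 - a\<close>.\<close>
  define S where "S = {r. 1 \<le> r \<and> r \<le> dim_k L \<and> source L r \<le> m}"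
  have fin: "finite S" by (rule finite_subset[of _ "{1..dim_k L}"]) (auto simp: S_def)
  have "s \<in> S" using st m by (simp add: S_def)
  then have "Max S \<in> S" using fin by (metis Max_in empty_iff)
  define a where "a = Max S"
  have a: "1 \<le> a" "a \<le> dim_k L" "a + offset a \<le> m"
    using \<open>Max S \<in> S\<close> src by (auto simp: a_def S_def)
  have max: "m < r + offset r" if "a < r" "r \<le> dim_k L" for r
  proof (rule ccontr)
    assume "\<not> m < r + offset r"
    then have "r \<in> S" using that src by (simp add: S_def)
    then show False using fin that by (simp add: a_def leD)
  qed
  define e where "e = m + 1 - a"
  have "e \<le> width L"
  proof (rule ccontr)
    assume e: "\<not> e \<le> width L"
    have "a + 1 \<le> col_height L t" using e m st unfolding e_def sink_def by linarith
    then have b1: "(a + 1, t) \<in> boxes L" using st by (simp add: boxes_col)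
    then have "offset (a + 1) < t" "a + 1 \<le> dim_k L" by (auto simp: boxes_iff)
    then show False using max[of "a + 1"] e st unfolding e_def by linarith
  qed
  then have 1: "(a, e) \<in> boxes L" using a by (simp add: boxes_iff e_def)
  have 2: "(a + 1, e - 1) \<notin> boxes L"
  proof
    assume "(a + 1, e - 1) \<in> boxes L"
    then have "offset (a + 1) < e - 1" "a + 1 \<le> dim_k L" by (auto simp: boxes_iff)
    then show False using max[of "a + 1"] unfolding e_def by linarith
  qed
  have 3: "m = a + e - 1" using a unfolding e_def by linarith
  show ?thesis using 1 2 3 by blast
qed

text \<open>Reduces statements about all \<open>m\<close> to border boxes: by
  \<open>border_box_exists\<close> nothing straddles any other border point.\<close>

lemma crossing_cases:
  obtains (border) a b where "(a, b) \<in> boxes L" "(a + 1, b - 1) \<notin> boxes L" "m = a + b - 1"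
  | (none) "\<And>A. family A \<Longrightarrow> crossing A m = 0" "\<And>s t. (s, t) \<in> boxes L \<Longrightarrow> \<not> (source L s \<le> m \<and> m < sink L t)"
proof (cases "\<exists>a b. (a, b) \<in> boxes L \<and> (a + 1, b - 1) \<notin> boxes L \<and> m = a + b - 1")
  case False
  then have none: "\<not> (source L s \<le> m \<and> m < sink L t)" if "(s, t) \<in> boxes L" for s t
    using border_box_exists[OF that] by blast
  have "\<not> (label (hd p) \<le> m \<and> m < label (last p))" if "border_path p" for p
    using that by (cases p rule: border_path_label) (use none in auto)
  then have "crossing A m = 0" if "family A" for A
    using family_border_path[OF that] unfolding crossing_def by (metis (mono_tags, lifting) card.empty empty_Collect_eq)
  then show ?thesis using that(2) none by blast
qed (use that(1) in blast)

lemma border_height: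
  assumes "A \<in> path_families L J" "(a, b) \<in> boxes L" "(a + 1, b - 1) \<notin> boxes L"
  shows "height A a b + card (J \<inter> {..a + b - 1}) = card (sources L \<inter> {..a + b - 1})"
  using crossing_count[OF assms(1), of "a + b - 1"] crossing_border[OF _ assms(2,3), of A] assms(1)
  by (simp add: path_families_iff)

subsection \<open>Families are determined by their edges\<close>

lemma gp_edges_single_valued:
  assumes "family A"
  shows "single_valued (gp_edges A)"
proof (rule single_valuedI)
  fix u v v' assume "(u, v) \<in> gp_edges A" "(u, v') \<in> gp_edges A"
  then obtain p q where p: "p \<in> A" "(u, v) \<in> path_edges p" and q: "q \<in> A" "(u, v') \<in> path_edges q"
    by (auto simp: gp_edges_def)
  have "p = q" using family_share[OF assms p(1) q(1)] p q path_edges_in_set by blast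
  then show "v = v'" using path_edge_unique(1)[of p u v v'] family_border_path[OF assms p(1)] p q border_path_is_path by blast
qed

lemma family_last_no_edge: "family A \<Longrightarrow> p \<in> A \<Longrightarrow> last p \<notin> Domain (gp_edges A)"
proof
  assume A: "family A" and p: "p \<in> A" and "last p \<in> Domain (gp_edges A)"
  then obtain q v where q: "q \<in> A" "(last p, v) \<in> path_edges q" by (auto simp: gp_edges_def)
  have "last p \<in> set p" using border_path_nonempty family_border_path[OF A p] by simp
  then have "q = p" using family_share[OF A q(1) p] path_edges_in_set[OF q(2)] by blast
  then show False using q no_edge_from_last border_path_is_path family_border_path[OF A p] by blast
qed

lemma family_path_eq:
  assumes "family A" "family A'" "gp_edges A = gp_edges A'" "p \<in> A" "q \<in> A'" "hd p = hd q"
  shows "p = q"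
proof (rule finite_path_eq[of "gp_edges A"])
  show "successively (\<lambda>u v. (u, v) \<in> gp_edges A) p"
    using assms(4) by (auto simp: successively_iff_path_edges gp_edges_def)
  show "successively (\<lambda>u v. (u, v) \<in> gp_edges A) q"
    unfolding assms(3) using assms(5) by (auto simp: successively_iff_path_edges gp_edges_def)
  show "p \<noteq> []" "q \<noteq> []" using assms family_border_path border_path_nonempty by blast+
  show "last p \<notin> Domain (gp_edges A)" using family_last_no_edge assms by blast
  show "last q \<notin> Domain (gp_edges A)" unfolding assms(3) using family_last_no_edge assms by blast
qed (use assms gp_edges_single_valued in auto)

text \<open>Every edge is a side of a box, and the jump of the height across it tells whether it is
  used.\<close>

lemma gp_edges_eq:
  assumes "family A" "family A'" "\<And>r c. height A r c = height A' r c"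
  shows "gp_edges A = gp_edges A'"
proof -
  have sub: "gp_edges A \<subseteq> gp_edges A'" if A: "family A" "family A'" "\<And>r c. height A r c = height A' r c" for A A'
  proof
    fix e assume e: "e \<in> gp_edges A"
    obtain u v where uv: "e = (u, v)" by (cases e)
    have "(u, v) \<in> gamma_graph L" using e uv gp_edges_gamma[OF A(1)] by blast
    then show "e \<in> gp_edges A'"
    proof (cases rule: gamma_graph_cases)
      case (north r c)
      have "north_edge L (r, c) \<in> gp_edges A" using e uv north(3) by metis
      then have "height A r c = height A (r - 1) c + 1" using height_north[OF A(1) north(1)] by simp
      then have "height A' r c = height A' (r - 1) c + 1" using A(3) by metis
      then have "north_edge L (r, c) \<in> gp_edges A'"
        using height_north[OF A(2) north(1)] by (metis add_cancel_right_right one_neq_zero)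
      then show ?thesis using uv north(3) by metis
    next
      case (west r c)
      have "west_edge L (r, c) \<in> gp_edges A" using e uv west(3) by metis
      then have "height A r c = height A r (c + 1) + 1" using height_west[OF A(1) west(1)] by simp
      then have "height A' r c = height A' r (c + 1) + 1" using A(3) by metis
      then have "west_edge L (r, c) \<in> gp_edges A'"
        using height_west[OF A(2) west(1)] by (metis add_cancel_right_right one_neq_zero)
      then show ?thesis using uv west(3) by metis
    qed
  qed
  show ?thesis using sub[OF assms] sub[OF assms(2,1)] assms(3) by auto
qed

text \<open>Equal ends give equal heights on the border boxes. From there
  \<open>depth_le_height\<close> with \<open>d = 0\<close> and \<open>Y = X\<close> carries the
  lower bound inwards, while \<open>height_le_depth\<close> is the upper bound. Equal heights give
  equal edges, and a path is determined by its source and the edges.\<close>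

lemma family_unique:
  assumes A: "A \<in> path_families L J" and A': "A' \<in> path_families L J" and X: "southeast_closed X"
    and h: "\<And>r c. height A r c = depth X r c" and sub: "\<And>p. p \<in> A' \<Longrightarrow> southeast L p \<subseteq> X"
  shows "A' = A"
proof -
  have fam: "family A" "family A'" and hds: "hd ` A = hd ` A'" using A A' by (auto simp: path_families_iff)
  have "height A' r c = depth X r c" for r c
  proof (rule antisym)
    show le: "height A' r c \<le> depth X r c" using height_le_depth[OF fam(2) X sub] .
    show "depth X r c \<le> height A' r c"
    proof (cases "(r, c) \<in> X")
      case True
      have border: "depth X r c + 0 \<le> height A' r c" if "(r, c) \<in> X" "(r + 1, c - 1) \<notin> boxes L" for r c
      proof -
        have b: "(r, c) \<in> boxes L" using that X southeast_closed_subset by blast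
        show ?thesis using border_height[OF A b that(2)] border_height[OF A' b that(2)] h[of r c] by simp
      qed
      have XY: "(r + 1, c - 1) \<in> X" if "(r, c) \<in> X" "(r + 1, c - 1) \<in> plus_boxes L" for r c
        using southeast_closedD[OF X that(1)] plus_boxes_subset that(2) by auto
      show ?thesis using depth_le_height[OF fam(2) X X border XY True] by simp
    qed (simp add: depth_outside)
  qed
  then have edges: "gp_edges A = gp_edges A'" using gp_edges_eq[OF fam] h by simp
  show ?thesis
  proof
    show "A' \<subseteq> A"
    proof
      fix p assume "p \<in> A'"
      then obtain q where "q \<in> A" "hd p = hd q" using hds by (metis imageE image_eqI)
      then show "p \<in> A" using family_path_eq[OF fam edges] \<open>p \<in> A'\<close> by metis
    qed
    show "A \<subseteq> A'"
    proof
      fix p assume "p \<in> A"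
      then obtain q where "q \<in> A'" "hd p = hd q" using hds by (metis imageE image_eqI)
      then show "p \<in> A'" using family_path_eq[OF fam edges] \<open>p \<in> A\<close> by metis
    qed
  qed
qed

subsection \<open>Families with a prescribed height function\<close>

text \<open>Conservation at corners lets walks from the sources end only on the border, and backward
  uniqueness makes them disjoint. Every edge can be traced back to a source, so the walks cover all
  of \<open>E\<close>; the sources that \<open>E\<close> does not leave become trivial
  paths.\<close>

lemma family_of_edges:
  assumes EG: "E \<subseteq> gamma_graph L" and sv: "single_valued E" and svc: "single_valued (E\<inverse>)"
    and flow_out: "\<And>u r c. (u, Corner r c) \<in> E \<Longrightarrow> \<exists>v. (Corner r c, v) \<in> E"
    and flow_in: "\<And>v r c. (Corner r c, v) \<in> E \<Longrightarrow> \<exists>u. (u, Corner r c) \<in> E"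
  shows "\<exists>A. family A \<and> hd ` A = Bdry ` sources L \<and> gp_edges A = E"
proof -
  have no_in_source: "(u, Bdry m) \<notin> E" if "m \<in> sources L" for u m
  proof
    assume "(u, Bdry m) \<in> E"
    then obtain t where "(col_height L t, t) \<in> boxes L" "m = sink L t" using EG gamma_in_bdry by (metis subsetD)
    then show False using that boxesD sources_sinks_disjoint by (force simp: sinks_def)
  qed
  \<comment> \<open>The rank increases along every edge, because a step west or south raises
    \<open>r + c\<close> by one; sources lie below all corners, and \<open>K\<close> lies above all
    of them.\<close>
  define K where "K = dim_k L + width L + 2"
  define rank where "rank v = (case v of Bdry m \<Rightarrow> if m \<in> sources L then 0 else K | Corner r c \<Rightarrow> r + c)" for v
  have rank: "rank u < rank v \<and> rank v \<le> K" if "(u, v) \<in> E" for u v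
  proof -
    have g: "(u, v) \<in> gamma_graph L" using that EG by blast
    show ?thesis
    proof (cases u)
      case (Bdry m)
      then obtain s where s: "(s, offset s + 1) \<in> boxes L" "m = source L s" "v = Corner s (offset s + 1)"
        using g gamma_out_bdry by metis
      then have "m \<in> sources L" using boxesD[OF s(1)] by (auto simp: sources_def)
      then show ?thesis using s boxesD[OF s(1)] Bdry by (auto simp: rank_def K_def)
    next
      case (Corner r c)
      note gc = gamma_out_corner[OF g[unfolded Corner]]
      have "Bdry (sink L c) = Bdry m \<Longrightarrow> m \<notin> sources L" for m
        using boxesD[OF gc(1)] source_neq_sink by (force simp: sources_def)
      then show ?thesis using gc boxesD[OF gc(1)] boxesD[of r "c + 1"] boxesD[of "r + 1" c] Corner
        by (auto simp: rank_def K_def)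
    qed
  qed
  have "\<exists>p. p \<noteq> [] \<and> hd p = u \<and> successively (\<lambda>u v. (u, v) \<in> E) p \<and> last p \<notin> Domain E" for u
  proof (induction "K - rank u" arbitrary: u rule: less_induct)
    case less
    show ?case
    proof (cases "u \<in> Domain E")
      case False
      then show ?thesis by (intro exI[of _ "[u]"]) auto
    next
      case True
      then obtain v where v: "(u, v) \<in> E" by blast
      have "K - rank v < K - rank u" using rank[OF v] by linarith
      then obtain p where p: "p \<noteq> []" "hd p = v" "successively (\<lambda>u v. (u, v) \<in> E) p" "last p \<notin> Domain E"
        using less by blast
      then show ?thesis using v by (intro exI[of _ "u # p"]) (cases p, auto)
    qed
  qed
  then obtain P where P: "P u \<noteq> []" "hd (P u) = u" "successively (\<lambda>u v. (u, v) \<in> E) (P u)" "last (P u) \<notin> Domain E" for u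
    by metis
  have closed: "w \<in> set (P u) \<and> (v, w) \<in> path_edges (P u)" if vP: "v \<in> set (P u)" and "(v, w) \<in> E" for u v w
  proof -
    have "v \<noteq> last (P u)" using P(4) that by blast
    then obtain w' where w': "(v, w') \<in> path_edges (P u)" using next_vertex[OF vP] by metis
    then have "(v, w') \<in> E" using P(3) by (auto simp: successively_iff_path_edges)
    then have "w' = w" using sv that by (metis single_valuedD)
    then show ?thesis using w' path_edges_in_set by blast
  qed
  define A where "A = (\<lambda>s. P (Bdry s)) ` sources L"
  have bp: "border_path p" if p: "p \<in> A" for p
  proof -
    obtain s where s: "s \<in> sources L" "p = P (Bdry s)" using p by (auto simp: A_def)
    have "path_edges p \<subseteq> E" using P(3) s by (auto simp: successively_iff_path_edges)
    then have "is_path L p" using EG P(1) s by (auto simp: is_path_edges)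
    moreover have "last p \<in> range Bdry"
    proof (cases "last p")
      case (Corner r c)
      have "last p \<noteq> hd p" using P(2) s Corner by simp
      then obtain u where "(u, last p) \<in> path_edges p" using prev_vertex[of "last p" p] P(1) s by auto
      then have "(u, Corner r c) \<in> E" using \<open>path_edges p \<subseteq> E\<close> Corner by auto
      then have "last p \<in> Domain E" using flow_out Corner by (metis DomainI)
      then show ?thesis using P(4) s by simp
    qed auto
    ultimately show ?thesis using s P(2) by (simp add: border_path_def)
  qed
  have disj: "set p \<inter> set q = {}" if pq: "p \<in> A" "q \<in> A" "p \<noteq> q" for p q
  proof (rule ccontr)
    assume "set p \<inter> set q \<noteq> {}"
    then obtain v where v: "v \<in> set p" "v \<in> set q" by blast
    obtain s where s: "s \<in> sources L" "p = P (Bdry s)" using pq by (auto simp: A_def)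
    obtain s' where s': "s' \<in> sources L" "q = P (Bdry s')" using pq by (auto simp: A_def)
    have "(Bdry s, v) \<in> E\<^sup>*" "(Bdry s', v) \<in> E\<^sup>*" using path_reachable P s s' v by metis+
    then have "(v, Bdry s) \<in> (E\<inverse>)\<^sup>*" "(v, Bdry s') \<in> (E\<inverse>)\<^sup>*" by (auto simp: rtrancl_converse)
    then have "(Bdry s, Bdry s') \<in> (E\<inverse>)\<^sup>* \<or> (Bdry s', Bdry s) \<in> (E\<inverse>)\<^sup>*"
      using single_valued_confluent[OF svc] by blast
    moreover have "Bdry s \<notin> Domain (E\<inverse>)" "Bdry s' \<notin> Domain (E\<inverse>)"
      using no_in_source s s' by auto
    ultimately have "s = s'" by (auto simp: Not_Domain_rtrancl)
    then show False using s s' pq by simp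
  qed
  have fam: "family A" using disjoint_paths_family bp disj by blast
  have hds: "hd ` A = Bdry ` sources L" unfolding A_def using P(2) by (force simp: image_image)
  have cover: "\<exists>p\<in>A. u \<in> set p" if "(u, v) \<in> E" for u v
    using that
  proof (induction "rank u" arbitrary: u v rule: less_induct)
    case less
    show ?case
    proof (cases u)
      case (Bdry m)
      then obtain s where "(s, offset s + 1) \<in> boxes L" "m = source L s"
        using less.prems EG gamma_out_bdry by (metis subsetD)
      then have "m \<in> sources L" using boxesD by (auto simp: sources_def)
      then have "P u \<in> A" using Bdry by (simp add: A_def)
      moreover have "u \<in> set (P u)" using P(1,2) by (metis hd_in_set)
      ultimately show ?thesis by blast
    next
      case (Corner r c)
      then obtain w where w: "(w, u) \<in> E" using flow_in less.prems by blast
      then obtain p where p: "p \<in> A" "w \<in> set p" using less.hyps rank by metis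
      then have "u \<in> set p" using closed w by (auto simp: A_def)
      then show ?thesis using p by blast
    qed
  qed
  have edges: "gp_edges A = E"
  proof
    show "gp_edges A \<subseteq> E" using P(3) by (auto simp: gp_edges_def A_def successively_iff_path_edges)
    show "E \<subseteq> gp_edges A"
    proof
      fix e assume e: "e \<in> E"
      obtain u v where uv: "e = (u, v)" by (cases e)
      obtain p where p: "p \<in> A" "u \<in> set p" using cover e uv by blast
      then have "(u, v) \<in> path_edges p" using closed e uv by (auto simp: A_def)
      then show "e \<in> gp_edges A" using p uv by (auto simp: gp_edges_def)
    qed
  qed
  then show ?thesis using fam hds by blast
qed

text \<open>The edges are the sides across which \<open>f\<close> jumps. The two ways from
  \<open>(r - 1, c + 1)\<close> to \<open>(r, c)\<close> cross the possible incoming edges of the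
  corner on one side and the outgoing ones on the other. Both have the total jump
  \<open>f r c - f (r - 1) (c + 1)\<close>, which gives conservation, and \<open>diag\<close> allows
  at most one edge each way.\<close>

lemma family_of_height:
  fixes f :: "nat \<Rightarrow> nat \<Rightarrow> nat"
  assumes out: "\<And>r c. (r, c) \<notin> boxes L \<Longrightarrow> f r c = 0"
    and left: "\<And>r c. (r, c) \<in> boxes L \<Longrightarrow> f r (c + 1) \<le> f r c"
    and up: "\<And>r c. (r, c) \<in> boxes L \<Longrightarrow> f (r - 1) c \<le> f r c"
    and diag: "\<And>r c. (r, c) \<in> boxes L \<Longrightarrow> f r c \<le> Suc (f (r - 1) (c + 1))"
    and col: "\<And>r c. (r, c) \<in> boxes L \<Longrightarrow> f r (c + 1) \<noteq> f r c \<Longrightarrow> col_plus r c"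
    and row: "\<And>r c. (r, c) \<in> boxes L \<Longrightarrow> f (r - 1) c \<noteq> f r c \<Longrightarrow> row_plus r c"
  shows "\<exists>A. family A \<and> hd ` A = Bdry ` sources L \<and> (\<forall>r c. height A r c = f r c)"
proof -
  define E where "E = {north_edge L (r, c) | r c. (r, c) \<in> boxes L \<and> f (r - 1) c \<noteq> f r c} \<union>
     {west_edge L (r, c) | r c. (r, c) \<in> boxes L \<and> f r (c + 1) \<noteq> f r c}"
  have EG: "E \<subseteq> gamma_graph L"
    unfolding E_def gamma_graph_eq using col row by blast
  have En: "north_edge L (r, c) \<in> E \<longleftrightarrow> (r, c) \<in> boxes L \<and> f (r - 1) c \<noteq> f r c" for r c
    unfolding E_def using north_edge_inject north_neq_west by auto
  have Ew: "west_edge L (r, c) \<in> E \<longleftrightarrow> (r, c) \<in> boxes L \<and> f r (c + 1) \<noteq> f r c" for r c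
    unfolding E_def using west_edge_inject north_neq_west[symmetric] by auto
  have left': "f (r - 1) (c + 1) \<le> f (r - 1) c" if "(r, c) \<in> boxes L" for r c
  proof (cases "(r - 1, c) \<in> boxes L")
    case False
    then have "r - 1 = 0" using boxes_nw[OF that, of "r - 1" c] boxesD[OF that] by force
    moreover have "(0, c + 1) \<notin> boxes L" using boxesD[of 0 "c + 1"] by force
    ultimately show ?thesis using out[of 0 "c + 1"] by simp
  qed (use left in blast)
  have up': "f (r - 1) (c + 1) \<le> f r (c + 1)" if "(r, c) \<in> boxes L" for r c
  proof (cases "(r, c + 1) \<in> boxes L")
    case False
    then have "c = width L" using left_box_or_outside[OF that] by simp
    then have "(r - 1, c + 1) \<notin> boxes L" using boxesD[of "r - 1" "c + 1"] by auto
    then show ?thesis using out by simp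
  qed (use up in blast)
  have in_cases: "(r, c) \<in> boxes L \<and> (u = Corner (r - 1) c \<and> (r - 1, c) \<in> boxes L \<and> f (r - 1) (c + 1) < f (r - 1) c \<or>
      north_edge L (r, c) = (u, Corner r c) \<and> f (r - 1) c < f r c)" if e: "(u, Corner r c) \<in> E" for u r c
  proof -
    have g: "(u, Corner r c) \<in> gamma_graph L" using e EG by blast
    show ?thesis
      using gamma_in_corner[OF g] En[of r c] Ew[of "r - 1" c] e left[of "r - 1" c] up[of r c]
      by (metis le_neq_implies_less)
  qed
  have out_cases: "(r, c) \<in> boxes L \<and> (v = Corner r (c + 1) \<and> (r, c + 1) \<in> boxes L \<and> f (r - 1) (c + 1) < f r (c + 1) \<or>
      west_edge L (r, c) = (Corner r c, v) \<and> f r (c + 1) < f r c)" if e: "(Corner r c, v) \<in> E" for v r c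
  proof -
    have g: "(Corner r c, v) \<in> gamma_graph L" using e EG by blast
    show ?thesis
      using gamma_out_corner[OF g] En[of r "c + 1"] Ew[of r c] e left[of r c] up[of r "c + 1"]
      by (metis le_neq_implies_less)
  qed
  have sv: "single_valued E"
  proof (rule single_valuedI)
    fix u v v' assume e: "(u, v) \<in> E" "(u, v') \<in> E"
    show "v = v'"
    proof (cases u)
      case (Bdry m)
      obtain s where s: "(s, offset s + 1) \<in> boxes L" "m = source L s" "v = Corner s (offset s + 1)"
        using e EG Bdry gamma_out_bdry by (metis subsetD)
      obtain s' where s': "(s', offset s' + 1) \<in> boxes L" "m = source L s'" "v' = Corner s' (offset s' + 1)"
        using e EG Bdry gamma_out_bdry by (metis subsetD)
      have "s = s'" using s(1,2) s'(1,2) source_inject boxesD by metis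
      then show ?thesis using s s' by simp
    next
      case (Corner r c)
      have b: "(r, c) \<in> boxes L" using out_cases e Corner by blast
      show ?thesis
        using out_cases[of r c v] out_cases[of r c v'] e Corner diag[OF b] by auto
    qed
  qed
  have svc: "single_valued (E\<inverse>)"
  proof (rule single_valuedI)
    fix v u u' assume "(v, u) \<in> E\<inverse>" "(v, u') \<in> E\<inverse>"
    then have e: "(u, v) \<in> E" "(u', v) \<in> E" by auto
    show "u = u'"
    proof (cases v)
      case (Bdry m)
      obtain s where s: "(col_height L s, s) \<in> boxes L" "m = sink L s" "u = Corner (col_height L s) s"
        using e EG Bdry gamma_in_bdry by (metis subsetD)
      obtain s' where s': "(col_height L s', s') \<in> boxes L" "m = sink L s'" "u' = Corner (col_height L s') s'"
        using e EG Bdry gamma_in_bdry by (metis subsetD)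
      have "s = s'" using s(1,2) s'(1,2) sink_inject boxesD by metis
      then show ?thesis using s s' by simp
    next
      case (Corner r c)
      have b: "(r, c) \<in> boxes L" using in_cases e Corner by blast
      show ?thesis
        using in_cases[of u r c] in_cases[of u' r c] e Corner diag[OF b] by auto
    qed
  qed
  have flow_out: "\<exists>v. (Corner r c, v) \<in> E" if "(u, Corner r c) \<in> E" for u r c
  proof -
    have b: "(r, c) \<in> boxes L" using in_cases[OF that] by blast
    have "f (r - 1) (c + 1) < f r c"
      using in_cases[OF that] left'[OF b] up[OF b] by auto
    then consider "f r (c + 1) \<noteq> f r c" | "f (r - 1) (c + 1) \<noteq> f r (c + 1)" by fastforce
    then show ?thesis
    proof cases
      case 1
      then have "west_edge L (r, c) \<in> E" using Ew b by blast
      then show ?thesis by (metis west_edge.simps)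
    next
      case 2
      then have "(r, c + 1) \<in> boxes L" using up'[OF b] out[of r "c + 1"] by fastforce
      then have "north_edge L (r, c + 1) \<in> E" using En 2 by blast
      then show ?thesis using north_edge_inner[OF b] by metis
    qed
  qed
  have flow_in: "\<exists>u. (u, Corner r c) \<in> E" if "(Corner r c, v) \<in> E" for v r c
  proof -
    have b: "(r, c) \<in> boxes L" using out_cases[OF that] by blast
    have "f (r - 1) (c + 1) < f r c"
      using out_cases[OF that] left[OF b] up'[OF b] by auto
    then consider "f (r - 1) c \<noteq> f r c" | "f (r - 1) (c + 1) \<noteq> f (r - 1) c" by fastforce
    then show ?thesis
    proof cases
      case 1
      then have "north_edge L (r, c) \<in> E" using En b by blast
      then show ?thesis by (metis north_edge.simps)
    next
      case 2
      then have "(r - 1, c) \<in> boxes L" using left'[OF b] out[of "r - 1" c] by fastforce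
      then have "west_edge L (r - 1, c) \<in> E" using Ew[of "r - 1" c] 2 by simp
      moreover have "west_edge L (r - 1, c) = (Corner (r - 1) c, Corner r c)"
        using west_edge_inner[of "r - 1" c] b boxesD[OF b] by simp
      ultimately show ?thesis by metis
    qed
  qed
  have "\<exists>A. family A \<and> hd ` A = Bdry ` sources L \<and> gp_edges A = E"
    by (rule family_of_edges[OF EG sv svc]) (fact flow_out, fact flow_in)
  then obtain A where fam: "family A" and hds: "hd ` A = Bdry ` sources L" and edges: "gp_edges A = E"
    by blast
  have "height A r c = f r c" for r c
  proof (cases "(r, c) \<in> boxes L")
    case True
    then show ?thesis
    proof (induction r c rule: box_less_induct)
      case (less r c)
      have "height A r (c + 1) = f r (c + 1)"
        using less.IH[of r "c + 1"] out height_outside by (cases "(r, c + 1) \<in> boxes L") auto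
      moreover have "f r c \<le> Suc (f r (c + 1))" using diag[OF less.hyps] up'[OF less.hyps] by simp
      ultimately show ?case
        using height_west[OF fam less.hyps] Ew[of r c] edges left[OF less.hyps] less.hyps by auto
    qed
  qed (simp add: out height_outside)
  then show ?thesis using fam hds by blast
qed

end

section \<open>The sets \<open>M'(B)\<close> and \<open>M(B)\<close>\<close>

lemma nat_set_eqI:
  fixes J K :: "nat set"
  assumes "\<And>m. card (J \<inter> {..m}) = card (K \<inter> {..m})"
  shows "J = K"
proof -
  have below: "card (J \<inter> {..<m}) = card (K \<inter> {..<m})" for m
    using assms by (cases m) (simp_all add: lessThan_Suc_atMost)
  have step: "card (S \<inter> {..m}) = card (S \<inter> {..<m}) + (if m \<in> S then 1 else 0)" for S and m :: nat
  proof -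
    have "S \<inter> {..m} = (if m \<in> S then insert m (S \<inter> {..<m}) else S \<inter> {..<m})"
      by (auto simp: le_less)
    then show ?thesis by simp
  qed
  have "m \<in> J \<longleftrightarrow> m \<in> K" for m
    using assms[of m] below[of m] step[of J m] step[of K m] by (cases "m \<in> J"; cases "m \<in> K") simp_all
  then show ?thesis by blast
qed

text \<open>At the first difference, a smaller entry \<open>y\<close> of \<open>J\<close> would give
  \<open>J\<close> more elements up to \<open>y\<close> than \<open>K\<close>, whose elements up to
  \<open>y\<close> all lie in the common prefix.\<close>

lemma sorted_list_of_set_lexord:
  fixes J K :: "nat set"
  assumes fin: "finite J" "finite K" "card K = card J" and ne: "K \<noteq> J"
    and le: "\<And>m. card (J \<inter> {..m}) \<le> card (K \<inter> {..m})"
  shows "(sorted_list_of_set K, sorted_list_of_set J) \<in> lexord {(a, b). a < b}"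
proof -
  let ?K = "sorted_list_of_set K" and ?J = "sorted_list_of_set J"
  have "?K \<noteq> ?J" using ne fin by (metis set_sorted_list_of_set)
  moreover have "length ?K = length ?J" using fin by simp
  ultimately obtain pre x xs y ys where eq: "x \<noteq> y" "?K = pre @ [x] @ xs" "?J = pre @ [y] @ ys"
    using same_length_different by blast
  have K: "sorted_wrt (<) (pre @ [x] @ xs)" "set (pre @ [x] @ xs) = K"
    unfolding eq(2)[symmetric] using fin by (simp_all add: strict_sorted_list_of_set)
  have J: "sorted_wrt (<) (pre @ [y] @ ys)" "set (pre @ [y] @ ys) = J"
    unfolding eq(3)[symmetric] using fin by (simp_all add: strict_sorted_list_of_set)
  have "\<not> y < x"
  proof
    assume yx: "y < x"
    have "K \<inter> {..y} \<subseteq> set pre"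
      unfolding K(2)[symmetric] using K(1) yx by (auto simp: sorted_wrt_append)
    then have "card (K \<inter> {..y}) \<le> card (set pre)" by (simp add: card_mono)
    also have "\<dots> < card (insert y (set pre))"
      using J(1) by (auto simp: sorted_wrt_append card_insert_if)
    also have "\<dots> \<le> card (J \<inter> {..y})"
      using J fin(1) by (intro card_mono) (auto simp: sorted_wrt_append)
    finally show False using le[of y] by simp
  qed
  then have "x < y" using eq(1) by simp
  then show ?thesis unfolding eq by (simp add: lexord_append_left_rightI)
qed

text \<open>Comparing all initial counts is stronger than comparing lexicographically, so a set with
  the least counts is the maximum; asymmetry of the order makes it the only one.\<close>

lemma lexmax_eqI:
  assumes J: "J \<in> \<J>" "finite J" and K: "\<And>K. K \<in> \<J> \<Longrightarrow> finite K \<and> card K = card J"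
    and le: "\<And>K m. K \<in> \<J> \<Longrightarrow> card (J \<inter> {..m}) \<le> card (K \<inter> {..m})"
  shows "lexmax \<J> = J"
  unfolding lexmax_def
proof (rule the_equality)
  have lt: "(sorted_list_of_set K, sorted_list_of_set J) \<in> lexord {(a, b). a < b}" if "K \<in> \<J>" "K \<noteq> J" for K
    using sorted_list_of_set_lexord[OF J(2)] K le that by blast
  then show "J \<in> \<J> \<and> (\<forall>K\<in>\<J>. K \<noteq> J \<longrightarrow>
        (sorted_list_of_set K, sorted_list_of_set J) \<in> lexord {(a, b). a < b})"
    using J by blast
  fix J' assume J': "J' \<in> \<J> \<and> (\<forall>K\<in>\<J>. K \<noteq> J' \<longrightarrow>
        (sorted_list_of_set K, sorted_list_of_set J') \<in> lexord {(a, b). a < b})"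
  show "J' = J"
  proof (rule ccontr)
    assume ne: "J' \<noteq> J"
    then have "(sorted_list_of_set J, sorted_list_of_set J') \<in> lexord {(a, b). a < b}" using J' J by auto
    moreover have "(sorted_list_of_set J', sorted_list_of_set J) \<in> lexord {(a, b). a < b}" using lt J' ne by auto
    moreover have "asym {(a :: nat, b). a < b}" by (auto intro: asymI)
    ultimately show False using lexord_asymmetric by blast
  qed
qed

context le_diag
begin

text \<open>For a box of the diagram this is the region of its hook (\<open>southeast_hook\<close>);
  \<open>strict_se\<close> is the region left to the families that compete for
  \<open>M'\<close>.\<close>

definition weak_se :: "nat \<Rightarrow> nat \<Rightarrow> box set" where
  "weak_se r c = {(a, b) \<in> boxes L. r \<le> a \<and> b \<le> c}"

definition strict_se :: "nat \<Rightarrow> nat \<Rightarrow> box set" where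
  "strict_se r c = {(a, b) \<in> boxes L. r < a \<and> b < c}"

lemma weak_se_closed: "southeast_closed (weak_se r c)"
  by (rule southeast_closedI) (auto simp: weak_se_def)

lemma strict_se_closed: "southeast_closed (strict_se r c)"
  by (rule southeast_closedI) (auto simp: strict_se_def)

lemma dim_n_eq: "dim_n L = dim_k L + width L"
  using le by (simp add: is_le_diagram_def width_def)

lemma source_range: "1 \<le> s \<Longrightarrow> s \<le> dim_k L \<Longrightarrow> source L s \<in> {1..dim_n L}"
  by (auto simp: source_def dim_n_eq)

lemma col_height_le: "1 \<le> t \<Longrightarrow> t \<le> width L \<Longrightarrow> col_height L t \<le> dim_k L"
  using boxes_col[of "col_height L t" t] boxesD[of "col_height L t" t] by (cases "col_height L t = 0") auto

lemma sink_range: "1 \<le> t \<Longrightarrow> t \<le> width L \<Longrightarrow> sink L t \<in> {1..dim_n L}"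
  using col_height_le[of t] by (auto simp: sink_def dim_n_eq)

lemma card_sources: "card (sources L) = dim_k L"
proof -
  have "inj_on (source L) {1..dim_k L}" using source_inject by (auto simp: inj_on_def)
  then show ?thesis by (simp add: sources_def card_image)
qed

lemma target_k_subset:
  assumes "A \<in> path_families L J"
  shows "J \<in> k_subsets (dim_k L) (dim_n L)"
proof -
  have A: "family A" "hd ` A = Bdry ` sources L" "last ` A = Bdry ` J"
    using assms by (auto simp: path_families_iff)
  have inj: "inj_on Bdry S" for S by (auto simp: inj_on_def)
  have "card J = card (last ` A)" using A(3) inj by (simp add: card_image)
  also have "\<dots> = card (hd ` A)" using family_inj_on[OF A(1)] by (simp add: card_image)
  also have "\<dots> = dim_k L" using A(2) inj card_sources by (simp add: card_image)
  finally have card: "card J = dim_k L" .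
  have "m \<in> {1..dim_n L}" if m: "m \<in> J" for m
  proof -
    have "Bdry m \<in> last ` A" using A(3) m by blast
    then obtain p where p: "p \<in> A" "last p = Bdry m" by (metis imageE)
    show ?thesis using family_border_path[OF A(1) p(1)]
    proof (cases p rule: border_path_label)
      case (trivial s)
      then show ?thesis using source_range p by auto
    next
      case (proper s t)
      then show ?thesis using sink_range[of t] boxesD[OF proper(1)] p by auto
    qed
  qed
  then show ?thesis using card by (auto simp: k_subsets_def)
qed

lemma le_matroid_iff: "J \<in> le_matroid L \<longleftrightarrow> path_families L J \<noteq> {}"
  using target_k_subset by (auto simp: le_matroid_def)

text \<open>Only a trivial path can end at a source, and paths of a family with the same head
  coincide.\<close>

lemma source_target_trivial:
  assumes A: "A \<in> path_families L J" "p \<in> A" "hd p = Bdry m" "m \<in> J" "m \<in> sources L"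
  shows "p = [Bdry m]"
proof -
  have fam: "family A" "last ` A = Bdry ` J" using A by (auto simp: path_families_iff)
  have "Bdry m \<in> last ` A" using fam(2) A(4) by blast
  then obtain q where q: "q \<in> A" "last q = Bdry m" by (metis imageE)
  have "q = [Bdry m]" using family_border_path[OF fam(1) q(1)]
  proof (cases q rule: border_path_label)
    case (proper s t)
    then have "m = sink L t" using q by simp
    then show ?thesis using A(5) sources_sinks_disjoint boxesD[OF proper(1)] by (auto simp: sinks_def)
  qed (use q in auto)
  then have "hd q = hd p" using A by simp
  then show ?thesis using inj_onD[OF family_inj_on(1)[OF fam(1)] _ q(1) A(2)] \<open>q = [Bdry m]\<close> by simp
qed

lemma A_set_iff:
  assumes "(r, c) \<in> boxes L"
  shows "m \<in> A_set L (r, c) \<longleftrightarrow> m \<in> {1..dim_n L} \<and> (m \<le> source L r \<or> sink L c \<le> m)"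
  using source_less_sink[OF assms] by (auto simp: A_set.simps)

text \<open>Labels in \<open>A_set\<close> are not moved, so a nontrivial path has both ends
  strictly between \<open>source L r\<close> and \<open>sink L c\<close>. It therefore starts below
  row \<open>r\<close> and ends to the right of column \<open>c\<close>.\<close>

lemma southeast_within_strict_se:
  assumes b: "(r, c) \<in> boxes L" and A: "A \<in> path_families L K" and K: "K \<inter> A_set L (r, c) = sources L \<inter> A_set L (r, c)"
    and p: "p \<in> A"
  shows "southeast L p \<subseteq> strict_se r c"
proof -
  have fam: "family A" "last ` A = Bdry ` K" using A by (auto simp: path_families_iff)
  note bp = family_border_path[OF fam(1) p]
  note rc = boxesD[OF b]
  show ?thesis using bp
  proof (cases p rule: border_path_label)
    case (trivial s)
    then show ?thesis by (simp add: southeast_trivial)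
  next
    case (proper s t)
    note st = boxesD[OF proper(1)]
    have src: "source L s \<in> sources L" using st by (simp add: sources_def)
    have "source L s \<notin> K"
    proof
      assume "source L s \<in> K"
      then have "p = [Bdry (source L s)]" using source_target_trivial[OF A p proper(2)] src by blast
      then show False using proper(4) by (simp add: southeast_trivial)
    qed
    then have "source L s \<notin> A_set L (r, c)" using K src by blast
    then have lt: "source L r < source L s" using A_set_iff[OF b, of "source L s"] source_range[of s] st by linarith
    have rs: "r < s"
    proof (rule ccontr)
      assume "\<not> r < s"
      then have "s = r \<or> s < r" by auto
      then show False using source_less[of s r] rc st lt by auto
    qed
    have "Bdry (sink L t) \<in> last ` A" using proper(3) p by (metis image_eqI)
    then have "sink L t \<in> K" using fam(2) by auto
    moreover have "sink L t \<notin> sources L" using sources_sinks_disjoint st by (auto simp: sinks_def)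
    ultimately have "sink L t \<notin> A_set L (r, c)" using K by blast
    then have lt: "sink L t < sink L c" using A_set_iff[OF b, of "sink L t"] sink_range[of t] st by linarith
    have tc: "t < c"
    proof (rule ccontr)
      assume "\<not> t < c"
      then have "c = t \<or> c < t" by auto
      then show False using sink_less[of c t] rc st lt by auto
    qed
    show ?thesis
    proof
      fix x assume "x \<in> southeast L p"
      then obtain a b where "x = (a, b)" "(a, b) \<in> southeast L p" by (cases x) auto
      then show "x \<in> strict_se r c"
        using southeast_bounds[OF bp proper(2,3)] st rs tc by (fastforce simp: strict_se_def southeast_iff)
    qed
  qed
qed

text \<open>The endpoint set \<open>J\<close> is left open here; it is identified afterwards by
  counting labels.\<close>

lemma family_of_depth:
  assumes X: "southeast_closed X"
  shows "\<exists>A J. A \<in> path_families L J \<and> (\<forall>r c. height A r c = depth X r c)"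
proof -
  have "\<exists>A. family A \<and> hd ` A = Bdry ` sources L \<and> (\<forall>r c. height A r c = depth X r c)"
  proof (rule family_of_height)
    fix r c
    show "(r, c) \<notin> boxes L \<Longrightarrow> depth X r c = 0" by (simp add: depth_outside)
    assume b: "(r, c) \<in> boxes L"
    show "depth X r (c + 1) \<le> depth X r c" "depth X (r - 1) c \<le> depth X r c"
      "depth X r c \<le> Suc (depth X (r - 1) (c + 1))"
      using depth_mono_step[OF X b] by auto
    show "depth X r (c + 1) \<noteq> depth X r c \<Longrightarrow> col_plus r c" using depth_no_col[OF X] b by metis
    show "depth X (r - 1) c \<noteq> depth X r c \<Longrightarrow> row_plus r c" using depth_no_row[OF X] b by metis
  qed
  then obtain A where A: "family A" "hd ` A = Bdry ` sources L" "\<forall>r c. height A r c = depth X r c" by blast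
  have "last ` A \<subseteq> range Bdry" using A(1) by (auto simp: family_def border_path_def)
  then obtain J where "last ` A = Bdry ` J" by (meson subset_imageE)
  then have "A \<in> path_families L J" using A by (simp add: path_families_iff)
  then show ?thesis using A by blast
qed

lemma height_southeast_subset:
  assumes "family A" "\<And>r c. height A r c = depth X r c" "p \<in> A"
  shows "southeast L p \<subseteq> X"
proof
  fix x assume x: "x \<in> southeast L p"
  obtain a b where ab: "x = (a, b)" by (cases x)
  have "p \<in> {p \<in> A. (a, b) \<in> southeast L p}" using x ab assms by simp
  moreover have "finite A" using assms(1) by (simp add: family_def)
  ultimately have "height A a b \<noteq> 0" unfolding height_def by auto
  then show "x \<in> X" using assms(2) depth_outside ab by fastforce
qed

text \<open>The family of maximal height in \<open>strict_se r c\<close> has the most paths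
  straddling each border point. By \<open>crossing_count\<close> its endpoint set then has the least
  initial counts among all competitors, which is the criterion of \<open>lexmax_eqI\<close>.\<close>

lemma M'_characterization:
  assumes b: "(r, c) \<in> boxes L"
  obtains A where "A \<in> path_families L (M' L (r, c))" "\<And>a b. height A a b = depth (strict_se r c) a b"
    "M' L (r, c) \<inter> A_set L (r, c) = sources L \<inter> A_set L (r, c)"
proof -
  note Y = strict_se_closed[of r c]
  note rc = boxesD[OF b]
  obtain A J where A: "A \<in> path_families L J" and h: "\<And>a b. height A a b = depth (strict_se r c) a b"
    using family_of_depth[OF Y] by blast
  have fam: "family A" "hd ` A = Bdry ` sources L" "last ` A = Bdry ` J" using A by (auto simp: path_families_iff)
  have sub: "southeast L p \<subseteq> strict_se r c" if "p \<in> A" for p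
    using height_southeast_subset[OF fam(1) h that] .
  have proper_strict: "r < s \<and> t < c"
    if "p \<in> A" "(s, t) \<in> boxes L" "(s, offset s + 1) \<in> southeast L p" "(col_height L t, t) \<in> southeast L p" for p s t
    using sub[OF that(1)] that by (auto simp: strict_se_def)
  \<comment> \<open>Nontrivial paths stay below row \<open>r\<close> and to the right of column
    \<open>c\<close>, so the labels they move lie strictly between \<open>source L r\<close> and
    \<open>sink L c\<close>.\<close>
  have JA: "J \<inter> A_set L (r, c) = sources L \<inter> A_set L (r, c)"
  proof (rule Set.set_eqI, rule iffI)
    fix m assume m: "m \<in> J \<inter> A_set L (r, c)"
    then have "Bdry m \<in> last ` A" using fam(3) by blast
    then obtain p where p: "p \<in> A" "last p = Bdry m" by (metis imageE)
    show "m \<in> sources L \<inter> A_set L (r, c)" using family_border_path[OF fam(1) p(1)]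
    proof (cases p rule: border_path_label)
      case (trivial s)
      then show ?thesis using p m by (auto simp: sources_def)
    next
      case (proper s t)
      note st = boxesD[OF proper(1)]
      have lt: "r < s" "t < c" using proper_strict[OF p(1) proper(1,4,5)] by auto
      have "(r, t) \<in> boxes L" using boxes_nw[OF proper(1), of r t] lt rc st by simp
      then have "source L r < sink L t" by (rule source_less_sink)
      moreover have "sink L t < sink L c" using sink_less lt st rc by simp
      moreover have "m = sink L t" using proper p by simp
      ultimately show ?thesis using m A_set_iff[OF b, of m] by auto
    qed
  next
    fix m assume m: "m \<in> sources L \<inter> A_set L (r, c)"
    then have "Bdry m \<in> hd ` A" using fam(2) by blast
    then obtain p where p: "p \<in> A" "hd p = Bdry m" by (metis imageE)
    show "m \<in> J \<inter> A_set L (r, c)" using family_border_path[OF fam(1) p(1)]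
    proof (cases p rule: border_path_label)
      case (trivial s)
      then have "last p = Bdry m" using p by simp
      then have "Bdry m \<in> last ` A" using p by (metis image_eqI)
      then have "m \<in> J" using fam(3) by auto
      then show ?thesis using m by simp
    next
      case (proper s t)
      note st = boxesD[OF proper(1)]
      have lt: "r < s" "t < c" using proper_strict[OF p(1) proper(1,4,5)] by auto
      have "(s, c) \<in> boxes L" using boxes_nw[OF proper(1), of s c] lt rc st by simp
      then have "source L s < sink L c" by (rule source_less_sink)
      moreover have "source L r < source L s" using source_less lt st rc by simp
      moreover have "m = source L s" using proper p by simp
      ultimately show ?thesis using m A_set_iff[OF b, of m] by auto
    qed
  qed
  define \<J> where "\<J> = {J \<in> le_matroid L. J \<inter> A_set L (r, c) = sources L \<inter> A_set L (r, c)}"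
  have "lexmax \<J> = J"
  proof (rule lexmax_eqI)
    show "J \<in> \<J>" using A JA by (auto simp: \<J>_def le_matroid_iff)
    have ks: "finite K \<and> card K = dim_k L" if "K \<in> \<J>" for K
      using that by (auto simp: \<J>_def le_matroid_def k_subsets_def intro: finite_subset)
    then show "finite J" "\<And>K. K \<in> \<J> \<Longrightarrow> finite K \<and> card K = card J" using \<open>J \<in> \<J>\<close> by auto
    fix K m assume K: "K \<in> \<J>"
    then obtain A' where A': "A' \<in> path_families L K" by (auto simp: \<J>_def le_matroid_iff)
    have fam': "family A'" using A' by (simp add: path_families_iff)
    have KA: "K \<inter> A_set L (r, c) = sources L \<inter> A_set L (r, c)" using K by (simp add: \<J>_def)
    have sub': "southeast L p \<subseteq> strict_se r c" if "p \<in> A'" for p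
      using southeast_within_strict_se[OF b A' KA that] .
    have "crossing A' m \<le> crossing A m"
    proof (cases m rule: crossing_cases)
      case (border a d)
      then show ?thesis
        using crossing_border[OF fam' border(1,2)] crossing_border[OF fam(1) border(1,2)] height_le_depth[OF fam' Y sub', of a d] h
        by simp
    qed (use fam' in simp)
    then show "card (J \<inter> {..m}) \<le> card (K \<inter> {..m})"
      using crossing_count[OF A, of m] crossing_count[OF A', of m] by linarith
  qed
  then have "M' L (r, c) = J" by (simp add: M'_def \<J>_def)
  then show ?thesis using that A h JA by simp
qed

lemma M_eq: "M L (r, c) = (M' L (r, c) - {source L r}) \<union> {sink L c}"
  by (simp add: M_def)

lemma M'_source_sink:
  assumes b: "(r, c) \<in> boxes L"
  shows "source L r \<in> M' L (r, c)" "sink L c \<notin> M' L (r, c)"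
proof -
  note rc = boxesD[OF b]
  have JA: "M' L (r, c) \<inter> A_set L (r, c) = sources L \<inter> A_set L (r, c)"
    using M'_characterization[OF b] by blast
  have "source L r \<in> sources L \<inter> A_set L (r, c)"
    using A_set_iff[OF b] source_range rc by (simp add: sources_def)
  then show "source L r \<in> M' L (r, c)" using JA by blast
  have "sink L c \<in> A_set L (r, c)" "sink L c \<notin> sources L"
    using A_set_iff[OF b] sink_range rc sources_sinks_disjoint by (auto simp: sinks_def)
  then show "sink L c \<notin> M' L (r, c)" using JA by blast
qed

lemma M_k_subset:
  assumes b: "(r, c) \<in> boxes L"
  shows "M L (r, c) \<in> k_subsets (dim_k L) (dim_n L)"
proof -
  note rc = boxesD[OF b]
  obtain A where "A \<in> path_families L (M' L (r, c))" using M'_characterization[OF b] by metis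
  then have "M' L (r, c) \<in> k_subsets (dim_k L) (dim_n L)" by (rule target_k_subset)
  then have M': "M' L (r, c) \<subseteq> {1..dim_n L}" "card (M' L (r, c)) = dim_k L" by (auto simp: k_subsets_def)
  then have fin: "finite (M' L (r, c))" by (auto intro: finite_subset)
  have "card (M L (r, c)) = card (M' L (r, c))"
    unfolding M_eq using M'_source_sink[OF b] fin card.remove[OF fin M'_source_sink(1)[OF b]] by simp
  then show ?thesis using M' sink_range[of c] rc by (auto simp: k_subsets_def M_eq)
qed

lemma card_M:
  assumes b: "(r, c) \<in> boxes L"
  shows "card (M L (r, c) \<inter> {..m}) + (if source L r \<le> m \<and> m < sink L c then 1 else 0) = card (M' L (r, c) \<inter> {..m})"
proof -
  let ?J = "M' L (r, c) \<inter> {..m}"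
  note J = M'_source_sink[OF b]
  have lt: "source L r < sink L c" using source_less_sink[OF b] .
  have remove: "source L r \<le> m \<Longrightarrow> card ?J = Suc (card (?J - {source L r}))"
    using J(1) by (intro card.remove) auto
  consider "m < source L r" | "source L r \<le> m" "m < sink L c" | "sink L c \<le> m" by linarith
  then show ?thesis
  proof cases
    case 1
    then have "M L (r, c) \<inter> {..m} = ?J" unfolding M_eq using lt by auto
    then show ?thesis using 1 by simp
  next
    case 2
    then have "M L (r, c) \<inter> {..m} = ?J - {source L r}" unfolding M_eq by auto
    then show ?thesis using 2 remove by simp
  next
    case 3
    then have "M L (r, c) \<inter> {..m} = insert (sink L c) (?J - {source L r})" unfolding M_eq by auto
    then show ?thesis using 3 remove J(2) lt by simp
  qed
qed

text \<open>Exchanging \<open>source L r\<close> for \<open>sink L c\<close> opens row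
  \<open>r\<close> and column \<open>c\<close>; the other labels in \<open>A_set\<close> stay fixed,
  as in \<open>southeast_within_strict_se\<close>.\<close>

lemma southeast_within_weak_se:
  assumes b: "(r, c) \<in> boxes L" and A: "A \<in> path_families L (M L (r, c))" and p: "p \<in> A"
  shows "southeast L p \<subseteq> weak_se r c"
proof -
  have fam: "family A" "last ` A = Bdry ` M L (r, c)" using A by (auto simp: path_families_iff)
  note bp = family_border_path[OF fam(1) p]
  note rc = boxesD[OF b]
  have JA: "M' L (r, c) \<inter> A_set L (r, c) = sources L \<inter> A_set L (r, c)"
    using M'_characterization[OF b] by blast
  show ?thesis using bp
  proof (cases p rule: border_path_label)
    case (trivial s)
    then show ?thesis by (simp add: southeast_trivial)
  next
    case (proper s t)
    note st = boxesD[OF proper(1)]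
    have src: "source L s \<in> sources L" using st by (simp add: sources_def)
    have notM: "source L s \<notin> M L (r, c)"
    proof
      assume "source L s \<in> M L (r, c)"
      then have "p = [Bdry (source L s)]" using source_target_trivial[OF A p proper(2)] src by blast
      then show False using proper(4) by (simp add: southeast_trivial)
    qed
    have rs: "r \<le> s"
    proof (rule ccontr)
      assume "\<not> r \<le> s"
      then have lt: "source L s < source L r" using source_less[of s r] rc st by simp
      then have "source L s \<notin> M' L (r, c)" using notM by (simp add: M_eq)
      then have "source L s \<notin> A_set L (r, c)" using JA src by blast
      then show False using A_set_iff[OF b, of "source L s"] source_range[of s] st lt by linarith
    qed
    have "Bdry (sink L t) \<in> last ` A" using proper(3) p by (metis image_eqI)
    then have inM: "sink L t \<in> M L (r, c)" using fam(2) by auto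
    have tc: "t \<le> c"
    proof (rule ccontr)
      assume "\<not> t \<le> c"
      then have lt: "sink L c < sink L t" using sink_less[of c t] rc st by simp
      then have "sink L t \<in> M' L (r, c)" using inM by (simp add: M_eq)
      moreover have "sink L t \<notin> sources L" using sources_sinks_disjoint st by (auto simp: sinks_def)
      ultimately have "sink L t \<notin> A_set L (r, c)" using JA by blast
      then show False using A_set_iff[OF b, of "sink L t"] sink_range[of t] st lt by linarith
    qed
    show ?thesis
    proof
      fix x assume "x \<in> southeast L p"
      then obtain a b where "x = (a, b)" "(a, b) \<in> southeast L p" by (cases x) auto
      then show "x \<in> weak_se r c"
        using southeast_bounds[OF bp proper(2,3)] st rs tc by (fastforce simp: weak_se_def southeast_iff)
    qed
  qed
qed

text \<open>On the border boxes of \<open>weak_se r c\<close> the set \<open>M\<close> has one label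
  fewer than \<open>M'\<close>, so a family for it would exceed the depth of
  \<open>strict_se r c\<close> by one. Applying \<open>depth_le_height\<close> with
  \<open>d = 1\<close> carries this up to \<open>(r, c)\<close>, where the height would be at least
  1. But without a \<open>+\<close> the depth of \<open>weak_se r c\<close> at \<open>(r, c)\<close>
  is copied from a neighbour outside this region, hence 0.\<close>

lemma M_unreachable:
  assumes b: "(r, c) \<in> boxes L" and np: "(r, c) \<notin> plus_boxes L"
  shows "path_families L (M L (r, c)) = {}"
proof (rule ccontr)
  assume "path_families L (M L (r, c)) \<noteq> {}"
  then obtain A where A: "A \<in> path_families L (M L (r, c))" by blast
  obtain A' where A': "A' \<in> path_families L (M' L (r, c))" "\<And>a b. height A' a b = depth (strict_se r c) a b"
    using M'_characterization[OF b] by metis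
  have fam: "family A" using A by (simp add: path_families_iff)
  note rc = boxesD[OF b]
  have border: "depth (strict_se r c) a d + 1 \<le> height A a d"
    if "(a, d) \<in> weak_se r c" "(a + 1, d - 1) \<notin> boxes L" for a d
  proof -
    have ad: "(a, d) \<in> boxes L" "r \<le> a" "d \<le> c" using that by (auto simp: weak_se_def)
    have lt: "source L r \<le> a + d - 1" "a + d - 1 < sink L c"
      using border_label[OF ad(1) that(2)] rc ad by auto
    then have "Suc (card (M L (r, c) \<inter> {..a + d - 1})) = card (M' L (r, c) \<inter> {..a + d - 1})"
      using card_M[OF b, of "a + d - 1"] by simp
    then show ?thesis
      using border_height[OF A ad(1) that(2)] border_height[OF A'(1) ad(1) that(2)] A'(2)[of a d] by linarith
  qed
  have XY: "(a + 1, d - 1) \<in> strict_se r c" if "(a, d) \<in> weak_se r c" "(a + 1, d - 1) \<in> plus_boxes L" for a d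
  proof -
    have "(a + 1, d - 1) \<in> boxes L" using that(2) plus_boxes_subset by blast
    then show ?thesis using that(1) boxesD[of "a + 1" "d - 1"] by (auto simp: strict_se_def weak_se_def)
  qed
  have B: "(r, c) \<in> weak_se r c" using b by (simp add: weak_se_def)
  have "1 \<le> height A r c"
    using depth_le_height[OF fam weak_se_closed strict_se_closed border XY B] by simp
  also have "\<dots> \<le> depth (weak_se r c) r c"
    using height_le_depth[OF fam weak_se_closed] southeast_within_weak_se[OF b A] by blast
  also have "\<dots> = 0"
  proof (rule depth_cases[OF B b weak_se_closed])
    assume "(r, c) \<in> plus_boxes L"
    then show ?thesis using np by simp
  next
    assume "\<And>Y. southeast_closed Y \<Longrightarrow> depth Y r c = depth Y r (c + 1)"
    then show ?thesis using weak_se_closed by (auto simp: weak_se_def intro: depth_outside)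
  next
    assume "\<And>Y. southeast_closed Y \<Longrightarrow> depth Y r c = depth Y (r - 1) c"
    then have "depth (weak_se r c) r c = depth (weak_se r c) (r - 1) c" using weak_se_closed by simp
    moreover have "(r - 1, c) \<notin> weak_se r c" using rc by (auto simp: weak_se_def)
    ultimately show ?thesis by (simp add: depth_outside)
  qed
  finally show False by simp
qed

subsection \<open>The hook path\<close>

lemma hook_corner_iff:
  assumes "(r, c) \<in> boxes L"
  shows "Corner a b \<in> set (hook_path L (r, c)) \<longleftrightarrow>
    a = r \<and> offset r < b \<and> b \<le> c \<or> b = c \<and> r < a \<and> a \<le> col_height L c"
  by (auto simp: hook_path.simps offset_def)

lemma hook_border_path:
  assumes "(r, c) \<in> plus_boxes L"
  shows "border_path (hook_path L (r, c))"
proof -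
  have "path_edges (hook_path L (r, c)) \<subseteq> gamma_graph L" using assms by (auto simp: gamma_graph_def)
  moreover have "r \<in> {1..dim_k L}" using assms plus_boxes_subset boxesD by force
  ultimately show ?thesis by (simp add: border_path_def is_path_edges hook_path.simps sources_def)
qed

lemma hook_hd_last: "hd (hook_path L (r, c)) = Bdry (source L r)" "last (hook_path L (r, c)) = Bdry (sink L c)"
  by (simp_all add: hook_path.simps)

lemma southeast_hook:
  assumes "(r, c) \<in> boxes L"
  shows "southeast L (hook_path L (r, c)) = weak_se r c"
proof -
  have "(a, b) \<in> southeast L (hook_path L (r, c)) \<longleftrightarrow> (a, b) \<in> weak_se r c" for a b
  proof
    assume "(a, b) \<in> southeast L (hook_path L (r, c))"
    then show "(a, b) \<in> weak_se r c" using hook_corner_iff[OF assms] by (auto simp: southeast_iff weak_se_def)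
  next
    have "Corner r c \<in> set (hook_path L (r, c))" using assms by (simp add: hook_corner_iff boxes_iff)
    moreover assume "(a, b) \<in> weak_se r c"
    ultimately show "(a, b) \<in> southeast L (hook_path L (r, c))" by (auto simp: southeast_iff weak_se_def)
  qed
  then show ?thesis by auto
qed

text \<open>The \<open>+\<close> at \<open>(r, c)\<close> makes row \<open>r\<close> and column
  \<open>c\<close> carry edges throughout the region, so the copying clauses never step out of
  \<open>weak_se r c\<close>. A diagonal step leaves it only from its first row or column, where the
  depths are 1 and 0.\<close>

lemma depth_weak_se:
  assumes plus: "(r, c) \<in> plus_boxes L"
  shows "(a, b) \<in> weak_se r c \<Longrightarrow> depth (weak_se r c) a b = Suc (depth (strict_se r c) a b)"
proof -
  assume ab: "(a, b) \<in> weak_se r c"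
  then have "(a, b) \<in> boxes L" by (simp add: weak_se_def)
  then show ?thesis using ab
  proof (induction a b rule: box_less_induct)
    case (less a b)
    note X = weak_se_closed[of r c] and Y = strict_se_closed[of r c]
    have ab: "1 \<le> a" "r \<le> a" "b \<le> c" "a \<le> dim_k L" "b \<le> width L" using less.prems boxesD[OF less.hyps] by (auto simp: weak_se_def)
    have rc: "1 \<le> r" "c \<le> width L" using plus plus_boxes_subset boxesD by auto
    have ne: "a - 1 \<noteq> a" using ab by simp
    show ?case
    proof (rule depth_cases[OF less.prems less.hyps X])
      assume "\<And>Y. southeast_closed Y \<Longrightarrow> (a, b) \<in> Y \<Longrightarrow> depth Y a b = Suc (depth Y (a - 1) (b + 1))"
      then have dX: "depth (weak_se r c) a b = Suc (depth (weak_se r c) (a - 1) (b + 1))"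
        and dY: "(a, b) \<in> strict_se r c \<Longrightarrow> depth (strict_se r c) a b = Suc (depth (strict_se r c) (a - 1) (b + 1))"
        using X Y less.prems by auto
      show ?thesis
      proof (cases "(a, b) \<in> strict_se r c")
        case True
        then have "(a - 1, b + 1) \<in> boxes L" "(a - 1, b + 1) \<in> weak_se r c"
          using boxes_nw[OF less.hyps, of "a - 1" "b + 1"] ab rc by (auto simp: strict_se_def weak_se_def)
        then show ?thesis using less.IH[of "a - 1" "b + 1"] dX dY[OF True] ne by simp
      next
        case False
        then have "(a - 1, b + 1) \<notin> weak_se r c" using ab less.hyps by (auto simp: strict_se_def weak_se_def)
        then show ?thesis using dX False by (simp add: depth_outside)
      qed
    next
      assume nc: "\<not> col_plus a b" and "\<And>Y. southeast_closed Y \<Longrightarrow> depth Y a b = depth Y a (b + 1)"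
      then have d: "depth (weak_se r c) a b = depth (weak_se r c) a (b + 1)"
         "depth (strict_se r c) a b = depth (strict_se r c) a (b + 1)" using X Y by auto
      have "b \<noteq> c" using nc plus ab by (auto simp: col_plus_def)
      then have "(a, b + 1) \<in> boxes L" "(a, b + 1) \<in> weak_se r c"
        using boxes_nw[OF less.hyps, of a "b + 1"] ab rc by (auto simp: weak_se_def)
      then show ?thesis using less.IH[of a "b + 1"] d by simp
    next
      assume nr: "\<not> row_plus a b" and "\<And>Y. southeast_closed Y \<Longrightarrow> depth Y a b = depth Y (a - 1) b"
      then have d: "depth (weak_se r c) a b = depth (weak_se r c) (a - 1) b"
         "depth (strict_se r c) a b = depth (strict_se r c) (a - 1) b" using X Y by auto
      have "a \<noteq> r" using nr plus ab by (auto simp: row_plus_def)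
      then have "(a - 1, b) \<in> boxes L" "(a - 1, b) \<in> weak_se r c"
        using boxes_nw[OF less.hyps, of "a - 1" b] ab rc by (auto simp: weak_se_def)
      then show ?thesis using less.IH[of "a - 1" b] d ne by simp
    qed
  qed
qed

text \<open>By \<open>depth_weak_se\<close> the maximal family of \<open>weak_se r c\<close> has one
  more path straddling \<open>m\<close> than that of \<open>strict_se r c\<close>, exactly for
  \<open>source L r \<le> m < sink L c\<close>. This is the change of the counts from
  \<open>M'\<close> to \<open>M\<close>, so its endpoint set is \<open>M\<close>.\<close>

lemma M_unique_family:
  assumes plus: "(r, c) \<in> plus_boxes L"
  obtains A where "path_families L (M L (r, c)) = {A}" "\<And>a b. height A a b = depth (weak_se r c) a b"
proof -
  have b: "(r, c) \<in> boxes L" using plus plus_boxes_subset by blast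
  note rc = boxesD[OF b]
  obtain A' where A': "A' \<in> path_families L (M' L (r, c))" and h': "\<And>a b. height A' a b = depth (strict_se r c) a b"
    using M'_characterization[OF b] by metis
  obtain A J where A: "A \<in> path_families L J" and h: "\<And>a b. height A a b = depth (weak_se r c) a b"
    using family_of_depth[OF weak_se_closed] by metis
  have fam: "family A" "family A'" using A A' by (auto simp: path_families_iff)
  have "card (J \<inter> {..m}) = card (M L (r, c) \<inter> {..m})" for m
  proof -
    have "crossing A m = crossing A' m + (if source L r \<le> m \<and> m < sink L c then 1 else 0)"
    proof (cases m rule: crossing_cases)
      case (border a d)
      have "source L r \<le> m \<and> m < sink L c \<longleftrightarrow> (a, d) \<in> weak_se r c"
        using border_label[OF border(1,2)] rc border by (simp add: weak_se_def)
      moreover have "depth (weak_se r c) a d = depth (strict_se r c) a d + (if (a, d) \<in> weak_se r c then 1 else 0)"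
      proof (cases "(a, d) \<in> weak_se r c")
        case False
        then have "(a, d) \<notin> strict_se r c" by (auto simp: strict_se_def weak_se_def)
        then show ?thesis using False by (simp add: depth_outside)
      qed (simp add: depth_weak_se[OF plus])
      ultimately show ?thesis
        using crossing_border[OF fam(1) border(1,2)] crossing_border[OF fam(2) border(1,2)] border(3) h h' by simp
    next
      case none
      then show ?thesis using none(1)[OF fam(1)] none(1)[OF fam(2)] none(2)[OF b] by simp
    qed
    then show ?thesis using crossing_count[OF A, of m] crossing_count[OF A', of m] card_M[OF b, of m] by linarith
  qed
  then have "J = M L (r, c)" by (rule nat_set_eqI)
  then have A: "A \<in> path_families L (M L (r, c))" using A by simp
  have "A2 = A" if "A2 \<in> path_families L (M L (r, c))" for A2
    using family_unique[OF A that weak_se_closed h] southeast_within_weak_se[OF b that] by blast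
  then have "path_families L (M L (r, c)) = {A}" using A by blast
  then show ?thesis using that h by blast
qed

end

section \<open>Faces and weights\<close>

context le_diag
begin

text \<open>Crossing an edge of the graph changes the set of \<open>+\<close> boxes weakly northwest of a cell, so
  this set identifies the faces.\<close>

definition plus_nw :: "box \<Rightarrow> box set" where
  "plus_nw x = {(a, b) \<in> plus_boxes L. a \<le> fst x \<and> snd x \<le> b}"

lemma plus_nw_self: "x \<in> plus_boxes L \<Longrightarrow> x \<in> plus_nw x"
  by (cases x) (simp add: plus_nw_def)

lemma plus_nw_inject: "x \<in> plus_boxes L \<Longrightarrow> y \<in> plus_boxes L \<Longrightarrow> plus_nw x = plus_nw y \<Longrightarrow> x = y"
proof -
  assume "x \<in> plus_boxes L" "y \<in> plus_boxes L" "plus_nw x = plus_nw y"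
  then have "x \<in> plus_nw y" "y \<in> plus_nw x" using plus_nw_self by blast+
  then show "x = y" by (cases x; cases y) (simp add: plus_nw_def)
qed

lemma boxes_cells: "boxes L \<subseteq> cells L"
  by (auto simp: cells_def)

lemma cells_outside: "x \<in> cells L \<Longrightarrow> x \<notin> boxes L \<Longrightarrow> fst x = 0 \<or> snd x = width L + 1"
  by (auto simp: cells_def)

lemma plus_nw_outside: "x \<in> cells L \<Longrightarrow> x \<notin> boxes L \<Longrightarrow> plus_nw x = {}"
  using cells_outside[of x] plus_boxes_subset boxesD by (fastforce simp: plus_nw_def)

text \<open>A side is open only if no \<open>+\<close> lies weakly above it in its column, or to the
  left in its row, so crossing it neither adds nor removes a \<open>+\<close>.\<close>

lemma plus_nw_step:
  assumes "(x, y) \<in> open_steps L"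
  shows "plus_nw x = plus_nw y" and "x \<in> cells L" and "y \<in> cells L"
proof -
  consider (west) r c where "x = (r, c)" "y = (r, c + 1)" "x \<in> cells L" "y \<in> cells L" "west_edge L (r, c) \<notin> gamma_graph L"
    | (north) r c where "x = (r + 1, c)" "y = (r, c)" "x \<in> cells L" "y \<in> cells L" "north_edge L (r + 1, c) \<notin> gamma_graph L"
    using assms unfolding open_steps_def by blast
  then have "plus_nw x = plus_nw y \<and> x \<in> cells L \<and> y \<in> cells L"
  proof cases
    case west
    have "(a, c) \<notin> plus_boxes L" if "a \<le> r" for a
    proof
      assume p: "(a, c) \<in> plus_boxes L"
      then have ac: "1 \<le> a" "c \<le> width L" using plus_boxes_subset boxesD by blast+
      have "(r, c) \<in> boxes L" using cells_outside[OF west(3)] west(1) ac that by auto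
      moreover have "col_plus r c" using p that by (auto simp: col_plus_def)
      ultimately show False using west(5) west_edge_in_gamma by blast
    qed
    then have "plus_nw x = plus_nw y"
      using west(1,2) by (auto simp: plus_nw_def) (metis le_antisym not_less_eq_eq)
    then show ?thesis using west by simp
  next
    case north
    have "(r + 1, b) \<notin> plus_boxes L" if "c \<le> b" for b
    proof
      assume p: "(r + 1, b) \<in> plus_boxes L"
      then have "b \<le> width L" using plus_boxes_subset boxesD by blast
      then have "(r + 1, c) \<in> boxes L" using cells_outside[OF north(3)] north(1) that by auto
      moreover have "row_plus (r + 1) c" using p that by (auto simp: row_plus_def)
      ultimately show False using north(5) north_edge_in_gamma by blast
    qed
    then have "plus_nw x = plus_nw y"
      using north(1,2) by (auto simp: plus_nw_def) (metis le_SucE)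
    then show ?thesis using north by simp
  qed
  then show "plus_nw x = plus_nw y" "x \<in> cells L" "y \<in> cells L" by auto
qed

lemma face_plus_nw: "y \<in> face_of L x \<Longrightarrow> plus_nw y = plus_nw x \<and> (x \<in> cells L \<longrightarrow> y \<in> cells L)"
proof -
  assume "y \<in> face_of L x"
  then have "(x, y) \<in> (open_steps L \<union> (open_steps L)\<inverse>)\<^sup>*" by (simp add: face_of_def)
  then show ?thesis
  proof (induction rule: rtrancl_induct)
    case (step y z)
    then consider "(y, z) \<in> open_steps L" | "(z, y) \<in> open_steps L" by blast
    then have "plus_nw y = plus_nw z \<and> y \<in> cells L \<and> z \<in> cells L" using plus_nw_step by cases metis+
    then show ?case using step.IH by simp
  qed simp
qed

lemma face_of_refl: "x \<in> face_of L x"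
  by (simp add: face_of_def)

lemma face_of_eq: "y \<in> face_of L x \<Longrightarrow> face_of L y = face_of L x"
proof -
  let ?E = "open_steps L \<union> (open_steps L)\<inverse>"
  have "sym ?E" by (auto simp: sym_def)
  then have s: "sym (?E\<^sup>*)" by (rule sym_rtrancl)
  assume "y \<in> face_of L x"
  then have "(x, y) \<in> ?E\<^sup>*" "(y, x) \<in> ?E\<^sup>*" using s by (auto simp: face_of_def dest: symD)
  then show ?thesis unfolding face_of_def by (auto intro: rtrancl_trans)
qed

text \<open>By the Le-property a box without \<open>+\<close> is open to the west or to the north,
  so one can walk through open sides until a \<open>+\<close> box or the outer strip is
  reached.\<close>

lemma face_representative:
  assumes "(r, c) \<in> boxes L"
  shows "\<exists>y \<in> face_of L (r, c). y \<in> plus_boxes L \<or> y \<in> cells L - boxes L"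
  using assms
proof (induction r c rule: box_less_induct)
  case (less r c)
  have rc: "1 \<le> r" "r \<le> dim_k L" "1 \<le> c" "c \<le> width L" using boxesD[OF less.hyps] by auto
  have cell: "(r, c) \<in> cells L" using less.hyps boxes_cells by blast
  have trans: "\<exists>y \<in> face_of L (r, c). y \<in> plus_boxes L \<or> y \<in> cells L - boxes L"
    if step: "((r, c), (r', c')) \<in> open_steps L" and le: "r' \<le> r" "c \<le> c'" "(r', c') \<noteq> (r, c)" for r' c'
  proof -
    have f: "(r', c') \<in> face_of L (r, c)" using step by (auto simp: face_of_def)
    have c: "(r', c') \<in> cells L" using plus_nw_step(3)[OF step] .
    show ?thesis
    proof (cases "(r', c') \<in> boxes L")
      case True
      then show ?thesis using less.IH[OF True le] face_of_eq[OF f] by simp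
    qed (use c f in blast)
  qed
  consider "(r, c) \<in> plus_boxes L" | "\<not> col_plus r c" | "\<not> row_plus r c" using le_property less.hyps by blast
  then show ?case
  proof cases
    case 1
    then show ?thesis using face_of_refl by blast
  next
    case 2
    then have "west_edge L (r, c) \<notin> gamma_graph L" using west_edge_in_gamma less.hyps by blast
    moreover have "(r, c + 1) \<in> cells L"
      using left_box_or_outside[OF less.hyps] rc by (auto simp: cells_def)
    ultimately have "((r, c), (r, c + 1)) \<in> open_steps L" using cell unfolding open_steps_def by blast
    then show ?thesis by (rule trans) auto
  next
    case 3
    obtain r' where r': "r = r' + 1" using rc by (metis le_add_diff_inverse2)
    have "north_edge L (r' + 1, c) \<notin> gamma_graph L" using north_edge_in_gamma less.hyps 3 r' by blast
    moreover have "(r', c) \<in> cells L"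
      using boxes_nw[OF less.hyps, of r' c] rc r' by (cases "r' = 0") (auto simp: cells_def)
    ultimately have "((r, c), (r', c)) \<in> open_steps L" using cell r' unfolding open_steps_def by blast
    then show ?thesis by (rule trans) (use r' in auto)
  qed
qed

text \<open>A box with the same \<open>plus_nw\<close> as \<open>B\<close> shares its face with a
  representative of the same value. This cannot lie in the outer strip, where the value is empty, so
  it is a \<open>+\<close> box, and \<open>plus_nw_inject\<close> makes it \<open>B\<close>.\<close>

lemma face_of_plus:
  assumes B: "B \<in> plus_boxes L"
  shows "face_of L B = {x \<in> boxes L. plus_nw x = plus_nw B}"
proof
  have cell: "B \<in> cells L" using B plus_boxes_subset boxes_cells by blast
  show "face_of L B \<subseteq> {x \<in> boxes L. plus_nw x = plus_nw B}"
    using face_plus_nw[of _ B] cell plus_nw_outside plus_nw_self[OF B] by fastforce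
  show "{x \<in> boxes L. plus_nw x = plus_nw B} \<subseteq> face_of L B"
  proof
    fix x assume "x \<in> {x \<in> boxes L. plus_nw x = plus_nw B}"
    then have x: "x \<in> boxes L" "plus_nw x = plus_nw B" by auto
    obtain y where y: "y \<in> face_of L x" "y \<in> plus_boxes L \<or> y \<in> cells L - boxes L"
      using face_representative[of "fst x" "snd x"] x by auto
    have eq: "plus_nw y = plus_nw B" using face_plus_nw[OF y(1)] x by simp
    then have "y \<in> plus_boxes L" using y(2) plus_nw_outside plus_nw_self[OF B] by blast
    then have "y = B" using plus_nw_inject B eq by blast
    then show "x \<in> face_of L B" using face_of_eq[OF y(1)] face_of_refl by blast
  qed
qed

lemma face_of_inject: "B \<in> plus_boxes L \<Longrightarrow> B' \<in> plus_boxes L \<Longrightarrow> face_of L B = face_of L B' \<Longrightarrow> B = B'"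
  using face_of_refl face_plus_nw plus_nw_inject by metis

lemma face_inter_plus: "B \<in> plus_boxes L \<Longrightarrow> C \<in> plus_boxes L \<Longrightarrow> C \<in> face_of L B \<longleftrightarrow> C = B"
  using face_of_eq face_of_inject face_of_refl by blast

text \<open>The boxes of a face lie weakly southeast of its \<open>+\<close> box, so a closed set
  contains the whole face with that box. A face without \<open>+\<close> box meets the outer strip
  and is never inside; hence the weight of the boundary face does not enter path weights.\<close>

lemma faces_within:
  assumes S: "southeast_closed S"
  shows "{\<Phi> \<in> faces L. \<Phi> \<subseteq> S} = face_of L ` (plus_boxes L \<inter> S)"
proof
  show "{\<Phi> \<in> faces L. \<Phi> \<subseteq> S} \<subseteq> face_of L ` (plus_boxes L \<inter> S)"
  proof
    fix \<Phi> assume "\<Phi> \<in> {\<Phi> \<in> faces L. \<Phi> \<subseteq> S}"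
    then obtain x where x: "\<Phi> = face_of L x" "face_of L x \<subseteq> S" by (auto simp: faces_def)
    then have "x \<in> boxes L" using face_of_refl southeast_closed_subset[OF S] by blast
    then obtain y where y: "y \<in> face_of L x" "y \<in> plus_boxes L \<or> y \<in> cells L - boxes L"
      using face_representative[of "fst x" "snd x"] by auto
    then have "y \<in> plus_boxes L \<inter> S" using x southeast_closed_subset[OF S] by blast
    then show "\<Phi> \<in> face_of L ` (plus_boxes L \<inter> S)" using x face_of_eq[OF y(1)] by blast
  qed
  show "face_of L ` (plus_boxes L \<inter> S) \<subseteq> {\<Phi> \<in> faces L. \<Phi> \<subseteq> S}"
  proof
    fix \<Phi> assume "\<Phi> \<in> face_of L ` (plus_boxes L \<inter> S)"
    then obtain a b where B: "(a, b) \<in> plus_boxes L" "(a, b) \<in> S" "\<Phi> = face_of L (a, b)" by auto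
    have "x \<in> S" if x: "x \<in> face_of L (a, b)" for x
    proof -
      obtain a' b' where x': "x = (a', b')" by (cases x)
      have xb: "(a', b') \<in> boxes L" "plus_nw (a', b') = plus_nw (a, b)" using x x' face_of_plus[OF B(1)] by auto
      then have "(a, b) \<in> plus_nw (a', b')" using plus_nw_self[OF B(1)] by simp
      then show ?thesis using southeast_closedD[OF S B(2) xb(1)] x' by (simp add: plus_nw_def)
    qed
    moreover have "\<Phi> \<in> faces L" using B plus_boxes_subset boxes_cells by (auto simp: faces_def)
    ultimately show "\<Phi> \<in> {\<Phi> \<in> faces L. \<Phi> \<subseteq> S}" using B by blast
  qed
qed

section \<open>Measurement coordinates as monomials\<close>

lemma face_weight_plus: "B \<in> plus_boxes L \<Longrightarrow> face_weight L T (face_of L B) = T B"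
proof -
  assume B: "B \<in> plus_boxes L"
  have "(THE B'. B' \<in> plus_boxes L \<and> face_of L B = face_of L B') = B"
    using B face_of_inject by (intro the_equality) blast+
  then show ?thesis using B by (auto simp: face_weight_def)
qed

lemma path_weight_eq: "path_weight L T p = (\<Prod>B \<in> plus_boxes L \<inter> southeast L p. T B)"
proof -
  have "inj_on (face_of L) (plus_boxes L \<inter> southeast L p)" using face_of_inject by (auto intro: inj_onI)
  then show ?thesis
    unfolding path_weight_def faces_within[OF southeast_closed_southeast]
    by (simp add: prod.reindex face_weight_plus)
qed

lemma family_weight:
  assumes "family A"
  shows "(\<Prod>p\<in>A. path_weight L T p) = (\<Prod>B\<in>plus_boxes L. T B ^ height A (fst B) (snd B))"
proof -
  have fin: "finite A" using assms by (simp add: family_def)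
  have "(\<Prod>p\<in>A. path_weight L T p) = (\<Prod>p\<in>A. \<Prod>B\<in>plus_boxes L. if B \<in> southeast L p then T B else 1)"
    unfolding path_weight_eq using finite_plus_boxes by (simp add: prod.inter_restrict)
  also have "\<dots> = (\<Prod>B\<in>plus_boxes L. \<Prod>p\<in>A. if B \<in> southeast L p then T B else 1)"
    by (rule prod.swap)
  also have "\<dots> = (\<Prod>B\<in>plus_boxes L. T B ^ height A (fst B) (snd B))"
  proof (rule prod.cong[OF refl])
    fix B assume "B \<in> plus_boxes L"
    have "(\<Prod>p\<in>A. if B \<in> southeast L p then T B else 1) = (\<Prod>p\<in>{p \<in> A. B \<in> southeast L p}. T B)"
      by (rule prod.inter_filter[OF fin, symmetric])
    then show "(\<Prod>p\<in>A. if B \<in> southeast L p then T B else 1) = T B ^ height A (fst B) (snd B)"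
      by (simp add: height_def)
  qed
  finally show ?thesis .
qed

lemma meas_coord_M:
  assumes "(r, c) \<in> plus_boxes L"
  shows "meas_coord L T (M L (r, c)) = (\<Prod>B\<in>plus_boxes L. T B ^ depth (weak_se r c) (fst B) (snd B))"
proof -
  obtain A where A: "path_families L (M L (r, c)) = {A}" "\<And>a b. height A a b = depth (weak_se r c) a b"
    using M_unique_family[OF assms] by metis
  then have "A \<in> path_families L (M L (r, c))" by simp
  then have "family A" by (simp add: path_families_iff)
  then show ?thesis unfolding meas_coord_def A(1) using A(2) by (simp add: family_weight)
qed

lemma meas_coord_M_zero:
  "(r, c) \<in> boxes L \<Longrightarrow> (r, c) \<notin> plus_boxes L \<Longrightarrow> meas_coord L T (M L (r, c)) = 0"
  by (simp add: meas_coord_def M_unreachable)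

lemma sources_k_subset: "sources L \<in> k_subsets (dim_k L) (dim_n L)"
  using source_range card_sources by (auto simp: k_subsets_def sources_def)

text \<open>A source in the target set forces a trivial path, whose region is empty. The value 1
  fixes the scale in which \<open>P\<close> and \<open>meas_coord\<close> agree.\<close>

lemma meas_coord_sources: "meas_coord L T (sources L) = 1"
proof -
  let ?A = "(\<lambda>m. [Bdry m]) ` sources L"
  have "?A \<in> path_families L (sources L)"
    by (auto simp: path_families_def is_path_def image_image)
  moreover have "A = ?A" if A: "A \<in> path_families L (sources L)" for A
  proof -
    have hd: "hd ` A = Bdry ` sources L" using A by (simp add: path_families_iff)
    have triv: "p = [hd p] \<and> hd p \<in> Bdry ` sources L" if p: "p \<in> A" for p
    proof -
      have "hd p \<in> Bdry ` sources L" using hd p by blast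
      then obtain m where "hd p = Bdry m" "m \<in> sources L" by blast
      then show ?thesis using source_target_trivial[OF A p] by auto
    qed
    have "p \<in> ?A" if "p \<in> A" for p using triv[OF that] by (metis (no_types, lifting) imageE image_eqI)
    moreover have "[Bdry m] \<in> A" if m: "m \<in> sources L" for m
    proof -
      have "Bdry m \<in> hd ` A" using hd m by blast
      then obtain p where "p \<in> A" "hd p = Bdry m" by (metis imageE)
      then show ?thesis using triv by metis
    qed
    ultimately show ?thesis by blast
  qed
  ultimately have "path_families L (sources L) = {?A}" by blast
  moreover have "(\<Prod>p\<in>?A. path_weight L T p) = 1"
    by (rule prod.neutral) (auto simp: path_weight_eq southeast_trivial)
  ultimately show ?thesis by (simp add: meas_coord_def)
qed

end

section \<open>Generalized paths as closed sets of boxes\<close>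

lemma indicator_step:
  "(if p then 1 else 0 :: nat) = (if q then 1 else 0) + (if e then 1 else 0) \<Longrightarrow> e \<longleftrightarrow> p \<and> \<not> q"
  by (cases p; cases q; cases e) auto

lemma successively_iff_all:
  assumes "successively (\<lambda>u v. Q u \<longleftrightarrow> Q v) xs" "x \<in> set xs" "Q x" "y \<in> set xs"
  shows "Q y"
proof -
  have "\<forall>z\<in>set xs. Q z \<longleftrightarrow> Q (hd xs)" using assms(1)
  proof (induction xs rule: induct_list012)
    case (3 a b xs)
    have 1: "Q a = Q b" and "successively (\<lambda>u v. Q u \<longleftrightarrow> Q v) (b # xs)" using 3(3) by (simp_all only: successively.simps)
    then have 2: "\<forall>z\<in>set (b # xs). Q z = Q b" using 3(2) by (metis list.sel(1))
    show ?case
    proof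
      fix z assume "z \<in> set (a # b # xs)"
      then have "z = a \<or> z \<in> set (b # xs)" by simp
      then show "Q z = Q (hd (a # b # xs))" using 1 2 by (metis list.sel(1))
    qed
  qed simp_all
  then show ?thesis using assms by blast
qed

context le_diag
begin

lemma source_notin_sinks: "1 \<le> s \<Longrightarrow> s \<le> dim_k L \<Longrightarrow> source L s \<notin> sinks L"
  using source_neq_sink by (auto simp: sinks_def)

lemma sink_notin_sources: "1 \<le> t \<Longrightarrow> t \<le> width L \<Longrightarrow> sink L t \<notin> sources L"
  using source_neq_sink by (fastforce simp: sources_def)

text \<open>A source has only one outgoing edge and a sink only one incoming edge. Thus nontrivial
  paths that share a border vertex share the adjacent corner, and disjointness can be tested at
  corners.\<close>

lemma border_path_mid:
  assumes p: "border_path p" and l: "last p \<in> Bdry ` sinks L" and m: "Bdry m \<in> set p"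
  shows "\<exists>r c. Corner r c \<in> set p \<and>
    (\<forall>q. border_path q \<longrightarrow> last q \<in> Bdry ` sinks L \<longrightarrow> Bdry m \<in> set q \<longrightarrow> Corner r c \<in> set q)"
proof -
  have nxt: "Corner s (offset s + 1) \<in> set q"
    if q: "border_path q" "last q \<in> Bdry ` sinks L" "Bdry (source L s) \<in> set q" and s: "1 \<le> s" "s \<le> dim_k L" for q s
  proof -
    have "source L s \<notin> sinks L" using s by (rule source_notin_sinks)
    then have "Bdry (source L s) \<noteq> last q" using q by auto
    then obtain v where "(Bdry (source L s), v) \<in> path_edges q" using next_vertex[OF q(3)] by blast
    then have v: "(Bdry (source L s), v) \<in> gamma_graph L" "v \<in> set q"
      using q(1) path_edges_in_set by (auto simp: border_path_def is_path_edges)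
    obtain s' where "(s', offset s' + 1) \<in> boxes L" "source L s = source L s'" "v = Corner s' (offset s' + 1)"
      using gamma_out_bdry[OF v(1)] by metis
    then show ?thesis using v(2) s source_inject boxesD by metis
  qed
  have prev: "Corner (col_height L t) t \<in> set q"
    if q: "border_path q" "Bdry (sink L t) \<in> set q" and t: "1 \<le> t" "t \<le> width L" for q t
  proof -
    have "sink L t \<notin> sources L" using t by (rule sink_notin_sources)
    then have "Bdry (sink L t) \<noteq> hd q" using q by (auto simp: border_path_def)
    then obtain u where "(u, Bdry (sink L t)) \<in> path_edges q" using prev_vertex[OF q(2)] by blast
    then have u: "(u, Bdry (sink L t)) \<in> gamma_graph L" "u \<in> set q"
      using q(1) path_edges_in_set by (auto simp: border_path_def is_path_edges)
    obtain t' where "(col_height L t', t') \<in> boxes L" "sink L t = sink L t'" "u = Corner (col_height L t') t'"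
      using gamma_in_bdry[OF u(1)] by metis
    then show ?thesis using u(2) t sink_inject boxesD by metis
  qed
  consider s where "1 \<le> s" "s \<le> dim_k L" "m = source L s" | t where "1 \<le> t" "t \<le> width L" "m = sink L t"
  proof (cases "Bdry m = hd p")
    case True
    then show ?thesis using p that(1) by (auto simp: border_path_def sources_def)
  next
    case False
    then obtain u where "(u, Bdry m) \<in> path_edges p" using prev_vertex[OF m] by blast
    then have "(u, Bdry m) \<in> gamma_graph L" using p by (auto simp: border_path_def is_path_edges)
    then show ?thesis using gamma_in_bdry that(2) boxesD by metis
  qed
  then show ?thesis
  proof cases
    case 1
    then show ?thesis using nxt p l m by blast
  next
    case 2
    then show ?thesis using prev p l m by blast
  qed
qed

lemma gp_family: "generalized_path L W \<Longrightarrow> family W"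
  by (rule disjoint_paths_family) (auto simp: generalized_path_def border_path_def)

lemma border_path_corners:
  assumes p: "border_path p" and l: "last p \<in> Bdry ` sinks L"
  obtains m m' mid where "p = Bdry m # mid @ [Bdry m']" "\<And>v. v \<in> set mid \<Longrightarrow> \<exists>r c. v = Corner r c"
proof -
  obtain m where m: "hd p = Bdry m" "m \<in> sources L" using p by (auto simp: border_path_def)
  obtain m' where m': "last p = Bdry m'" "m' \<in> sinks L" using l by auto
  have ne: "p \<noteq> []" "hd p \<noteq> last p" using border_path_nonempty[OF p] m m' sources_sinks_disjoint by auto
  then obtain q where q: "p = Bdry m # q" using m by (cases p) auto
  then have "q \<noteq> []" using ne by auto
  then obtain mid where mid: "q = mid @ [Bdry m']" using m'(1) q by (metis append_butlast_last_id last_ConsR)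
  have "\<exists>r c. v = Corner r c" if v: "v \<in> set mid" for v
  proof (cases v)
    case (Bdry x)
    have dist: "distinct (Bdry m # mid @ [Bdry m'])" using path_distinct[OF border_path_is_path[OF p]] q mid by simp
    have "v \<noteq> hd p" "v \<noteq> last p" "v \<in> set p" using dist v q mid by auto
    then obtain u w where uw: "(u, v) \<in> path_edges p" "(v, w) \<in> path_edges p" using prev_vertex next_vertex by metis
    then have "(u, Bdry x) \<in> gamma_graph L" "(Bdry x, w) \<in> gamma_graph L"
      using p Bdry by (auto simp: border_path_def is_path_edges)
    then show ?thesis using gamma_in_bdry gamma_out_bdry source_neq_sink boxesD by metis
  qed simp
  then show ?thesis using that q mid by simp
qed

text \<open>A corner of \<open>q\<close> weakly inside the region of \<open>p\<close> is strictly
  inside, since otherwise \<open>p\<close> would pass through it. This propagates along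
  \<open>q\<close> in both directions, so one strictly inner corner forces all of \<open>q\<close>
  inside.\<close>

lemma disjoint_paths_nested_step:
  assumes p: "border_path p" and q: "border_path q" and l: "last q \<in> Bdry ` sinks L"
    and disj: "set p \<inter> set q = {}"
    and c: "Corner r c \<in> set q" "(r, c) \<in> southeast L p" "(r - 1, c + 1) \<in> southeast L p"
  shows "southeast L q \<subseteq> southeast L p"
proof -
  let ?X = "southeast L p" and ?Y = "southeast L q"
  obtain m m' mid where mid: "q = Bdry m # mid @ [Bdry m']" and corners: "\<And>v. v \<in> set mid \<Longrightarrow> \<exists>r c. v = Corner r c"
    using border_path_corners[OF q l] by metis
  have Xc: "southeast_closed ?X" by (rule southeast_closed_southeast)
  \<comment> \<open>\<open>Q\<close> says strictly inside at a corner; on \<open>q\<close> this is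
    the same as weakly inside by \<open>both\<close>. It is propagated over \<open>mid\<close>,
    which consists of corners.\<close>
  define Q where "Q v \<longleftrightarrow> (case v of Corner a b \<Rightarrow> (a, b) \<in> ?X \<and> (a - 1, b + 1) \<in> ?X | Bdry m \<Rightarrow> True)" for v
  have both: "(a - 1, b + 1) \<in> ?X" if "Corner a b \<in> set q" "(a, b) \<in> ?X" for a b
  proof (rule ccontr)
    assume "(a - 1, b + 1) \<notin> ?X"
    moreover have "(a, b) \<in> boxes L" using corner_in_boxes[OF q that(1)] .
    ultimately have "Corner a b \<in> set p" using corner_path_iff[OF p] that by blast
    then show False using disj that by blast
  qed
  have step: "Q u \<longleftrightarrow> Q v" if uv: "(u, v) \<in> path_edges q" "u \<in> set mid" "v \<in> set mid" for u v
  proof -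
    obtain a b where u: "u = Corner a b" using corners uv by blast
    obtain a' b' where v: "v = Corner a' b'" using corners uv by blast
    have g: "(Corner a b, v) \<in> gamma_graph L" using uv q u by (auto simp: border_path_def is_path_edges)
    have uq: "Corner a b \<in> set q" "Corner a' b' \<in> set q" using uv u v mid by auto
    have box: "(a, b) \<in> boxes L" "(a', b') \<in> boxes L" using corner_in_boxes[OF q] uq by auto
    have e: "a' = a \<and> b' = b + 1 \<or> a' = a + 1 \<and> b' = b" using gamma_out_corner(2)[OF g] v by auto
    have "(a', b') \<in> ?X" if "(a, b) \<in> ?X" "(a - 1, b + 1) \<in> ?X"
      using e southeast_closedD[OF Xc that(1) box(2)] southeast_closedD[OF Xc that(2) box(2)] by auto
    moreover have "(a, b) \<in> ?X" if "(a' - 1, b' + 1) \<in> ?X"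
      using e southeast_closedD[OF Xc that box(1)] by auto
    ultimately show ?thesis using both[OF uq(1)] both[OF uq(2)] unfolding Q_def u v by auto
  qed
  have "successively (\<lambda>u v. Q u \<longleftrightarrow> Q v) mid"
    unfolding successively_iff_path_edges
  proof (intro ballI, clarify)
    fix u v assume e: "(u, v) \<in> path_edges mid"
    then obtain xs ys where "mid = xs @ u # v # ys" by (auto simp: path_edges_iff)
    then have "q = (Bdry m # xs) @ u # v # (ys @ [Bdry m'])" using mid by simp
    then have "(u, v) \<in> path_edges q" unfolding path_edges_iff by blast
    then show "Q u \<longleftrightarrow> Q v" using step path_edges_in_set[OF e] by blast
  qed
  moreover have "Corner r c \<in> set mid" using c(1) mid by auto
  moreover have "Q (Corner r c)" using c by (simp add: Q_def)
  ultimately have all: "Q v" if "v \<in> set mid" for v using successively_iff_all that by metis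
  show ?thesis
  proof
    fix x assume x: "x \<in> ?Y"
    obtain a b where ab: "x = (a, b)" by (cases x)
    then obtain a' b' where d: "Corner a' b' \<in> set q" "a' \<le> a" "b \<le> b'" "(a, b) \<in> boxes L"
      using x by (auto simp: southeast_iff)
    then have "Corner a' b' \<in> set mid" using mid by auto
    then have "(a', b') \<in> ?X" using all[of "Corner a' b'"] by (simp add: Q_def)
    then show "x \<in> ?X" using southeast_closedD[OF Xc] d ab by blast
  qed
qed

text \<open>Containment of regions is excluded by definition; overlap is impossible too. For a
  topmost common box, the box diagonally northwest is not in both regions. If it is in one, the
  other path has a corner strictly inside that region and is nested in it; if it is in none, both
  paths pass through the same corner.\<close>

lemma gp_disjoint:
  assumes W: "generalized_path L W" and p: "p \<in> W" and q: "q \<in> W" and ne: "p \<noteq> q"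
  shows "southeast L p \<inter> southeast L q = {}"
proof (rule ccontr)
  let ?X = "southeast L p" and ?Y = "southeast L q"
  assume "?X \<inter> ?Y \<noteq> {}"
  then obtain a0 b0 where ab0: "(a0, b0) \<in> ?X \<inter> ?Y" by auto
  note bp = family_border_path[OF gp_family[OF W]]
  have l: "last p \<in> Bdry ` sinks L" "last q \<in> Bdry ` sinks L" using W p q by (auto simp: generalized_path_def)
  have disj: "set p \<inter> set q = {}" "set q \<inter> set p = {}" using W p q ne by (auto simp: generalized_path_def)
  have nn: "\<not> ?X \<subseteq> ?Y" "\<not> ?Y \<subseteq> ?X" using W p q ne by (auto simp: generalized_path_def)
  define a where "a = (LEAST a. \<exists>b. (a, b) \<in> ?X \<inter> ?Y)"
  have "\<exists>b. (a, b) \<in> ?X \<inter> ?Y" unfolding a_def by (rule LeastI) (use ab0 in blast)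
  then obtain b where b: "(a, b) \<in> ?X \<inter> ?Y" by blast
  have box: "(a, b) \<in> boxes L" using b southeast_closed_subset[OF southeast_closed_southeast] by blast
  have "a - 1 < a" using boxesD[OF box] by simp
  then have "\<not> (\<exists>b. (a - 1, b) \<in> ?X \<inter> ?Y)" unfolding a_def by (rule not_less_Least)
  then consider "(a - 1, b + 1) \<in> ?X" "(a - 1, b + 1) \<notin> ?Y" | "(a - 1, b + 1) \<in> ?Y" "(a - 1, b + 1) \<notin> ?X"
    | "(a - 1, b + 1) \<notin> ?Y" "(a - 1, b + 1) \<notin> ?X" by blast
  then show False
  proof cases
    case 1
    then have "Corner a b \<in> set q" using corner_path_iff[OF bp[OF q] box] b by blast
    then show False using disjoint_paths_nested_step[OF bp[OF p] bp[OF q] l(2) disj(1)] 1 b nn by blast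
  next
    case 2
    then have "Corner a b \<in> set p" using corner_path_iff[OF bp[OF p] box] b by blast
    then show False using disjoint_paths_nested_step[OF bp[OF q] bp[OF p] l(1) disj(2)] 2 b nn by blast
  next
    case 3
    then have "Corner a b \<in> set p" "Corner a b \<in> set q"
      using corner_path_iff[OF bp[OF p] box] corner_path_iff[OF bp[OF q] box] b by blast+
    then show False using disj by blast
  qed
qed

lemma gp_southeast_closed: "southeast_closed (gp_southeast L W)"
proof (rule southeast_closedI)
  show "gp_southeast L W \<subseteq> boxes L" by (auto simp: gp_southeast_def southeast_iff)
  show "(r', c') \<in> gp_southeast L W"
    if "(r, c) \<in> gp_southeast L W" "(r', c') \<in> boxes L" "r \<le> r'" "c' \<le> c" for r c r' c'
    using that southeast_mono unfolding gp_southeast_def by blast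
qed

lemma gp_height:
  assumes "generalized_path L W"
  shows "height W r c = (if (r, c) \<in> gp_southeast L W then 1 else 0)"
proof -
  have "p = q" if "p \<in> {p \<in> W. (r, c) \<in> southeast L p}" "q \<in> {p \<in> W. (r, c) \<in> southeast L p}" for p q
    using gp_disjoint[OF assms, of p q] that by blast
  then have "height W r c = (if {p \<in> W. (r, c) \<in> southeast L p} = {} then 0 else 1)"
    unfolding height_def by (rule card_at_most_one)
  then show ?thesis by (auto simp: gp_southeast_def)
qed

lemma gp_west_edge:
  assumes W: "generalized_path L W" and b: "(r, c) \<in> boxes L"
  shows "west_edge L (r, c) \<in> gp_edges W \<longleftrightarrow> (r, c) \<in> gp_southeast L W \<and> (r, c + 1) \<notin> gp_southeast L W"
proof -
  have "(if (r, c) \<in> gp_southeast L W then 1 else 0 :: nat) =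
    (if (r, c + 1) \<in> gp_southeast L W then 1 else 0) + (if west_edge L (r, c) \<in> gp_edges W then 1 else 0)"
    using height_west[OF gp_family[OF W] b] unfolding gp_height[OF W] .
  then show ?thesis by (rule indicator_step)
qed

lemma gp_north_edge:
  assumes W: "generalized_path L W" and b: "(r, c) \<in> boxes L"
  shows "north_edge L (r, c) \<in> gp_edges W \<longleftrightarrow> (r, c) \<in> gp_southeast L W \<and> (r - 1, c) \<notin> gp_southeast L W"
proof -
  have "(if (r, c) \<in> gp_southeast L W then 1 else 0 :: nat) =
    (if (r - 1, c) \<in> gp_southeast L W then 1 else 0) + (if north_edge L (r, c) \<in> gp_edges W then 1 else 0)"
    using height_north[OF gp_family[OF W] b] unfolding gp_height[OF W] .
  then show ?thesis by (rule indicator_step)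
qed

lemma gp_corner:
  assumes W: "generalized_path L W" and b: "(r, c) \<in> boxes L"
  shows "(\<exists>p\<in>W. Corner r c \<in> set p) \<longleftrightarrow> (r, c) \<in> gp_southeast L W \<and> (r - 1, c + 1) \<notin> gp_southeast L W"
proof -
  have "(if (r, c) \<in> gp_southeast L W then 1 else 0 :: nat) =
    (if (r - 1, c + 1) \<in> gp_southeast L W then 1 else 0) + (if \<exists>p\<in>W. Corner r c \<in> set p then 1 else 0)"
    using height_corner[OF gp_family[OF W] b] unfolding gp_height[OF W] .
  then show ?thesis by (rule indicator_step)
qed

text \<open>The sets of boxes southeast of a generalized path are exactly the closed sets whose
  northwestern boundary consists of edges of the graph.\<close>

definition graph_bounded :: "box set \<Rightarrow> bool" where
  "graph_bounded X \<longleftrightarrow> southeast_closed X \<and>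
     (\<forall>r c. (r, c) \<in> X \<longrightarrow> (r, c + 1) \<notin> X \<longrightarrow> col_plus r c) \<and>
     (\<forall>r c. (r, c) \<in> X \<longrightarrow> (r - 1, c) \<notin> X \<longrightarrow> row_plus r c)"

lemma gp_graph_bounded:
  assumes W: "generalized_path L W"
  shows "graph_bounded (gp_southeast L W)"
  unfolding graph_bounded_def
proof (intro conjI allI impI)
  note sub = southeast_closed_subset[OF gp_southeast_closed]
  fix r c assume rc: "(r, c) \<in> gp_southeast L W"
  then have b: "(r, c) \<in> boxes L" using sub by blast
  show "col_plus r c" if "(r, c + 1) \<notin> gp_southeast L W"
    using gp_west_edge[OF W b] rc that gp_edges_gamma[OF gp_family[OF W]] west_edge_in_gamma[OF b] by blast
  show "row_plus r c" if "(r - 1, c) \<notin> gp_southeast L W"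
    using gp_north_edge[OF W b] rc that gp_edges_gamma[OF gp_family[OF W]] north_edge_in_gamma[OF b] by blast
qed (rule gp_southeast_closed)

text \<open>The height is the indicator of the region, so equal regions have equal edges. A path
  from a source to a sink has a first edge, and the path of the other collection using this edge
  starts at the same source, since no edge enters a source.\<close>

lemma gp_unique:
  assumes W: "generalized_path L W" and V: "generalized_path L V" and eq: "gp_southeast L W = gp_southeast L V"
  shows "W = V"
proof -
  have sub: "W \<subseteq> V" if W: "generalized_path L W" and V: "generalized_path L V"
    and eq: "gp_southeast L W = gp_southeast L V" for W V
  proof
    note fW = gp_family[OF W] and fV = gp_family[OF V]
    have edges: "gp_edges W = gp_edges V"
      by (rule gp_edges_eq[OF fW fV]) (simp add: gp_height[OF W] gp_height[OF V] eq)
    fix p assume p: "p \<in> W"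
    obtain m where m: "hd p = Bdry m" "m \<in> sources L" using W p by (auto simp: generalized_path_def)
    have "last p \<in> Bdry ` sinks L" using W p by (auto simp: generalized_path_def)
    then have "hd p \<noteq> last p" using m sources_sinks_disjoint by auto
    moreover have "hd p \<in> set p" using border_path_nonempty[OF family_border_path[OF fW p]] by simp
    ultimately obtain v where "(hd p, v) \<in> path_edges p" using next_vertex by metis
    then have "(hd p, v) \<in> gp_edges W" using p by (auto simp: gp_edges_def)
    then obtain q where q: "q \<in> V" "(hd p, v) \<in> path_edges q" unfolding edges by (auto simp: gp_edges_def)
    then have hq: "hd p \<in> set q" using path_edges_in_set by blast
    have "hd p = hd q"
    proof (rule ccontr)
      assume "hd p \<noteq> hd q"
      then obtain u where "(u, hd p) \<in> path_edges q" using prev_vertex[OF hq] by blast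
      then have "(u, Bdry m) \<in> gamma_graph L"
        using family_border_path[OF fV q(1)] m by (auto simp: border_path_def is_path_edges)
      then obtain t where "(col_height L t, t) \<in> boxes L" "m = sink L t" using gamma_in_bdry by metis
      then show False using m(2) sink_notin_sources boxesD by blast
    qed
    then have "p = q" using family_path_eq[OF fW fV edges p q(1)] by blast
    then show "p \<in> V" using q by simp
  qed
  show ?thesis using sub[OF W V eq] sub[OF V W eq[symmetric]] by blast
qed

text \<open>The indicator of \<open>Z\<close> satisfies \<open>family_of_height\<close>. Dropping
  the trivial paths leaves a generalized path, because nested nonempty regions would give height
  2.\<close>

lemma gp_exists:
  assumes Z: "graph_bounded Z"
  obtains W where "generalized_path L W" "gp_southeast L W = Z"
proof -
  have closed: "southeast_closed Z" and sub: "Z \<subseteq> boxes L"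
    using Z southeast_closed_subset by (auto simp: graph_bounded_def)
  define f :: "nat \<Rightarrow> nat \<Rightarrow> nat" where "f r c = (if (r, c) \<in> Z then 1 else 0)" for r c
  have "\<exists>A. family A \<and> hd ` A = Bdry ` sources L \<and> (\<forall>r c. height A r c = f r c)"
  proof (rule family_of_height)
    fix r c
    show "(r, c) \<notin> boxes L \<Longrightarrow> f r c = 0" using sub by (auto simp: f_def)
    assume b: "(r, c) \<in> boxes L"
    show "f r (c + 1) \<le> f r c" using southeast_closedD[OF closed _ b, of r "c + 1"] by (auto simp: f_def)
    show "f (r - 1) c \<le> f r c" using southeast_closedD[OF closed _ b, of "r - 1" c] by (auto simp: f_def)
    show "f r c \<le> Suc (f (r - 1) (c + 1))" by (simp add: f_def)
    show "f r (c + 1) \<noteq> f r c \<Longrightarrow> col_plus r c"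
      using southeast_closedD[OF closed _ b, of r "c + 1"] Z by (auto simp: f_def graph_bounded_def split: if_splits)
    show "f (r - 1) c \<noteq> f r c \<Longrightarrow> row_plus r c"
      using southeast_closedD[OF closed _ b, of "r - 1" c] Z by (auto simp: f_def graph_bounded_def split: if_splits)
  qed
  then obtain A where A: "family A" "hd ` A = Bdry ` sources L" "\<And>r c. height A r c = f r c" by blast
  have fin: "finite A" using A by (simp add: family_def)
  define W where "W = {p \<in> A. last p \<in> Bdry ` sinks L}"
  have proper: "p \<in> W" if p: "p \<in> A" "southeast L p \<noteq> {}" for p
    using family_border_path[OF A(1) p(1)]
  proof (cases p rule: border_path_label)
    case (trivial s)
    then show ?thesis using p by (simp add: southeast_trivial)
  next
    case (proper s t)
    then show ?thesis using p boxesD[OF proper(1)] by (auto simp: W_def sinks_def)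
  qed
  have cnt: "(r, c) \<in> Z \<longleftrightarrow> {p \<in> A. (r, c) \<in> southeast L p} \<noteq> {}" for r c
  proof -
    have "height A r c \<noteq> 0 \<longleftrightarrow> {p \<in> A. (r, c) \<in> southeast L p} \<noteq> {}"
      using fin by (simp add: height_def)
    moreover have "height A r c \<noteq> 0 \<longleftrightarrow> (r, c) \<in> Z" unfolding A(3) f_def by simp
    ultimately show ?thesis by blast
  qed
  have "(r, c) \<in> gp_southeast L W \<longleftrightarrow> (r, c) \<in> Z" for r c
    unfolding cnt gp_southeast_def using proper unfolding W_def by blast
  then have se: "gp_southeast L W = Z" by auto
  have nonempty: "southeast L p \<noteq> {}" if p: "p \<in> W" for p
  proof -
    have "p \<in> A" using p by (simp add: W_def)
    from family_border_path[OF A(1) this] show ?thesis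
    proof (cases p rule: border_path_label)
      case (trivial s)
      then show ?thesis using p source_notin_sinks by (auto simp: W_def)
    qed auto
  qed
  have "\<not> southeast L p \<subseteq> southeast L q" if pq: "p \<in> W" "q \<in> W" "p \<noteq> q" for p q
  proof
    assume sub: "southeast L p \<subseteq> southeast L q"
    obtain r c where rc: "(r, c) \<in> southeast L p" using nonempty[OF pq(1)] by auto
    then have "{p, q} \<subseteq> {p \<in> A. (r, c) \<in> southeast L p}" using sub pq by (auto simp: W_def)
    then have "card {p, q} \<le> height A r c" unfolding height_def using fin by (intro card_mono) auto
    then show False using pq(3) A(3)[of r c] by (auto simp: f_def split: if_splits)
  qed
  then have "generalized_path L W"
    using A(1) by (auto simp: generalized_path_def W_def family_def border_path_def)
  then show ?thesis using that se by blast
qed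

subsection \<open>The next generalized path\<close>

lemma depth_mono:
  assumes X: "southeast_closed X"
  shows "(r', c') \<in> boxes L \<Longrightarrow> 1 \<le> r \<Longrightarrow> r \<le> r' \<Longrightarrow> c' \<le> c \<Longrightarrow> c \<le> width L \<Longrightarrow> depth X r c \<le> depth X r' c'"
proof (induction r' c' rule: box_less_induct)
  case (less r' c')
  show ?case
  proof (cases "r < r'")
    case True
    then have "(r' - 1, c') \<in> boxes L" using boxes_nw[OF less.hyps, of "r' - 1" c'] less.prems by simp
    then have "depth X r c \<le> depth X (r' - 1) c'" using less.IH[of "r' - 1" c'] less.prems True by simp
    then show ?thesis using depth_mono_step[OF X less.hyps] by simp
  next
    case False
    then have r: "r' = r" using less.prems by simp
    show ?thesis
    proof (cases "c' < c")
      case True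
      then have "(r', c' + 1) \<in> boxes L" using boxes_nw[OF less.hyps, of r' "c' + 1"] less.prems by simp
      then have "depth X r c \<le> depth X r' (c' + 1)" using less.IH[of r' "c' + 1"] less.prems True by simp
      then show ?thesis using depth_mono_step[OF X less.hyps] by simp
    next
      case False
      then show ?thesis using r less.prems by simp
    qed
  qed
qed

text \<open>The region with the first layer of its chains removed; it turns out to be the region of
  the next generalized path.\<close>

definition deep :: "box set \<Rightarrow> box set" where
  "deep X = {(r, c) \<in> boxes L. 2 \<le> depth X r c}"

lemma deep_subset: "deep X \<subseteq> X"
proof
  fix x assume "x \<in> deep X"
  then show "x \<in> X" using depth_outside[of "fst x" "snd x" X] by (cases x) (auto simp: deep_def)
qed

lemma deep_iff: "(r, c) \<in> deep X \<longleftrightarrow> 2 \<le> depth X r c"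
  by (cases "(r, c) \<in> boxes L") (simp_all add: deep_def depth_outside)

lemma deep_graph_bounded:
  assumes X: "southeast_closed X"
  shows "graph_bounded (deep X)"
  unfolding graph_bounded_def
proof (intro conjI allI impI)
  show "southeast_closed (deep X)"
  proof (rule southeast_closedI)
    show "deep X \<subseteq> boxes L" by (auto simp: deep_def)
    fix r c r' c' assume a: "(r, c) \<in> deep X" "(r', c') \<in> boxes L" "r \<le> r'" "c' \<le> c"
    then have "(r, c) \<in> boxes L" by (simp add: deep_def)
    then show "(r', c') \<in> deep X"
      using depth_mono[OF X a(2), of r c] a boxesD by (fastforce simp: deep_iff)
  qed
  fix r c assume d: "(r, c) \<in> deep X"
  then have b: "(r, c) \<in> boxes L" by (simp add: deep_def)
  show "col_plus r c" if "(r, c + 1) \<notin> deep X"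
    using depth_no_col[OF X] b d that by (metis deep_iff)
  show "row_plus r c" if "(r - 1, c) \<notin> deep X"
    using depth_no_row[OF X] b d that by (metis deep_iff)
qed

text \<open>Every chain loses its first box. Boxes of depth 0 or 1 leave the region, in agreement
  with truncated subtraction.\<close>

lemma depth_deep:
  assumes X: "southeast_closed X"
  shows "depth (deep X) r c = depth X r c - 1"
proof (cases "(r, c) \<in> boxes L")
  case True
  have D: "southeast_closed (deep X)" using deep_graph_bounded[OF X] by (simp add: graph_bounded_def)
  show ?thesis using True
  proof (induction r c rule: quadrant_induct)
    case (outside r c)
    then show ?case by (simp add: depth_northwest)
  next
    case (less r c)
    note IH = less.IH
    have ne: "r - 1 \<noteq> r" using boxesD[OF less.hyps] by linarith
    show ?case
    proof (cases "(r, c) \<in> X")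
      case False
      then have "(r, c) \<notin> deep X" using deep_subset by blast
      then show ?thesis using False by (simp add: depth_outside)
    next
      case True
      show ?thesis
      proof (rule depth_cases[OF True less.hyps X])
        assume d: "\<And>Y. southeast_closed Y \<Longrightarrow> (r, c) \<in> Y \<Longrightarrow> depth Y r c = Suc (depth Y (r - 1) (c + 1))"
        show ?thesis
        proof (cases "(r, c) \<in> deep X")
          case True
          then show ?thesis using d[OF X \<open>(r, c) \<in> X\<close>] d[OF D True] IH[of "r - 1" "c + 1"] ne by (simp add: deep_iff)
        next
          case False
          then show ?thesis using depth_outside[of r c "deep X"] by (simp add: deep_iff)
        qed
      next
        assume "\<And>Y. southeast_closed Y \<Longrightarrow> depth Y r c = depth Y r (c + 1)"
        then show ?thesis using X D IH[of r "c + 1"] by simp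
      next
        assume "\<And>Y. southeast_closed Y \<Longrightarrow> depth Y r c = depth Y (r - 1) c"
        then show ?thesis using X D IH[of "r - 1" c] ne by simp
      qed
    qed
  qed
qed (simp add: depth_outside)

text \<open>A copying clause that left \<open>X\<close> would cross its boundary at a side that is
  no edge. The recursion therefore stays in \<open>X\<close> until it meets a
  \<open>+\<close>.\<close>

lemma depth_pos:
  assumes X: "graph_bounded X"
  shows "(r, c) \<in> X \<Longrightarrow> 1 \<le> depth X r c"
proof -
  assume "(r, c) \<in> X"
  have closed: "southeast_closed X" using X by (simp add: graph_bounded_def)
  have "(r, c) \<in> boxes L" using closed \<open>(r, c) \<in> X\<close> southeast_closed_subset by blast
  then show ?thesis using \<open>(r, c) \<in> X\<close>
  proof (induction r c rule: box_less_induct)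
    case (less r c)
    have ne: "r - 1 \<noteq> r" using boxesD[OF less.hyps] by linarith
    have IH: "1 \<le> depth X r' c'" if "(r', c') \<in> X" "r' \<le> r" "c \<le> c'" "(r', c') \<noteq> (r, c)" for r' c'
      using less.IH that southeast_closed_subset[OF closed] by blast
    show ?case
    proof (rule depth_cases[OF less.prems less.hyps closed])
      assume "\<And>Y. southeast_closed Y \<Longrightarrow> (r, c) \<in> Y \<Longrightarrow> depth Y r c = Suc (depth Y (r - 1) (c + 1))"
      then show ?thesis using closed less.prems by simp
    next
      assume a: "\<not> col_plus r c" "\<And>Y. southeast_closed Y \<Longrightarrow> depth Y r c = depth Y r (c + 1)"
      then have "(r, c + 1) \<in> X" using X less.prems by (auto simp: graph_bounded_def)
      then show ?thesis using a(2)[OF closed] IH[of r "c + 1"] by simp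
    next
      assume a: "\<not> row_plus r c" "\<And>Y. southeast_closed Y \<Longrightarrow> depth Y r c = depth Y (r - 1) c"
      then have "(r - 1, c) \<in> X" using X less.prems by (auto simp: graph_bounded_def)
      then show ?thesis using a(2)[OF closed] IH[of "r - 1" c] ne by simp
    qed
  qed
qed

lemma depth_minus_deep:
  assumes "graph_bounded X"
  shows "int (depth X r c) - int (depth (deep X) r c) = (if (r, c) \<in> X then 1 else 0)"
proof -
  have X: "southeast_closed X" using assms by (simp add: graph_bounded_def)
  show ?thesis
  proof (cases "(r, c) \<in> X")
    case True
    then show ?thesis using depth_pos[OF assms True] depth_deep[OF X] by simp
  next
    case False
    then show ?thesis using depth_deep[OF X, of r c] by (simp add: depth_outside)
  qed
qed

text \<open>At a \<open>+\<close> box in the region of \<open>V\<close> the diagonal neighbour is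
  still southeast of \<open>W\<close>, as otherwise both would pass through the corner; this makes
  the depth at least 2, and other boxes inherit the bound from neighbours in the region of
  \<open>V\<close>. Conversely, at a common corner the depth would rise from 0 to at least 2 along
  one diagonal step.\<close>

lemma strictly_southeast_deep:
  assumes W: "generalized_path L W" and V: "generalized_path L V"
  shows "strictly_southeast L W V \<longleftrightarrow> gp_southeast L V \<subseteq> deep (gp_southeast L W)"
proof
  let ?X = "gp_southeast L W" and ?Z = "gp_southeast L V"
  have Xb: "graph_bounded ?X" and Zb: "graph_bounded ?Z" using gp_graph_bounded W V by auto
  have X: "southeast_closed ?X" and Z: "southeast_closed ?Z" using gp_southeast_closed by auto
  {
    assume s: "strictly_southeast L W V"
    then have sub: "?Z \<subseteq> ?X" by (simp add: strictly_southeast_def)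
    have "2 \<le> depth ?X r c" if "(r, c) \<in> ?Z" for r c
    proof -
      have "(r, c) \<in> boxes L" using that southeast_closed_subset[OF Z] by blast
      then show ?thesis using that
      proof (induction r c rule: box_less_induct)
        case (less r c)
        have ne: "r - 1 \<noteq> r" using boxesD[OF less.hyps] by linarith
        have IH: "2 \<le> depth ?X r' c'" if "(r', c') \<in> ?Z" "r' \<le> r" "c \<le> c'" "(r', c') \<noteq> (r, c)" for r' c'
          using less.IH that southeast_closed_subset[OF Z] by blast
        have rX: "(r, c) \<in> ?X" using less.prems sub by blast
        show ?case
        proof (rule depth_cases[OF rX less.hyps X])
          assume d: "\<And>Y. southeast_closed Y \<Longrightarrow> (r, c) \<in> Y \<Longrightarrow> depth Y r c = Suc (depth Y (r - 1) (c + 1))"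
          have "(r - 1, c + 1) \<in> ?X"
          proof (rule ccontr)
            assume n: "(r - 1, c + 1) \<notin> ?X"
            then obtain p where p: "p \<in> W" "Corner r c \<in> set p" using gp_corner[OF W less.hyps] rX by blast
            have "(r - 1, c + 1) \<notin> ?Z" using n sub by blast
            then obtain q where q: "q \<in> V" "Corner r c \<in> set q" using gp_corner[OF V less.hyps] less.prems by blast
            show False using s p q unfolding strictly_southeast_def by blast
          qed
          then show ?thesis using d[OF X rX] depth_pos[OF Xb] by fastforce
        next
          assume a: "\<not> col_plus r c" "\<And>Y. southeast_closed Y \<Longrightarrow> depth Y r c = depth Y r (c + 1)"
          then have "(r, c + 1) \<in> ?Z" using Zb less.prems by (auto simp: graph_bounded_def)
          then show ?thesis using a(2)[OF X] IH[of r "c + 1"] by simp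
        next
          assume a: "\<not> row_plus r c" "\<And>Y. southeast_closed Y \<Longrightarrow> depth Y r c = depth Y (r - 1) c"
          then have "(r - 1, c) \<in> ?Z" using Zb less.prems by (auto simp: graph_bounded_def)
          then show ?thesis using a(2)[OF X] IH[of "r - 1" c] ne by simp
        qed
      qed
    qed
    then show "?Z \<subseteq> deep ?X" by (auto simp: deep_iff)
  }
  {
    assume sub: "?Z \<subseteq> deep ?X"
    have no_corner: False if pq: "p \<in> W" "q \<in> V" "Corner r c \<in> set p" "Corner r c \<in> set q" for p q r c
    proof -
      have b: "(r, c) \<in> boxes L" using corner_in_boxes family_border_path gp_family[OF W] pq by blast
      have "(r, c) \<in> deep ?X" using gp_corner[OF V b] pq sub by blast
      moreover have "(r - 1, c + 1) \<notin> ?X" using gp_corner[OF W b] pq by blast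
      ultimately show False using depth_mono_step[OF X b] by (simp add: deep_iff depth_outside)
    qed
    have "set p \<inter> set q = {}" if pq: "p \<in> W" "q \<in> V" for p q
    proof (rule ccontr)
      assume "set p \<inter> set q \<noteq> {}"
      then obtain v where v: "v \<in> set p" "v \<in> set q" by blast
      have bp: "border_path p" "border_path q" using family_border_path gp_family W V pq by blast+
      have l: "last p \<in> Bdry ` sinks L" "last q \<in> Bdry ` sinks L" using W V pq by (auto simp: generalized_path_def)
      show False
      proof (cases v)
        case (Corner r c)
        then show False using no_corner[OF pq] v by blast
      next
        case (Bdry m)
        then obtain r c where "Corner r c \<in> set p" "Corner r c \<in> set q"
          using border_path_mid[OF bp(1) l(1)] v bp(2) l(2) by blast
        then show False using no_corner[OF pq] by blast
      qed
    qed
    then show "strictly_southeast L W V"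
      using sub deep_subset[of ?X] unfolding strictly_southeast_def by blast
  }
qed

text \<open>By \<open>strictly_southeast_deep\<close> the candidates are the generalized paths with
  region inside \<open>deep\<close>, and \<open>deep\<close> itself is such a region.\<close>

lemma next_gp:
  assumes W: "generalized_path L W"
  shows "generalized_path L (next_gp L W)" and "gp_southeast L (next_gp L W) = deep (gp_southeast L W)"
proof -
  let ?D = "deep (gp_southeast L W)"
  obtain V where V: "generalized_path L V" "gp_southeast L V = ?D"
    using gp_exists[OF deep_graph_bounded[OF gp_southeast_closed]] by metis
  have "next_gp L W = V"
    unfolding next_gp_def
  proof (rule the_equality)
    show "generalized_path L V \<and> strictly_southeast L W V \<and>
     (\<forall>V'. generalized_path L V' \<and> strictly_southeast L W V' \<longrightarrow> gp_southeast L V' \<subseteq> gp_southeast L V)"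
      using V strictly_southeast_deep[OF W] by auto
    fix U assume U: "generalized_path L U \<and> strictly_southeast L W U \<and>
     (\<forall>V'. generalized_path L V' \<and> strictly_southeast L W V' \<longrightarrow> gp_southeast L V' \<subseteq> gp_southeast L U)"
    then have "gp_southeast L U \<subseteq> ?D" using strictly_southeast_deep[OF W] by blast
    moreover have "gp_southeast L V \<subseteq> gp_southeast L U" using U V strictly_southeast_deep[OF W] by blast
    ultimately show "U = V" using gp_unique U V by blast
  qed
  then show "generalized_path L (next_gp L W)" and "gp_southeast L (next_gp L W) = ?D" using V by auto
qed

subsection \<open>The paths \<open>U\<^sub>F\<close> and \<open>D\<^sub>F\<close>\<close>

lemma U_path_gp:
  assumes "(r, c) \<in> plus_boxes L"
  shows "generalized_path L (U_path L (r, c))" and "gp_southeast L (U_path L (r, c)) = weak_se r c"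
proof -
  have b: "(r, c) \<in> boxes L" using assms plus_boxes_subset by blast
  have "sink L c \<in> sinks L" using boxesD[OF b] by (simp add: sinks_def)
  then show "generalized_path L (U_path L (r, c))"
    using hook_border_path[OF assms] by (auto simp: generalized_path_def U_path_def border_path_def hook_hd_last)
  show "gp_southeast L (U_path L (r, c)) = weak_se r c"
    using southeast_hook[OF b] by (simp add: gp_southeast_def U_path_def)
qed

lemma face_subset_weak_se:
  assumes "(r, c) \<in> plus_boxes L"
  shows "face_of L (r, c) \<subseteq> weak_se r c"
proof
  fix x assume "x \<in> face_of L (r, c)"
  then have x: "x \<in> boxes L" "plus_nw x = plus_nw (r, c)" using face_of_plus[OF assms] by auto
  then have "(r, c) \<in> plus_nw x" using plus_nw_self[OF assms] by simp
  then show "x \<in> weak_se r c" using x by (cases x) (simp add: plus_nw_def weak_se_def)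
qed

text \<open>Towards the southeast \<open>plus_nw\<close> only grows, so removing the face of
  \<open>(r, c)\<close> leaves a closed region. Where this region borders on the face,
  \<open>plus_nw\<close> changes, so a \<open>+\<close> of that row or column has entered and the
  side is an edge.\<close>

lemma D_path_gp:
  assumes plus: "(r, c) \<in> plus_boxes L"
  shows "generalized_path L (D_path L (r, c))"
    and "gp_southeast L (D_path L (r, c)) = weak_se r c - face_of L (r, c)"
proof -
  let ?Z = "weak_se r c - face_of L (r, c)"
  have mono: "plus_nw (a, b) \<subseteq> plus_nw (a', b')" if "a \<le> a'" "b' \<le> b" for a b a' b'
    using that by (auto simp: plus_nw_def)
  have Z: "(a, b) \<in> ?Z \<longleftrightarrow> (a, b) \<in> weak_se r c \<and> plus_nw (a, b) \<noteq> plus_nw (r, c)" for a b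
    using face_of_plus[OF plus] by (auto simp: weak_se_def)
  have nw: "plus_nw (r, c) \<subseteq> plus_nw (a, b)" if "(a, b) \<in> weak_se r c" for a b
    using mono that by (simp add: weak_se_def)
  have "graph_bounded ?Z"
    unfolding graph_bounded_def
  proof (intro conjI allI impI)
    show "southeast_closed ?Z"
    proof (rule southeast_closedI)
      show "?Z \<subseteq> boxes L" by (auto simp: weak_se_def)
      fix a b a' b' assume a: "(a, b) \<in> ?Z" "(a', b') \<in> boxes L" "a \<le> a'" "b' \<le> b"
      then have "(a', b') \<in> weak_se r c" by (auto simp: weak_se_def)
      moreover have "(a, b) \<in> weak_se r c" "plus_nw (a, b) \<noteq> plus_nw (r, c)" using a(1) Z[of a b] by simp_all
      then have "plus_nw (a', b') \<noteq> plus_nw (r, c)"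
        using mono[OF a(3,4)] nw[of a b] by (metis subset_antisym)
      ultimately show "(a', b') \<in> ?Z" using Z by blast
    qed
    fix a b assume ab: "(a, b) \<in> ?Z"
    then have w: "(a, b) \<in> boxes L" "r \<le> a" "b \<le> c" by (auto simp: weak_se_def)
    have rc: "1 \<le> r" "c \<le> width L" using plus plus_boxes_subset boxesD by auto
    show "col_plus a b" if n: "(a, b + 1) \<notin> ?Z"
    proof (cases "b = c")
      case True
      then show ?thesis using plus w by (auto simp: col_plus_def)
    next
      case False
      then have "(a, b + 1) \<in> weak_se r c" using boxes_nw[OF w(1), of a "b + 1"] w rc by (simp add: weak_se_def)
      then have "plus_nw (a, b + 1) \<noteq> plus_nw (a, b)" using n ab Z by blast
      then obtain x where "x \<in> plus_nw (a, b)" "x \<notin> plus_nw (a, b + 1)" using mono[of a a b "b + 1"] by auto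
      then have "(fst x, b) \<in> plus_boxes L" "fst x \<le> a" by (auto simp: plus_nw_def Suc_le_eq le_less)
      then show ?thesis by (auto simp: col_plus_def)
    qed
    show "row_plus a b" if n: "(a - 1, b) \<notin> ?Z"
    proof (cases "a = r")
      case True
      then show ?thesis using plus w by (auto simp: row_plus_def)
    next
      case False
      then have "(a - 1, b) \<in> weak_se r c" using boxes_nw[OF w(1), of "a - 1" b] w rc boxesD[OF w(1)] by (simp add: weak_se_def)
      then have "plus_nw (a - 1, b) \<noteq> plus_nw (a, b)" using n ab Z by blast
      then obtain y d where "(y, d) \<in> plus_nw (a, b)" "(y, d) \<notin> plus_nw (a - 1, b)" using mono[of "a - 1" a b b] by auto
      then have y: "(y, d) \<in> plus_boxes L" "y \<le> a" "\<not> y \<le> a - 1" "b \<le> d" by (auto simp: plus_nw_def)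
      then have "y = a" by linarith
      then show ?thesis using y by (auto simp: row_plus_def)
    qed
  qed
  then obtain W where W: "generalized_path L W" "gp_southeast L W = ?Z" using gp_exists by metis
  note face = face_subset_weak_se[OF plus]
  have "D_path L (r, c) = W"
    unfolding D_path_def U_path_gp(2)[OF plus]
  proof (rule the_equality)
    show "generalized_path L W \<and> gp_southeast L W \<subseteq> weak_se r c \<and> weak_se r c - gp_southeast L W = face_of L (r, c)"
      using W face by blast
    fix V assume V: "generalized_path L V \<and> gp_southeast L V \<subseteq> weak_se r c \<and> weak_se r c - gp_southeast L V = face_of L (r, c)"
    then have "gp_southeast L V \<subseteq> weak_se r c" "weak_se r c - gp_southeast L V = face_of L (r, c)" by blast+
    then have "gp_southeast L V = gp_southeast L W" using W(2) double_diff[of "gp_southeast L V" "weak_se r c"] by auto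
    then show "V = W" using gp_unique V W(1) by blast
  qed
  then show "generalized_path L (D_path L (r, c))" "gp_southeast L (D_path L (r, c)) = ?Z" using W by auto
qed

end

section \<open>Corners and exponents\<close>

lemma power_int_prod: "(\<Prod>x\<in>A. f x) powi n = (\<Prod>x\<in>A. f x powi n)" for f :: "'a \<Rightarrow> real"
  by (induction A rule: infinite_finite_induct) (auto simp: power_int_mult_distrib)

lemma power_int_sum: "x \<noteq> 0 \<Longrightarrow> x powi (\<Sum>i\<in>A. g i) = (\<Prod>i\<in>A. x powi g i)" for x :: real
  by (induction A rule: infinite_finite_induct) (auto simp: power_int_add)

context le_diag
begin

section \<open>Depth of a staircase of quadrants\<close>

lemma southeast_closed_UN:
  assumes "\<And>i. i \<in> I \<Longrightarrow> southeast_closed (X i)"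
  shows "southeast_closed (\<Union>i\<in>I. X i)"
proof (rule southeast_closedI)
  show "(\<Union>i\<in>I. X i) \<subseteq> boxes L" using southeast_closed_subset[OF assms] by blast
  fix r c r' c' assume a: "(r, c) \<in> (\<Union>i\<in>I. X i)" "(r', c') \<in> boxes L" "r \<le> r'" "c' \<le> c"
  then obtain i where i: "i \<in> I" "(r, c) \<in> X i" by blast
  then show "(r', c') \<in> (\<Union>i\<in>I. X i)" using southeast_closedD[OF assms[OF i(1)] i(2) a(2-4)] by blast
qed

text \<open>Inclusion and exclusion reduces to neighbouring quadrants: each new one meets the union
  of the earlier ones in a single quadrant, so \<open>depth_modular\<close> adds one term and
  subtracts one.\<close>

lemma depth_staircase:
  fixes f :: "nat \<Rightarrow> nat"
  assumes "finite R" "\<And>r r'. r \<in> R \<Longrightarrow> r' \<in> R \<Longrightarrow> r < r' \<Longrightarrow> f r < f r'"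
  shows "int (depth (\<Union>r\<in>R. weak_se r (f r)) a b) = (\<Sum>r\<in>R. int (depth (weak_se r (f r)) a b)) -
    (\<Sum>r\<in>{r \<in> R. \<exists>x\<in>R. x < r}. int (depth (weak_se r (f (Max {x \<in> R. x < r}))) a b))"
  using assms
proof (induction R rule: finite_linorder_max_induct)
  case empty
  then show ?case by (simp add: depth_outside)
next
  case (insert m R)
  let ?U = "\<Union>r\<in>R. weak_se r (f r)"
  let ?g = "\<lambda>S r. int (depth (weak_se r (f (Max {x \<in> S. x < r}))) a b)"
  have m: "m \<notin> R" using insert.hyps by blast
  have IH: "int (depth ?U a b) = (\<Sum>r\<in>R. int (depth (weak_se r (f r)) a b)) - (\<Sum>r\<in>{r \<in> R. \<exists>x\<in>R. x < r}. ?g R r)"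
    using insert.IH insert.prems by blast
  have same: "{x \<in> insert m R. x < r} = {x \<in> R. x < r}" if "r \<in> R" for r
    using insert.hyps that by auto
  show ?case
  proof (cases "R = {}")
    case True
    have "{r \<in> {m}. \<exists>x\<in>{m}. x < r} = {}" by auto
    then show ?thesis unfolding True by (simp only: sum.empty) simp
  next
    case False
    define M where "M = Max R"
    have M: "M \<in> R" "\<And>r. r \<in> R \<Longrightarrow> r \<le> M" using False insert.hyps(1) by (auto simp: M_def)
    have fM: "f M < f m" using insert.prems[of M m] M insert.hyps by auto
    have fle: "f r \<le> f M" if "r \<in> R" for r
    proof (cases "r = M")
      case False
      then have "r < M" using M(2)[OF that] by simp
      then show ?thesis using insert.prems[of r M] that M by simp
    qed simp
    \<comment> \<open>As \<open>f\<close> increases, the earlier quadrant reaching furthest left is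
      the preceding one, so the intersection is the quadrant with the new row and the preceding
      column.\<close>
    have int: "weak_se m (f m) \<inter> ?U = weak_se m (f M)"
    proof
      show "weak_se m (f m) \<inter> ?U \<subseteq> weak_se m (f M)"
        using fle by (fastforce simp: weak_se_def)
      show "weak_se m (f M) \<subseteq> weak_se m (f m) \<inter> ?U"
      proof
        fix x assume x: "x \<in> weak_se m (f M)"
        then have "x \<in> weak_se m (f m)" using fM by (auto simp: weak_se_def)
        moreover have "M \<le> m" using M(1) insert.hyps by auto
        then have "x \<in> weak_se M (f M)" using x by (auto simp: weak_se_def)
        ultimately show "x \<in> weak_se m (f m) \<inter> ?U" using M(1) by blast
      qed
    qed
    have "southeast_closed ?U" by (intro southeast_closed_UN weak_se_closed)
    from depth_modular[OF weak_se_closed this, of m "f m" a b]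
    have mod: "int (depth (weak_se m (f m) \<union> ?U) a b) =
        int (depth (weak_se m (f m)) a b) + int (depth ?U a b) - int (depth (weak_se m (f M)) a b)"
      unfolding int by linarith
    have set: "{r \<in> insert m R. \<exists>x\<in>insert m R. x < r} = insert m {r \<in> R. \<exists>x\<in>R. x < r}"
      using insert.hyps False by auto
    have below: "{x \<in> insert m R. x < m} = R" using insert.hyps by auto
    have fin: "finite {r \<in> R. \<exists>x\<in>R. x < r}" and notin: "m \<notin> {r \<in> R. \<exists>x\<in>R. x < r}"
      using insert.hyps(1) m by auto
    have "(\<Sum>r\<in>{r \<in> insert m R. \<exists>x\<in>insert m R. x < r}. ?g (insert m R) r) =
        int (depth (weak_se m (f M)) a b) + (\<Sum>r\<in>{r \<in> R. \<exists>x\<in>R. x < r}. ?g (insert m R) r)"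
      unfolding set sum.insert[OF fin notin] below M_def ..
    also have "(\<Sum>r\<in>{r \<in> R. \<exists>x\<in>R. x < r}. ?g (insert m R) r) = (\<Sum>r\<in>{r \<in> R. \<exists>x\<in>R. x < r}. ?g R r)"
      by (rule sum.cong[OF refl]) (simp only: mem_Collect_eq same)
    finally have sum: "(\<Sum>r\<in>{r \<in> insert m R. \<exists>x\<in>insert m R. x < r}. ?g (insert m R) r) =
        int (depth (weak_se m (f M)) a b) + (\<Sum>r\<in>{r \<in> R. \<exists>x\<in>R. x < r}. ?g R r)" .
    have U: "(\<Union>r\<in>insert m R. weak_se r (f r)) = weak_se m (f m) \<union> ?U" by simp
    show ?thesis unfolding U mod sum IH using insert.hyps(1) m by simp
  qed
qed

text \<open>Lets the staircase sum include inner positions beyond the border.\<close>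

lemma weak_se_empty: "1 \<le> r \<Longrightarrow> c \<le> width L \<Longrightarrow> (r, c) \<notin> boxes L \<Longrightarrow> weak_se r c = {}"
  using boxes_nw by (fastforce simp: weak_se_def)

section \<open>Outer and inner corners of a generalized path\<close>

context
  fixes W :: "vertex list set"
  assumes W: "generalized_path L W"
begin

lemma outer_corners_iff:
  "(r, c) \<in> outer_corners L W \<longleftrightarrow>
    (r, c) \<in> gp_southeast L W \<and> (r - 1, c) \<notin> gp_southeast L W \<and> (r, c + 1) \<notin> gp_southeast L W"
proof -
  have "(r, c) \<in> gp_southeast L W \<Longrightarrow> (r, c) \<in> boxes L"
    using southeast_closed_subset[OF gp_southeast_closed] by blast
  then show ?thesis
    unfolding outer_corners_def using gp_west_edge[OF W] gp_north_edge[OF W] by blast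
qed

lemma outer_corners_plus: "outer_corners L W \<subseteq> plus_boxes L"
proof
  fix x assume x: "x \<in> outer_corners L W"
  obtain r c where rc: "x = (r, c)" by (cases x)
  have b: "(r, c) \<in> boxes L" using x rc by (simp add: outer_corners_def)
  have "north_edge L (r, c) \<in> gamma_graph L" "west_edge L (r, c) \<in> gamma_graph L"
    using x rc gp_edges_gamma[OF gp_family[OF W]] by (auto simp: outer_corners_def)
  then show "x \<in> plus_boxes L"
    using le_property[OF b] north_edge_in_gamma[OF b] west_edge_in_gamma[OF b] rc by blast
qed

lemma outer_corners_row:
  assumes "(r, c) \<in> outer_corners L W" "(r, c') \<in> outer_corners L W"
  shows "c = c'"
proof -
  have le: "\<not> c < c'" if "(r, c) \<in> outer_corners L W" "(r, c') \<in> outer_corners L W" for c c'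
  proof
    assume lt: "c < c'"
    have 1: "(r, c') \<in> gp_southeast L W" "(r, c + 1) \<notin> gp_southeast L W" "(r, c) \<in> boxes L"
      using that outer_corners_iff by (auto simp: outer_corners_def)
    have "(r, c') \<in> boxes L" using that by (simp add: outer_corners_def)
    then have "(r, c + 1) \<in> boxes L" using boxes_nw[OF 1(3), of r "c + 1"] boxesD[OF 1(3)] boxesD[of r c'] lt by auto
    then show False using southeast_closedD[OF gp_southeast_closed 1(1), of r "c + 1"] 1(2) lt by simp
  qed
  show ?thesis using le[OF assms] le[OF assms(2,1)] by simp
qed

lemma outer_corners_increasing:
  assumes "(r, c) \<in> outer_corners L W" "(r', c') \<in> outer_corners L W" "r < r'"
  shows "c < c'"
proof (rule ccontr)
  assume n: "\<not> c < c'"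
  have 1: "(r, c) \<in> gp_southeast L W" "(r' - 1, c') \<notin> gp_southeast L W" "(r', c') \<in> boxes L" "(r, c) \<in> boxes L"
    using assms outer_corners_iff by (auto simp: outer_corners_def)
  have "(r' - 1, c') \<in> boxes L" using boxes_nw[OF 1(3), of "r' - 1" c'] boxesD[OF 1(3)] boxesD[OF 1(4)] assms(3) by linarith
  then show False using southeast_closedD[OF gp_southeast_closed 1(1), of "r' - 1" c'] 1(2) assms(3) n by simp
qed

text \<open>From a box of the region one moves up or left inside it until both neighbours are
  outside, which is an outer corner.\<close>

lemma outer_corner_below:
  assumes "(r, c) \<in> gp_southeast L W"
  shows "\<exists>r' c'. (r', c') \<in> outer_corners L W \<and> r' \<le> r \<and> c \<le> c'"
proof -
  note sub = southeast_closed_subset[OF gp_southeast_closed]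
  have "(r, c) \<in> boxes L" using sub assms by blast
  then show ?thesis using assms
  proof (induction r c rule: box_less_induct)
    case (less r c)
    have ne: "r - 1 \<noteq> r" using boxesD[OF less.hyps] by linarith
    consider "(r - 1, c) \<in> gp_southeast L W" | "(r, c + 1) \<in> gp_southeast L W" | "(r, c) \<in> outer_corners L W"
      using outer_corners_iff less.prems by blast
    then show ?case
    proof cases
      case 1
      then obtain r' c' where "(r', c') \<in> outer_corners L W" "r' \<le> r - 1" "c \<le> c'"
        using less.IH[of "r - 1" c] sub ne by fastforce
      then show ?thesis by (meson diff_le_self order_trans)
    next
      case 2
      then obtain r' c' where "(r', c') \<in> outer_corners L W" "r' \<le> r" "c + 1 \<le> c'"
        using less.IH[of r "c + 1"] sub by fastforce
      then show ?thesis by (meson le_add1 order_trans)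
    qed blast
  qed
qed

text \<open>The northern side must lie on the row of the later hook and the western side on the
  column of the earlier one, which fixes the position; being a box is all that remains.\<close>

lemma inner_corners_iff:
  "(r', c) \<in> inner_corners L W \<longleftrightarrow> (r', c) \<in> boxes L \<and>
     (\<exists>r c'. consecutive_corners L W (r, c) (r', c'))"
proof
  assume i: "(r', c) \<in> inner_corners L W"
  then have b: "(r', c) \<in> boxes L" by (simp add: inner_corners_def)
  obtain C D where CD: "consecutive_corners L W C D" "north_edge L (r', c) \<in> path_edges (hook_path L D)"
      "west_edge L (r', c) \<in> path_edges (hook_path L C)"
    using i by (auto simp: inner_corners_def)
  obtain r0 c0 where C: "C = (r0, c0)" by (cases C)
  obtain r1 c1 where D: "D = (r1, c1)" by (cases D)
  have box: "(r0, c0) \<in> boxes L" "(r1, c1) \<in> boxes L"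
    using CD(1) C D by (auto simp: consecutive_corners_def outer_corners_def)
  have "r' = r1" using CD(2) D hook_edges[OF box(2)] north_edge_inject north_neq_west by auto
  moreover have "c = c0" using CD(3) C hook_edges[OF box(1)] west_edge_inject north_neq_west[symmetric] by auto
  ultimately show "(r', c) \<in> boxes L \<and> (\<exists>r c'. consecutive_corners L W (r, c) (r', c'))"
    using b CD(1) C D by blast
next
  assume a: "(r', c) \<in> boxes L \<and> (\<exists>r c'. consecutive_corners L W (r, c) (r', c'))"
  then obtain r c' where con: "consecutive_corners L W (r, c) (r', c')" by blast
  have o: "(r, c) \<in> outer_corners L W" "(r', c') \<in> outer_corners L W" "r < r'"
    using con by (auto simp: consecutive_corners_def)
  have box: "(r, c) \<in> boxes L" "(r', c') \<in> boxes L" using o by (auto simp: outer_corners_def)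
  have "c < c'" using outer_corners_increasing o by blast
  then have "north_edge L (r', c) \<in> path_edges (hook_path L (r', c'))"
    unfolding hook_edges[OF box(2)] using a by (auto simp: boxes_iff)
  moreover have "west_edge L (r', c) \<in> path_edges (hook_path L (r, c))"
    unfolding hook_edges[OF box(1)] using a o by (auto simp: boxes_col)
  ultimately show "(r', c) \<in> inner_corners L W" using a con unfolding inner_corners_def by blast
qed

text \<open>The later outer corner is a \<open>+\<close> further left in the row, the earlier one a
  \<open>+\<close> further up in the column, so the Le-property applies.\<close>

lemma inner_corners_plus: "inner_corners L W \<subseteq> plus_boxes L"
proof
  fix x assume x: "x \<in> inner_corners L W"
  obtain r' c where rc: "x = (r', c)" by (cases x)
  obtain r c' where "consecutive_corners L W (r, c) (r', c')" and b: "(r', c) \<in> boxes L"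
    using x rc inner_corners_iff by blast
  then have o: "(r, c) \<in> outer_corners L W" "(r', c') \<in> outer_corners L W" "r < r'"
    by (auto simp: consecutive_corners_def)
  have "c < c'" using outer_corners_increasing o by blast
  moreover have "(r', c') \<in> plus_boxes L" "(r, c) \<in> plus_boxes L" using o outer_corners_plus by blast+
  ultimately have "row_plus r' c" "col_plus r' c"
    using o(3) less_imp_le unfolding row_plus_def col_plus_def by blast+
  then show "x \<in> plus_boxes L" using le_property[OF b] rc by blast
qed

lemma outer_inner_disjoint: "outer_corners L W \<inter> inner_corners L W = {}"
proof -
  have False if i: "(r', c) \<in> outer_corners L W" "(r', c) \<in> inner_corners L W" for r' c
  proof -
    obtain r c' where "consecutive_corners L W (r, c) (r', c')" using i(2) inner_corners_iff by blast
    then have "(r, c) \<in> outer_corners L W" "r < r'" by (auto simp: consecutive_corners_def)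
    then show False using outer_corners_increasing i(1) by blast
  qed
  then show ?thesis by auto
qed

lemma eps_gp_depth_sum:
  "(\<Sum>C\<in>plus_boxes L. eps_gp L W C * int (depth (weak_se (fst C) (snd C)) a b)) = int (depth (gp_southeast L W) a b)"
proof -
  let ?O = "outer_corners L W" and ?I = "inner_corners L W"
  let ?g = "\<lambda>C. int (depth (weak_se (fst C) (snd C)) a b)"
  \<comment> \<open>A row contains at most one outer corner, so the outer corners are the pairs
    \<open>(r, f r)\<close> with \<open>r\<close> in \<open>R\<close>, and \<open>f\<close>
    increases on \<open>R\<close>.\<close>
  define R where "R = fst ` ?O"
  define f where "f r = (THE c. (r, c) \<in> ?O)" for r
  have f: "(r, c) \<in> ?O \<Longrightarrow> f r = c" for r c
    unfolding f_def using outer_corners_row by blast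
  have O: "(r, c) \<in> ?O \<longleftrightarrow> r \<in> R \<and> c = f r" for r c
    using f by (force simp: R_def)
  have finO: "finite ?O" using outer_corners_plus finite_plus_boxes by (rule finite_subset)
  then have finR: "finite R" by (simp add: R_def)
  have incr: "f r < f r'" if "r \<in> R" "r' \<in> R" "r < r'" for r r'
    using outer_corners_increasing[of r "f r" r' "f r'"] O that by blast
  have boxO: "(r, f r) \<in> boxes L" if "r \<in> R" for r
    using O[of r "f r"] that by (simp add: outer_corners_def)
  have union: "gp_southeast L W = (\<Union>r\<in>R. weak_se r (f r))"
  proof
    show "gp_southeast L W \<subseteq> (\<Union>r\<in>R. weak_se r (f r))"
    proof
      fix x assume x: "x \<in> gp_southeast L W"
      then have "x \<in> boxes L" using southeast_closed_subset[OF gp_southeast_closed] by blast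
      moreover obtain r' c' where "(r', c') \<in> ?O" "r' \<le> fst x" "snd x \<le> c'"
        using outer_corner_below[of "fst x" "snd x"] x by auto
      ultimately show "x \<in> (\<Union>r\<in>R. weak_se r (f r))" using O by (cases x) (auto simp: weak_se_def)
    qed
    show "(\<Union>r\<in>R. weak_se r (f r)) \<subseteq> gp_southeast L W"
    proof
      fix x assume "x \<in> (\<Union>r\<in>R. weak_se r (f r))"
      then obtain r where r: "r \<in> R" "x \<in> weak_se r (f r)" by blast
      then have "(r, f r) \<in> gp_southeast L W" using O outer_corners_iff by blast
      then show "x \<in> gp_southeast L W"
        using southeast_closedD[OF gp_southeast_closed] r(2) by (cases x) (auto simp: weak_se_def)
    qed
  qed
  define R' where "R' = {r \<in> R. \<exists>x\<in>R. x < r}"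
  define pred where "pred r = Max {x \<in> R. x < r}" for r
  have pred: "pred r \<in> R \<and> pred r < r \<and> (\<forall>x\<in>R. x < r \<longrightarrow> x \<le> pred r)" if "r \<in> R'" for r
  proof -
    have "{x \<in> R. x < r} \<noteq> {}" "finite {x \<in> R. x < r}" using that finR by (auto simp: R'_def)
    then have "pred r \<in> {x \<in> R. x < r}" "\<forall>x\<in>{x \<in> R. x < r}. x \<le> pred r"
      unfolding pred_def using Max_in Max_ge by blast+
    then show ?thesis by auto
  qed
  have I: "?I = (\<lambda>r. (r, f (pred r))) ` R' \<inter> boxes L"
  proof -
    have con: "consecutive_corners L W (r, c) (r', c') \<longleftrightarrow> r' \<in> R' \<and> r = pred r' \<and> c = f r \<and> c' = f r'" for r c r' c'
    proof
      assume c: "consecutive_corners L W (r, c) (r', c')"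
      then have "r \<in> R" "r' \<in> R" "r < r'" "c = f r" "c' = f r'" using O by (auto simp: consecutive_corners_def)
      moreover have no: "\<not> (r < x \<and> x < r')" if "x \<in> R" for x
        using c O[of x "f x"] that unfolding consecutive_corners_def by force
      moreover have "r' \<in> R'" using calculation by (auto simp: R'_def)
      ultimately show "r' \<in> R' \<and> r = pred r' \<and> c = f r \<and> c' = f r'"
        using pred[of r'] by (metis le_neq_implies_less)
    next
      assume c: "r' \<in> R' \<and> r = pred r' \<and> c = f r \<and> c' = f r'"
      then have p: "r \<in> R" "r < r'" "\<forall>x\<in>R. x < r' \<longrightarrow> x \<le> r" "r' \<in> R" using pred by (auto simp: R'_def)
      have "(r, c) \<in> ?O" "(r', c') \<in> ?O" using p c O by auto
      moreover have "\<not> (fst (r, c) < fst E \<and> fst E < fst (r', c'))" if "E \<in> ?O" for E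
        using p(3) that O[of "fst E" "snd E"] by auto
      ultimately show "consecutive_corners L W (r, c) (r', c')" using p unfolding consecutive_corners_def by auto
    qed
    have "(r', c) \<in> ?I \<longleftrightarrow> (r', c) \<in> (\<lambda>r. (r, f (pred r))) ` R' \<inter> boxes L" for r' c
      unfolding inner_corners_iff con by auto
    then show ?thesis by auto
  qed
  have eps: "eps_gp L W C * g = (if C \<in> ?O then g else 0) - (if C \<in> ?I then g else 0)" for C g
    using outer_inner_disjoint by (auto simp: eps_gp_def)
  have "(\<Sum>C\<in>plus_boxes L. eps_gp L W C * ?g C) =
      (\<Sum>C\<in>plus_boxes L. if C \<in> ?O then ?g C else 0) - (\<Sum>C\<in>plus_boxes L. if C \<in> ?I then ?g C else 0)"
    unfolding eps by (rule sum_subtractf)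
  also have "(\<Sum>C\<in>plus_boxes L. if C \<in> ?O then ?g C else 0) = sum ?g ?O"
    using finite_plus_boxes outer_corners_plus by (subst sum.inter_restrict[symmetric]) (auto simp: Int_absorb1)
  also have "(\<Sum>C\<in>plus_boxes L. if C \<in> ?I then ?g C else 0) = sum ?g ?I"
    using finite_plus_boxes inner_corners_plus by (subst sum.inter_restrict[symmetric]) (auto simp: Int_absorb1)
  also have "sum ?g ?O = (\<Sum>r\<in>R. int (depth (weak_se r (f r)) a b))"
  proof -
    have "?O = (\<lambda>r. (r, f r)) ` R" using O by auto
    then show ?thesis by (simp add: sum.reindex inj_on_def)
  qed
  also have "sum ?g ?I = (\<Sum>r\<in>R'. int (depth (weak_se r (f (pred r))) a b))"
  proof -
    have "sum ?g ?I = sum ?g ((\<lambda>r. (r, f (pred r))) ` R')"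
    proof (rule sum.mono_neutral_left)
      show "finite ((\<lambda>r. (r, f (pred r))) ` R')" using finR by (simp add: R'_def)
      show "?I \<subseteq> (\<lambda>r. (r, f (pred r))) ` R'" using I by blast
      \<comment> \<open>Consecutive outer corners may belong to different paths; the place of the
        inner corner can then lie beyond the border, where its quadrant is empty and has depth
        0.\<close>
      show "\<forall>C\<in>(\<lambda>r. (r, f (pred r))) ` R' - ?I. ?g C = 0"
      proof
        fix C assume "C \<in> (\<lambda>r. (r, f (pred r))) ` R' - ?I"
        then obtain r where r: "r \<in> R'" "C = (r, f (pred r))" "(r, f (pred r)) \<notin> boxes L" using I by auto
        have "1 \<le> r" using boxO[of r] boxesD r(1) by (auto simp: R'_def)
        moreover have "f (pred r) \<le> width L" using boxO[of "pred r"] boxesD pred[OF r(1)] by blast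
        ultimately have "weak_se r (f (pred r)) = {}" using weak_se_empty r(3) by blast
        then show "?g C = 0" using r(2) by (simp add: depth_outside)
      qed
    qed
    then show ?thesis by (simp add: sum.reindex inj_on_def)
  qed
  also have "(\<Sum>r\<in>R. int (depth (weak_se r (f r)) a b)) - (\<Sum>r\<in>R'. int (depth (weak_se r (f (pred r))) a b)) =
      int (depth (\<Union>r\<in>R. weak_se r (f r)) a b)"
    unfolding R'_def pred_def by (rule depth_staircase[symmetric, OF finR incr])
  finally show ?thesis unfolding union .
qed

end

lemma eps_depth_sum:
  assumes plus: "(r, c) \<in> plus_boxes L"
  shows "(\<Sum>C\<in>plus_boxes L. eps L (r, c) C * int (depth (weak_se (fst C) (snd C)) a b)) =
    (if (a, b) \<in> face_of L (r, c) then 1 else 0)"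
proof -
  let ?U = "U_path L (r, c)" and ?D = "D_path L (r, c)"
  let ?S = "\<lambda>W. \<Sum>C\<in>plus_boxes L. eps_gp L W C * int (depth (weak_se (fst C) (snd C)) a b)"
  note U = U_path_gp[OF plus] and D = D_path_gp[OF plus]
  have diff: "?S W - ?S (next_gp L W) = (if (a, b) \<in> gp_southeast L W then 1 else 0)" if W: "generalized_path L W" for W
    unfolding eps_gp_depth_sum[OF W] eps_gp_depth_sum[OF next_gp(1)[OF W]] next_gp(2)[OF W]
    by (rule depth_minus_deep[OF gp_graph_bounded[OF W]])
  have "(\<Sum>C\<in>plus_boxes L. eps L (r, c) C * int (depth (weak_se (fst C) (snd C)) a b)) =
      (?S ?U - ?S (next_gp L ?U)) - (?S ?D - ?S (next_gp L ?D))"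
    unfolding eps_def sum_subtractf[symmetric] left_diff_distrib ..
  also have "\<dots> = (if (a, b) \<in> face_of L (r, c) then 1 else 0)"
    unfolding diff[OF U(1)] diff[OF D(1)] U(2) D(2) using face_subset_weak_se[OF plus] by auto
  finally show ?thesis .
qed

text \<open>After exchanging the products, the exponent of \<open>T B\<close> is the signed depth
  sum at \<open>B\<close>. It is the indicator of the face of \<open>(r, c)\<close>, which contains
  no other \<open>+\<close> box.\<close>

lemma weight_recovery:
  fixes T :: "box \<Rightarrow> real"
  assumes T: "\<And>B. B \<in> plus_boxes L \<Longrightarrow> 0 < T B" and plus: "(r, c) \<in> plus_boxes L"
  shows "(\<Prod>C\<in>plus_boxes L. (\<Prod>B\<in>plus_boxes L. T B ^ depth (weak_se (fst C) (snd C)) (fst B) (snd B))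
    powi eps L (r, c) C) = T (r, c)"
proof -
  let ?d = "\<lambda>C B. depth (weak_se (fst C) (snd C)) (fst B) (snd B)"
  have "(\<Prod>C\<in>plus_boxes L. (\<Prod>B\<in>plus_boxes L. T B ^ ?d C B) powi eps L (r, c) C) =
      (\<Prod>C\<in>plus_boxes L. \<Prod>B\<in>plus_boxes L. T B powi (eps L (r, c) C * int (?d C B)))"
    unfolding power_int_prod by (simp only: power_int_power mult.commute)
  also have "\<dots> = (\<Prod>B\<in>plus_boxes L. \<Prod>C\<in>plus_boxes L. T B powi (eps L (r, c) C * int (?d C B)))"
    by (rule prod.swap)
  also have "\<dots> = (\<Prod>B\<in>plus_boxes L. if B = (r, c) then T B else 1)"
  proof (rule prod.cong[OF refl])
    fix B assume B: "B \<in> plus_boxes L"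
    have "(\<Prod>C\<in>plus_boxes L. T B powi (eps L (r, c) C * int (?d C B))) =
        T B powi (\<Sum>C\<in>plus_boxes L. eps L (r, c) C * int (?d C B))"
      using T[OF B] by (simp add: power_int_sum)
    also have "\<dots> = T B powi (if B = (r, c) then 1 else 0)"
      unfolding eps_depth_sum[OF plus] using face_inter_plus[OF plus B] by simp
    finally show "(\<Prod>C\<in>plus_boxes L. T B powi (eps L (r, c) C * int (?d C B))) = (if B = (r, c) then T B else 1)"
      by simp
  qed
  also have "\<dots> = T (r, c)" using finite_plus_boxes plus by (simp add: prod.delta)
  finally show ?thesis .
qed

end

section \<open>The formula for the Le-coordinates\<close>

theorem theorem4p1:
  fixes L :: le_diagram and T :: "box \<Rightarrow> real" and x :: "real vec set" and B :: box
  assumes "is_le_diagram L"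
    and "is_le_tableau L T"
    and "x \<in> tnn_cell (dim_k L) (dim_n L) (le_matroid L)"
    and "is_meas L T x"
    and "B \<in> boxes L"
  shows "T B =
    (if P L x (M L B) = 0 then 0
     else (\<Prod>C\<in>plus_boxes L. P L x (M L C) powi eps L B C))"
proof -
  interpret le_diag L using assms(1) by unfold_locales
  obtain a where a: "a \<noteq> 0"
    "\<And>J. J \<in> k_subsets (dim_k L) (dim_n L) \<Longrightarrow> plucker (dim_k L) (dim_n L) x J = a * meas_coord L T J"
    using assms(4) by (auto simp: is_meas_def)
  \<comment> \<open>Dividing by the coordinate of the sources cancels \<open>a\<close>, because
    \<open>meas_coord\<close> is 1 there.\<close>
  have P: "P L x J = meas_coord L T J" if "J \<in> k_subsets (dim_k L) (dim_n L)" for J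
    using a(1) a(2)[OF that] a(2)[OF sources_k_subset] by (simp add: P_def meas_coord_sources)
  have PM: "P L x (M L C) = meas_coord L T (M L C)" if "C \<in> boxes L" for C
    using P M_k_subset that by (cases C) simp
  obtain r c where B: "B = (r, c)" by (cases B)
  show ?thesis
  proof (cases "B \<in> plus_boxes L")
    case True
    have pos: "0 < T C" if "C \<in> plus_boxes L" for C
      using assms(2) that by (simp add: is_le_tableau_def)
    have PM': "P L x (M L C) = (\<Prod>D\<in>plus_boxes L. T D ^ depth (weak_se (fst C) (snd C)) (fst D) (snd D))"
      if "C \<in> plus_boxes L" for C
    proof -
      have "C \<in> boxes L" using that plus_boxes_subset by blast
      then show ?thesis using PM[of C] meas_coord_M[of "fst C" "snd C"] that by simp
    qed
    have "0 < P L x (M L B)"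
      unfolding PM'[OF True] using pos by (simp add: prod_pos)
    moreover have "(\<Prod>C\<in>plus_boxes L. P L x (M L C) powi eps L B C) = T B"
      using weight_recovery[of T r c] pos True B PM' by simp
    ultimately show ?thesis by simp
  next
    case False
    then have "T B = 0" using assms(2,5) by (simp add: is_le_tableau_def)
    moreover have "P L x (M L B) = 0"
      using PM[OF assms(5)] meas_coord_M_zero[of r c T] False assms(5) B by simp
    ultimately show ?thesis by simp
  qed
qed

end
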